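(* Let $d\ge 2$, let $\mathbf{x}\in\mathbb{R}^{n_1\times\cdots\times n_d}$, let $r\ge 1$ and $p\ge 4$ be integers and set $s=r+p$. Run the following randomized TT-SVD on $\mathbf{x}$ with target rank $s$: Set $\mathbf{b}_{d+1}:=\mathbf{x}$. For $j=d,d-1,\dots,2$: (i) draw a tensor $\mathbf{g}\in\mathbb{R}^{s\times n_1\times\cdots\times n_{j-1}}$ with i.i.d. standard Gaussian entries, independently of all previous steps; (ii) form $\mathbf{a}_j:=\mathbf{g}\circ_{(2,\dots,j),(1,\dots,j-1)}\mathbf{b}_{j+1}$ (contracting modes $2,\dots,j$ of $\mathbf{g}$ with modes $1,\dots,j-1$ of $\mathbf{b}_{j+1}$), so $\mathbf{a}_d\in\mathbb{R}^{s\times n_d}$ and, for $j<d$, $\mathbf{a}_j\in\mathbb{R}^{s\times n_j\times q_j}$; (iii) compute a factorization $\mathbf{R}_j\mathbf{Q}_j=\hat M_{\{1\}}(\mathbf{a}_j)$ in which $\mathbf{Q}_j$ has orthonormal rows spanning the row space of $\hat M_{\{1\}}(\mathbf{a}_j)$; let $q_{j-1}$ be the number of rows of $\mathbf{Q}_j$, and let $\mathbf{W}_j:=\hat M^{-1}(\mathbf{Q}_j)$, so $\mathbf{W}_d\in\mathbb{R}^{q_{d-1}\times n_d}$ and $\mathbf{W}_j\in\mathbb{R}^{q_{j-1}\times n_j\times q_j}$ for $j<d$; (iv) if $j=d$ set $\mathbf{b}_d:=\mathbf{b}_{d+1}\circ_{(d),(2)}\mathbf{W}_d$, otherwise set $\mathbf{b}_j:=\mathbf{b}_{j+1}\circ_{(j,j+1),(2,3)}\mathbf{W}_j$,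 so that $\mathbf{b}_j\in\mathbb{R}^{n_1\times\cdots\times n_{j-1}\times q_{j-1}}$. Finally set $\mathbf{W}_1:=\mathbf{b}_2\in\mathbb{R}^{n_1\times q_1}$ and $P_{2..d}(\mathbf{x}):=\mathbf{W}_1\circ\mathbf{W}_2\circ\cdots\circ\mathbf{W}_d$. Then for every $u,t\ge 1$, $$\|\mathbf{x}-P_{2..d}(\mathbf{x})\|\le\sqrt{d-1}\;\eta\;\min_{\mathbf{y}:\ \text{TT-rank}(\mathbf{y})\preceq(r,\dots,r)}\|\mathbf{x}-\mathbf{y}\|,\qquad \eta=1+t\sqrt{\frac{12r}{p}}+ut\,\frac{e\sqrt{r+p}}{p+1},$$ with probability at least $\left(1-5t^{-p}-2e^{-u^2/2}\right)^{d-1}$.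
   Context: $\|\cdot\|$ is the Euclidean (Frobenius) norm of the entries. For a tensor $\mathbf{x}$ and a set of modes $\alpha$, $\hat M_\alpha(\mathbf{x})$ is the matricization whose row index combines the modes in $\alpha$ and whose column index combines the remaining modes (with a fixed consistent bijection of multi-indices); $\hat M^{-1}$ is the inverse reshaping (here $\hat M^{-1}(\mathbf{Q}_j)$ reshapes the $q_{j-1}\times(n_jq_j)$ matrix into a $q_{j-1}\times n_j\times q_j$ tensor, and is the identity for $j=d$). For tensors $\mathbf{x},\mathbf{y}$, $\mathbf{x}\circ_{k,l}\mathbf{y}$ denotes summation over a common index placed in mode $k$ of $\mathbf{x}$ and mode $l$ of $\mathbf{y}$, the result carrying the remaining modes of $\mathbf{x}$ followed by the remaining modes of $\mathbf{y}$; tuples of index pairs mean contracting each pair; plain $\circ$ contracts the last mode of the left factor with the first mode of the right factor. A TT representation of $\mathbf{y}$ is $\mathbf{y}=\mathbf{V}_1\circ\cdots\circ\mathbf{V}_d$ with $\mathbf{V}_1\in\mathbb{R}^{n_1\times r_1}$, $\mathbf{V}_i\in\mathbb{R}^{r_{i-1}\times n_i\times r_i}$, $\mathbf{V}_d\in\mathbb{R}^{r_{d-1}\times n_d}$; the TT-rank of $\mathbf{y}$ is the entrywise minimal such $(r_1,\dots,r_{d-1})$, equivalently $r_i=\operatorname{rank}\hat M_{\{1,\dots,i\}}(\mathbf{y})$. $\preceq$ denotes entrywise $\le$.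
   Formalization: The probability bound is taken as max(0, 1−5t^{-p}−2e^{-u²/2})^{d−1}, since for a negative base and even d−1 the stated power can exceed 1 (for example d=3, u=t=1 gives about 27). *)

theory Defs
  imports "HOL-Probability.Probability"
begin

text \<open>Tensors are functions on multi-indices (nat lists); their shape (list of mode sizes)
  is carried separately. Modes are numbered from 0 here (mode k+1 of the paper is mode k).\<close>

definition idx :: "nat list \<Rightarrow> nat list set" where
  "idx ns = {is. length is = length ns \<and> (\<forall>k<length ns. is ! k < ns ! k)}"

definition tnorm :: "nat list \<Rightarrow> (nat list \<Rightarrow> real) \<Rightarrow> real" where
  "tnorm ns x = sqrt (\<Sum>is\<in>idx ns. (x is)\<^sup>2)"

definition drop_modes :: "nat list \<Rightarrow> 'a list \<Rightarrow> 'a list" where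
  "drop_modes ks a = [a ! i. i \<leftarrow> [0..<length a], i \<notin> set ks]"

definition contract ::
  "nat list \<Rightarrow> (nat list \<Rightarrow> real) \<Rightarrow> nat list \<Rightarrow> (nat list \<Rightarrow> real) \<Rightarrow> nat list \<Rightarrow> nat list
     \<Rightarrow> (nat list \<Rightarrow> real)" where
  "contract xd x yd y ks ls = (\<lambda>r. \<Sum>(a, b) \<in> {(a, b). a \<in> idx xd \<and> b \<in> idx yd \<and>
      drop_modes ks a @ drop_modes ls b = r \<and> (\<forall>k<length ks. a ! (ks ! k) = b ! (ls ! k))}.
      x a * y b)"

definition contract_dims :: "nat list \<Rightarrow> nat list \<Rightarrow> nat list \<Rightarrow> nat list \<Rightarrow> nat list" where
  "contract_dims xd yd ks ls = drop_modes ks xd @ drop_modes ls yd"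

definition tcomp ::
  "nat list \<times> (nat list \<Rightarrow> real) \<Rightarrow> nat list \<times> (nat list \<Rightarrow> real) \<Rightarrow> nat list \<times> (nat list \<Rightarrow> real)" where
  "tcomp X Y = (contract_dims (fst X) (fst Y) [length (fst X) - 1] [0],
                contract (fst X) (snd X) (fst Y) (snd Y) [length (fst X) - 1] [0])"

definition tt_prod :: "(nat list \<times> (nat list \<Rightarrow> real)) list \<Rightarrow> nat list \<times> (nat list \<Rightarrow> real)" where
  "tt_prod cs = foldl tcomp (hd cs) (tl cs)"

definition tt_core_dims :: "nat list \<Rightarrow> nat list \<Rightarrow> nat \<Rightarrow> nat list" where
  "tt_core_dims ns rs i =
     (if i = 0 then [ns ! 0, rs ! 0]
      else if i = length ns - 1 then [rs ! (i - 1), ns ! i]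
      else [rs ! (i - 1), ns ! i, rs ! i])"

definition tt_representable :: "nat list \<Rightarrow> (nat list \<Rightarrow> real) \<Rightarrow> nat list \<Rightarrow> bool" where
  "tt_representable ns y rs \<longleftrightarrow> length rs = length ns - 1 \<and>
     (\<exists>V :: nat \<Rightarrow> nat list \<Rightarrow> real. \<forall>is\<in>idx ns.
        y is = snd (tt_prod (map (\<lambda>i. (tt_core_dims ns rs i, V i)) [0..<length ns])) is)"

definition tt_rank :: "nat list \<Rightarrow> (nat list \<Rightarrow> real) \<Rightarrow> nat list" where
  "tt_rank ns y = (THE rs. tt_representable ns y rs \<and>
      (\<forall>rs'. tt_representable ns y rs' \<longrightarrow> list_all2 (\<le>) rs rs'))"

definition in_row_span :: "nat list \<Rightarrow> nat \<Rightarrow> (nat list \<Rightarrow> real) \<Rightarrow> (nat list \<Rightarrow> real) \<Rightarrow> bool" where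
  "in_row_span cd m A v \<longleftrightarrow> (\<exists>c :: nat \<Rightarrow> real. \<forall>i\<in>idx cd. v i = (\<Sum>k<m. c k * A (k # i)))"

text \<open>Shapes occurring in the randomized TT-SVD (paper's 1-based step index j, 2 \<le> j \<le> d).\<close>
definition rt_bdims :: "nat list \<Rightarrow> (nat \<Rightarrow> nat) \<Rightarrow> nat \<Rightarrow> nat list" where
  "rt_bdims ns q j = (if j = length ns + 1 then ns else take (j - 1) ns @ [q (j - 1)])"

definition rt_adims :: "nat list \<Rightarrow> nat \<Rightarrow> (nat \<Rightarrow> nat) \<Rightarrow> nat \<Rightarrow> nat list" where
  "rt_adims ns s q j = s # (if j = length ns then [ns ! (j - 1)] else [ns ! (j - 1), q j])"

definition rt_Wdims :: "nat list \<Rightarrow> nat \<Rightarrow> (nat \<Rightarrow> nat) \<Rightarrow> nat \<Rightarrow> nat list" where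
  "rt_Wdims ns s q j = q (j - 1) # tl (rt_adims ns s q j)"

definition rt_a ::
  "nat list \<Rightarrow> nat \<Rightarrow> (nat \<Rightarrow> nat) \<Rightarrow> (nat \<Rightarrow> nat list \<Rightarrow> real) \<Rightarrow> (nat \<Rightarrow> nat list \<Rightarrow> real)
     \<Rightarrow> nat \<Rightarrow> nat list \<Rightarrow> real" where
  "rt_a ns s q g b j = contract (s # take (j - 1) ns) (g j) (rt_bdims ns q (j + 1)) (b (j + 1))
      [1..<j] [0..<j - 1]"

text \<open>A possible run of the randomized TT-SVD on x (shape ns) with target rank s and Gaussian
  draws g j (shape s # n_1..n_{j-1}), producing ranks q j, cores W j (j = 2..d) and the
  intermediate tensors b j (j = 2..d+1). The orthonormal-row factor Q_j is any matrix with
  orthonormal rows spanning the row space of the first-mode matricization of a_j;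
  W j is its reshaping (rows indexed by the first mode).\<close>
definition rt_run ::
  "nat list \<Rightarrow> (nat list \<Rightarrow> real) \<Rightarrow> nat \<Rightarrow> (nat \<Rightarrow> nat list \<Rightarrow> real)
     \<Rightarrow> (nat \<Rightarrow> nat) \<Rightarrow> (nat \<Rightarrow> nat list \<Rightarrow> real) \<Rightarrow> (nat \<Rightarrow> nat list \<Rightarrow> real) \<Rightarrow> bool" where
  "rt_run ns x s g q W b \<longleftrightarrow> (let d = length ns in
     b (d + 1) = x \<and>
     (\<forall>j\<in>{2..d}.
        let a = rt_a ns s q g b j; cd = tl (rt_adims ns s q j) in
        (\<forall>k<q (j - 1). \<forall>k'<q (j - 1).
           (\<Sum>c\<in>idx cd. W j (k # c) * W j (k' # c)) = (if k = k' then 1 else 0)) \<and>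
        (\<forall>k<q (j - 1). in_row_span cd s a (\<lambda>c. W j (k # c))) \<and>
        (\<forall>k<s. in_row_span cd (q (j - 1)) (W j) (\<lambda>c. a (k # c))) \<and>
        b j = (if j = d
               then contract (rt_bdims ns q (j + 1)) (b (j + 1)) (rt_Wdims ns s q j) (W j) [j - 1] [1]
               else contract (rt_bdims ns q (j + 1)) (b (j + 1)) (rt_Wdims ns s q j) (W j)
                      [j - 1, j] [1, 2])))"

definition rt_output ::
  "nat list \<Rightarrow> nat \<Rightarrow> (nat \<Rightarrow> nat) \<Rightarrow> (nat \<Rightarrow> nat list \<Rightarrow> real) \<Rightarrow> (nat \<Rightarrow> nat list \<Rightarrow> real)
     \<Rightarrow> nat list \<Rightarrow> real" where
  "rt_output ns s q W b = snd (tt_prod ((rt_bdims ns q 2, b 2) #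
      map (\<lambda>j. (rt_Wdims ns s q j, W j)) [2..<length ns + 1]))"

definition rt_gauss_index :: "nat list \<Rightarrow> nat \<Rightarrow> (nat \<times> nat list) set" where
  "rt_gauss_index ns s = {(j, is). 2 \<le> j \<and> j \<le> length ns \<and> is \<in> idx (s # take (j - 1) ns)}"

definition rt_measure :: "nat list \<Rightarrow> nat \<Rightarrow> (nat \<times> nat list \<Rightarrow> real) measure" where
  "rt_measure ns s = PiM (rt_gauss_index ns s) (\<lambda>_. density lborel std_normal_density)"

end

theory Submission
  imports Defs
begin

text \<open>
  The error splits orthogonally over the \<open>d - 1\<close> steps, because the cores computed so far always
  have orthonormal rows. Each step is a randomized range finder applied to an unfolding whose
  distance to the matrices of rank at most \<open>r\<close> is no larger than the distance of \<open>x\<close> to the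
  tensors of TT-rank at most \<open>r\<close>: projections acting on the column modes neither increase ranks nor
  distances. The steps are then combined by Fubini.

  For one step write the sketch as \<open>G B = G1 C + G2 D\<close>, where \<open>C\<close> collects the coordinates of \<open>B\<close>
  along an \<open>r\<close>-dimensional space and \<open>D\<close> the remaining ones. With a left inverse \<open>L\<close> of \<open>G1\<close>,
  the squared error is at most \<open>|D|^2 + |L G2 D|^2\<close>. By a polar decomposition of \<open>L\<close>, the
  quantity \<open>|L G2 D|\<close> has, for fixed \<open>G1\<close>, the same law as \<open>|L^T N D|\<close> for a Gaussian \<open>N\<close> with \<open>r\<close>
  rows. Chernoff's bound controls \<open>|N D|\<close>; for fixed \<open>N\<close>, each column of \<open>L^T\<close> has, in every
  direction, the length of the inverse of a distance of a Gaussian vector to a subspace of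
  codimension at least \<open>p + 1\<close>, whose \<open>p\<close>-th moment is bounded by a Gamma integral. In contrast
  to the usual argument this needs no concentration inequality for Lipschitz functions and no bound
  for the smallest singular value of a Gaussian matrix.
\<close>

section \<open>Orthogonal residuals\<close>

text \<open>A run may choose its orthonormal bases in any way, even a non-measurable one. The
  probabilistic part therefore never mentions \<open>W\<close>, \<open>q\<close> or
  \<open>b\<close>: a projection onto a row space does not depend on a basis, so all runs on the
  same draws have the same squared error, and it is a measurable function of the draws. A direct
  bound on \<open>|L G2 D|\<close> for given \<open>L\<close> would call for several matrix norms of
  \<open>L\<close>. After the polar exchange \<open>N\<close> meets only the fixed matrix
  \<open>D\<close>, and \<open>L\<close> enters only through lengths of combinations of its rows
  whose coefficients are independent of it, so scalar moments suffice. The failure probability has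
  two sources: \<open>exp (- u\<^sup>2 / 2)\<close> pays for \<open>|N D|^2\<close> exceeding
  \<open>2 (r + u\<^sup>2) |D|^2\<close>, and \<open>5 * t powr (- p)\<close> is Markov's inequality
  for the \<open>p\<close>-th moment. The \<open>exp 1\<close> in the error factor comes from the
  Stirling-type bound \<open>Gamma (a + 1) \<ge> a powr a * exp (- a)\<close>. The factor
  \<open>sqrt (d - 1)\<close> arises because \<open>d - 1\<close> squared errors with a common bound
  are added.\<close>

definition ip :: "'a set \<Rightarrow> ('a \<Rightarrow> real) \<Rightarrow> ('a \<Rightarrow> real) \<Rightarrow> real" where
  "ip A v w = (\<Sum>i\<in>A. v i * w i)"

abbreviation sq_norm :: "'a set \<Rightarrow> ('a \<Rightarrow> real) \<Rightarrow> real" where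
  "sq_norm A v \<equiv> ip A v v"

definition orthonormal :: "'a set \<Rightarrow> 'k set \<Rightarrow> ('k \<Rightarrow> 'a \<Rightarrow> real) \<Rightarrow> bool" where
  "orthonormal A K e \<longleftrightarrow> (\<forall>k\<in>K. \<forall>l\<in>K. ip A (e k) (e l) = (if k = l then 1 else 0))"

definition in_span :: "'a set \<Rightarrow> (nat \<Rightarrow> 'a \<Rightarrow> real) \<Rightarrow> nat \<Rightarrow> ('a \<Rightarrow> real) \<Rightarrow> bool" where
  "in_span A h n z \<longleftrightarrow> (\<exists>c. \<forall>i\<in>A. z i = (\<Sum>k<n. c k * h k i))"

text \<open>Gram--Schmidt without a rank assumption: when \<open>h n\<close> depends on the earlier vectors, its residual
  vanishes and the quotient \<open>0 / 0 = 0\<close> skips it.\<close>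
primrec residual :: "'a set \<Rightarrow> (nat \<Rightarrow> 'a \<Rightarrow> real) \<Rightarrow> nat \<Rightarrow> ('a \<Rightarrow> real) \<Rightarrow> 'a \<Rightarrow> real" where
  "residual A h 0 v = v"
| "residual A h (Suc n) v = (\<lambda>i. residual A h n v i -
     ip A (residual A h n v) (residual A h n (h n)) / ip A (residual A h n (h n)) (residual A h n (h n))
       * residual A h n (h n) i)"

lemma ip_commute: "ip A v w = ip A w v"
  by (simp add: ip_def mult.commute)

lemma ip_cong: "(\<And>i. i \<in> A \<Longrightarrow> v i = v' i) \<Longrightarrow> (\<And>i. i \<in> A \<Longrightarrow> w i = w' i) \<Longrightarrow> ip A v w = ip A v' w'"
  unfolding ip_def by (rule sum.cong) auto

lemma ip_diff_left: "ip A (\<lambda>i. v i - v' i) w = ip A v w - ip A v' w"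
  by (simp add: ip_def sum_subtractf left_diff_distrib)

lemma ip_diff_right: "ip A w (\<lambda>i. v i - v' i) = ip A w v - ip A w v'"
  by (simp add: ip_def sum_subtractf right_diff_distrib)

lemma ip_scale_left: "ip A (\<lambda>i. c * v i) w = c * ip A v w"
  by (simp add: ip_def sum_distrib_left mult.assoc)

lemma ip_scale_right: "ip A w (\<lambda>i. c * v i) = c * ip A w v"
  by (simp add: ip_def sum_distrib_left mult_ac)

lemma ip_sum_left: "ip A (\<lambda>i. \<Sum>k\<in>K. c k * h k i) w = (\<Sum>k\<in>K. c k * ip A (h k) w)"
  unfolding ip_def sum_distrib_left sum_distrib_right by (subst sum.swap) (simp add: mult.assoc)

lemma ip_sum_right: "ip A w (\<lambda>i. \<Sum>k\<in>K. c k * h k i) = (\<Sum>k\<in>K. c k * ip A w (h k))"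
  by (subst ip_commute, subst ip_sum_left) (simp add: ip_commute)

lemma ip_self_nonneg [simp]: "0 \<le> sq_norm A v"
  by (simp add: ip_def sum_nonneg)

lemma ip_self_eq_0: "finite A \<Longrightarrow> sq_norm A v = 0 \<longleftrightarrow> (\<forall>i\<in>A. v i = 0)"
  by (simp add: ip_def sum_nonneg_eq_0_iff)

lemma ip_zero_left: "(\<And>i. i \<in> A \<Longrightarrow> v i = 0) \<Longrightarrow> ip A v w = 0"
  by (simp add: ip_def)

lemma orthonormalD: "orthonormal A K e \<Longrightarrow> k \<in> K \<Longrightarrow> l \<in> K \<Longrightarrow> ip A (e k) (e l) = (if k = l then 1 else 0)"
  by (simp add: orthonormal_def)

lemma ip_in_span_eq_0:
  assumes "in_span A h n z" "\<And>k. k < n \<Longrightarrow> ip A (h k) v = 0"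
  shows "ip A z v = 0"
proof -
  from assms(1) obtain c where c: "\<forall>i\<in>A. z i = (\<Sum>k<n. c k * h k i)" by (auto simp: in_span_def)
  have "ip A z v = ip A (\<lambda>i. \<Sum>k<n. c k * h k i) v" using c by (intro ip_cong) auto
  also have "\<dots> = 0" using assms(2) by (simp add: ip_sum_left)
  finally show ?thesis .
qed

lemma in_span_diff:
  assumes "in_span A h n y" "in_span A h n z" shows "in_span A h n (\<lambda>i. y i - z i)"
proof -
  from assms obtain c d where "\<forall>i\<in>A. y i = (\<Sum>k<n. c k * h k i)" "\<forall>i\<in>A. z i = (\<Sum>k<n. d k * h k i)"
    by (auto simp: in_span_def)
  then show ?thesis unfolding in_span_def
    by (intro exI[of _ "\<lambda>k. c k - d k"]) (simp add: left_diff_distrib sum_subtractf)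
qed

lemma in_span_sum:
  assumes "\<And>k. k \<in> K \<Longrightarrow> in_span A h n (y k)"
  shows "in_span A h n (\<lambda>i. \<Sum>k\<in>K. c k * y k i)"
proof -
  from assms have "\<forall>k\<in>K. \<exists>d. \<forall>i\<in>A. y k i = (\<Sum>l<n. d l * h l i)" by (auto simp: in_span_def)
  then obtain d where d: "\<forall>k\<in>K. \<forall>i\<in>A. y k i = (\<Sum>l<n. d k l * h l i)" by metis
  have "(\<Sum>k\<in>K. c k * y k i) = (\<Sum>l<n. (\<Sum>k\<in>K. c k * d k l) * h l i)" if "i \<in> A" for i
  proof -
    have "(\<Sum>k\<in>K. c k * y k i) = (\<Sum>k\<in>K. \<Sum>l<n. c k * d k l * h l i)"
      using d that by (intro sum.cong) (auto simp: sum_distrib_left mult.assoc)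
    also have "\<dots> = (\<Sum>l<n. (\<Sum>k\<in>K. c k * d k l) * h l i)"
      by (subst sum.swap) (simp add: sum_distrib_right)
    finally show ?thesis .
  qed
  then show ?thesis unfolding in_span_def by (intro exI[of _ "\<lambda>l. \<Sum>k\<in>K. c k * d k l"]) auto
qed

lemma in_span_member: "k < n \<Longrightarrow> in_span A h n (h k)"
  unfolding in_span_def by (rule exI[of _ "\<lambda>l. if l = k then 1 else 0"]) (simp add: if_distrib[of "\<lambda>c. c * _"] sum.delta cong: if_cong)

lemma in_span_trans:
  assumes "in_span A h n z" "\<And>k. k < n \<Longrightarrow> in_span A h' n' (h k)"
  shows "in_span A h' n' z"
proof -
  from assms(1) obtain c where c: "\<forall>i\<in>A. z i = (\<Sum>k<n. c k * h k i)" by (auto simp: in_span_def)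
  have "in_span A h' n' (\<lambda>i. \<Sum>k\<in>{..<n}. c k * h k i)" by (rule in_span_sum) (use assms(2) in auto)
  then show ?thesis using c by (simp add: in_span_def)
qed

lemma in_span_cong:
  assumes "\<And>i. i \<in> A \<Longrightarrow> z i = z' i" shows "in_span A h n z \<longleftrightarrow> in_span A h n z'"
  using assms by (simp add: in_span_def)

lemma residual_span: "in_span A h n (\<lambda>i. v i - residual A h n v i)"
proof (induction n arbitrary: v)
  case 0
  then show ?case by (simp add: in_span_def)
next
  case (Suc n)
  define w where "w = residual A h n (h n)"
  define a where "a = ip A (residual A h n v) w / sq_norm A w"
  obtain c where c: "\<forall>i\<in>A. v i - residual A h n v i = (\<Sum>k<n. c k * h k i)"
    using Suc[of v] by (auto simp: in_span_def)
  obtain d where d: "\<forall>i\<in>A. h n i - w i = (\<Sum>k<n. d k * h k i)"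
    using Suc[of "h n"] by (auto simp: in_span_def w_def)
  show ?case unfolding in_span_def
  proof (intro exI[of _ "\<lambda>k. if k = n then a else c k - a * d k"] ballI)
    fix i assume i: "i \<in> A"
    have "(\<Sum>k<Suc n. (if k = n then a else c k - a * d k) * h k i)
        = a * h n i + (\<Sum>k<n. c k * h k i) - a * (\<Sum>k<n. d k * h k i)"
      by (simp add: left_diff_distrib sum_subtractf sum_distrib_left mult.assoc)
    also have "\<dots> = v i - residual A h n v i + a * w i"
      using c[rule_format, OF i] d[rule_format, OF i] by (simp add: algebra_simps)
    finally show "v i - residual A h (Suc n) v i = (\<Sum>k<Suc n. (if k = n then a else c k - a * d k) * h k i)"
      by (simp add: w_def a_def)
  qed
qed

lemma residual_orth:
  assumes "finite A"
  shows "k < n \<Longrightarrow> ip A (residual A h n v) (h k) = 0"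
proof (induction n arbitrary: v k)
  case (Suc n)
  define w where "w = residual A h n (h n)"
  define r where "r = residual A h n v"
  define a where "a = ip A r w / sq_norm A w"
  have res: "residual A h (Suc n) v = (\<lambda>i. r i - a * w i)"
    by (simp add: r_def a_def w_def)
  have ort: "ip A (residual A h (Suc n) v) (h l) = 0" if "l < n" for l
    using Suc.IH[OF that, of v] Suc.IH[OF that, of "h n"]
    by (simp only: res ip_diff_left ip_scale_left) (simp add: r_def w_def)
  show ?case
  proof (cases "k = n")
    case True
    have "ip A (\<lambda>i. h n i - w i) (residual A h (Suc n) v) = 0"
      unfolding w_def by (rule ip_in_span_eq_0[OF residual_span]) (metis ip_commute ort)
    then have "ip A (residual A h (Suc n) v) (h n) = ip A (residual A h (Suc n) v) w"
      by (simp add: ip_diff_left ip_commute del: residual.simps)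
    also have "\<dots> = ip A r w - a * sq_norm A w" by (simp only: res ip_diff_left ip_scale_left)
    also have "\<dots> = 0"
    proof (cases "sq_norm A w = 0")
      case True
      then have "ip A r w = 0" using assms by (subst ip_commute) (simp add: ip_self_eq_0 ip_zero_left)
      then show ?thesis using True by simp
    qed (simp add: a_def)
    finally show ?thesis using True by simp
  next
    case False
    then show ?thesis using Suc.prems ort[of k] by simp
  qed
qed simp

text \<open>Two candidates for the residual differ by a vector that lies in the span and is
  orthogonal to it, hence vanishes on \<open>A\<close>. This characterisation is what later yields
  linearity of the residual and its independence of the chosen spanning vectors.\<close>

lemma residual_unique:
  assumes "finite A" "in_span A h n (\<lambda>i. v i - z i)" "\<And>k. k < n \<Longrightarrow> ip A z (h k) = 0" "i \<in> A"
  shows "residual A h n v i = z i"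
proof -
  define w where "w = (\<lambda>i. residual A h n v i - z i)"
  have "in_span A h n w"
    using in_span_diff[OF assms(2) residual_span[of A h n v]]
    by (simp add: w_def)
  then have "sq_norm A w = 0"
    by (rule ip_in_span_eq_0)
      (use assms(3) residual_orth[OF assms(1)] in \<open>simp add: w_def ip_diff_right ip_commute[of A "h _"]\<close>)
  then show ?thesis using assms by (simp add: ip_self_eq_0 w_def)
qed

lemma residual_pythagoras:
  assumes "finite A" "in_span A h n z"
  shows "sq_norm A (\<lambda>i. v i - z i) = sq_norm A (residual A h n v)
    + sq_norm A (\<lambda>i. v i - residual A h n v i - z i)"
proof -
  define r where "r = residual A h n v"
  define w where "w = (\<lambda>i. v i - r i - z i)"
  have "in_span A h n w" unfolding w_def r_def by (rule in_span_diff[OF residual_span assms(2)])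
  then have 0: "ip A w r = 0"
    by (rule ip_in_span_eq_0) (simp add: r_def ip_commute[of A "h _"] residual_orth[OF assms(1)])
  have "sq_norm A (\<lambda>i. v i - z i) = (\<Sum>i\<in>A. r i * r i + 2 * (w i * r i) + w i * w i)"
    unfolding ip_def by (rule sum.cong) (simp_all add: w_def algebra_simps)
  also have "\<dots> = sq_norm A r + 2 * ip A w r + sq_norm A w"
    by (simp add: ip_def sum.distrib sum_distrib_left)
  finally have "sq_norm A (\<lambda>i. v i - z i) = sq_norm A r + sq_norm A w" unfolding 0 by simp
  then show ?thesis unfolding w_def unfolding r_def .
qed

lemma residual_min:
  assumes "finite A" "in_span A h n z"
  shows "sq_norm A (residual A h n v) \<le> sq_norm A (\<lambda>i. v i - z i)"
  using residual_pythagoras[OF assms, of v] ip_self_nonneg[of A "\<lambda>i. v i - residual A h n v i - z i"] by linarith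

lemma in_span_0: "in_span A h n (\<lambda>i. 0)"
  unfolding in_span_def by (rule exI[of _ "\<lambda>_. 0"]) simp

lemma residual_orthonormal:
  assumes "finite A" "orthonormal A {..<n} e" "i \<in> A"
  shows "residual A e n v i = v i - (\<Sum>k<n. ip A v (e k) * e k i)"
proof (rule residual_unique[OF assms(1) _ _ assms(3)])
  show "in_span A e n (\<lambda>i. v i - (v i - (\<Sum>k<n. ip A v (e k) * e k i)))"
    by (auto simp: in_span_def)
next
  fix l assume "l < n"
  have "(\<Sum>k<n. ip A v (e k) * ip A (e k) (e l)) = (\<Sum>k<n. if k = l then ip A v (e k) else 0)"
    using \<open>l < n\<close> orthonormalD[OF assms(2)] by (intro sum.cong) auto
  then show "ip A (\<lambda>i. v i - (\<Sum>k<n. ip A v (e k) * e k i)) (e l) = 0"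
    using \<open>l < n\<close> by (simp add: ip_diff_left ip_sum_left)
qed

lemma bessel:
  fixes e :: "nat \<Rightarrow> 'a \<Rightarrow> real"
  assumes "finite A" "orthonormal A {..<n} e"
  shows "(\<Sum>k<n. (ip A v (e k))\<^sup>2) \<le> sq_norm A v"
proof -
  have "sq_norm A (residual A e n v) = ip A (residual A e n v) v"
    using ip_in_span_eq_0[OF residual_span[of A e n v], of "residual A e n v"] residual_orth[OF assms(1)]
    by (simp add: ip_diff_left ip_commute)
  also have "\<dots> = ip A (\<lambda>i. v i - (\<Sum>k<n. ip A v (e k) * e k i)) v"
    by (rule ip_cong) (use residual_orthonormal[OF assms] in auto)
  also have "\<dots> = sq_norm A v - (\<Sum>k<n. (ip A v (e k))\<^sup>2)"
    by (simp add: ip_diff_left ip_sum_left power2_eq_square ip_commute[of A "e _"])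
  finally show ?thesis using ip_self_nonneg[of A "residual A e n v"] by linarith
qed

section \<open>Dimension counting by traces\<close>

lemma ip_delta: "finite A \<Longrightarrow> i \<in> A \<Longrightarrow> ip A (\<lambda>j. if j = i then 1 else 0) v = v i"
  by (simp add: ip_def if_distrib[of "\<lambda>c. c * _"] cong: if_cong)

text \<open>Each summand is the squared distance of a coordinate vector to the span of the
  \<open>e k\<close>, so the sum is the trace of the projection onto the orthogonal complement. Its
  nonnegative terms take the place of dimension theory: they all vanish for a full system, and some
  term is positive for a smaller one.\<close>

lemma orthonormal_trace:
  assumes "finite A" "orthonormal A {..<n} e"
  shows "(\<Sum>i\<in>A. 1 - (\<Sum>k<n. (e k i)\<^sup>2)) = real (card A) - real n"
proof -
  have "(\<Sum>i\<in>A. \<Sum>k<n. (e k i)\<^sup>2) = (\<Sum>k<n. sq_norm A (e k))"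
    by (subst sum.swap) (simp add: ip_def power2_eq_square)
  also have "\<dots> = real n" using orthonormalD[OF assms(2)] by simp
  finally show ?thesis by (simp add: sum_subtractf)
qed

lemma orthonormal_coord_le:
  fixes e :: "nat \<Rightarrow> 'a \<Rightarrow> real"
  assumes "finite A" "orthonormal A {..<n} e" "i \<in> A"
  shows "(\<Sum>k<n. (e k i)\<^sup>2) \<le> 1"
  using bessel[OF assms(1,2), of "\<lambda>j. if j = i then 1 else 0"] assms by (simp add: ip_delta)

lemma orthonormal_card_le:
  assumes "finite A" "orthonormal A {..<n} e" shows "n \<le> card A"
proof -
  have "0 \<le> (\<Sum>i\<in>A. 1 - (\<Sum>k<n. (e k i)\<^sup>2))"
    by (rule sum_nonneg) (use orthonormal_coord_le[OF assms] in auto)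
  then show ?thesis using orthonormal_trace[OF assms] by simp
qed

text \<open>The trace is zero with nonnegative terms, so every coordinate vector has zero residual
  and equals its own expansion. Reading off one entry shows that a square matrix with orthonormal
  rows also has orthonormal columns.\<close>

lemma orthonormal_complete:
  assumes "finite A" "orthonormal A {..<card A} e" "i \<in> A" "j \<in> A"
  shows "(\<Sum>k<card A. e k i * e k j) = (if i = j then 1 else 0)"
proof -
  let ?d = "\<lambda>j. if j = i then 1 else 0 :: real"
  let ?r = "residual A e (card A) ?d"
  have "(\<Sum>i\<in>A. 1 - (\<Sum>k<card A. (e k i)\<^sup>2)) = 0" using orthonormal_trace[OF assms(1,2)] by simp
  then have 1: "1 - (\<Sum>k<card A. (e k i)\<^sup>2) = 0"
    using sum_nonneg_eq_0_iff[OF assms(1), of "\<lambda>i. 1 - (\<Sum>k<card A. (e k i)\<^sup>2)"]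
      orthonormal_coord_le[OF assms(1,2)] assms(3) by force
  have "sq_norm A ?r = ip A ?d ?r"
    using ip_in_span_eq_0[OF residual_span[of A e "card A" ?d], of ?r] residual_orth[OF assms(1)]
    by (simp add: ip_diff_left ip_commute)
  also have "\<dots> = ?r i" using assms by (simp add: ip_delta)
  also have "\<dots> = 0" using 1 residual_orthonormal[OF assms(1,2,3), of ?d] assms
    by (simp add: ip_delta power2_eq_square)
  finally have "?r j = 0" using assms by (simp add: ip_self_eq_0)
  then have "?d j = (\<Sum>k<card A. ip A ?d (e k) * e k j)"
    using residual_orthonormal[OF assms(1,2,4), of ?d] by simp
  also have "\<dots> = (\<Sum>k<card A. e k i * e k j)" using assms by (simp add: ip_delta)
  finally show ?thesis by (simp add: eq_commute)
qed

lemma orthonormal_snoc: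
  fixes e :: "nat \<Rightarrow> 'a \<Rightarrow> real"
  assumes "orthonormal A {..<q} e" "sq_norm A w = 1" "\<And>k. k < q \<Longrightarrow> ip A w (e k) = 0"
  shows "orthonormal A {..<Suc q} (e(q := w))"
  using assms by (auto simp: orthonormal_def less_Suc_eq ip_commute)

lemma ip_normalize:
  assumes "sq_norm A w \<noteq> 0"
  shows "sq_norm A (\<lambda>i. inverse (sqrt (sq_norm A w)) * w i) = 1"
proof -
  have "sqrt (sq_norm A w) * sqrt (sq_norm A w) = sq_norm A w" by simp
  then show ?thesis using assms
    by (simp only: ip_scale_left ip_scale_right) (simp add: field_simps)
qed

lemma orthonormal_spanning:
  assumes "finite A"
  shows "\<exists>q\<le>n. \<exists>e. orthonormal A {..<q} e \<and> (\<forall>k<n. in_span A e q (h k))"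
proof (induction n)
  case 0
  then show ?case by (auto simp: orthonormal_def)
next
  case (Suc n)
  then obtain q e where q: "q \<le> n" and e: "orthonormal A {..<q} e" and sp: "\<forall>k<n. in_span A e q (h k)" by blast
  define w where "w = residual A e q (h n)"
  show ?case
  proof (cases "sq_norm A w = 0")
    case True
    then have "\<forall>i\<in>A. w i = 0" using assms by (simp add: ip_self_eq_0)
    then have "in_span A e q (h n)"
      using residual_span[of A e q "h n"] by (subst in_span_cong[where z' = "\<lambda>i. h n i - w i"]) (auto simp: w_def)
    then show ?thesis using q e sp by (intro exI[of _ q]) (auto simp: less_Suc_eq)
  next
    case False
    define f where "f = (\<lambda>i. inverse (sqrt (sq_norm A w)) * w i)"
    define e' where "e' = e(q := f)"
    have on: "orthonormal A {..<Suc q} e'" unfolding e'_def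
    proof (rule orthonormal_snoc[OF e])
      show "sq_norm A f = 1" using ip_normalize[OF False] by (simp add: f_def)
      show "ip A f (e k) = 0" if "k < q" for k
        using residual_orth[OF assms that] by (simp add: f_def ip_scale_left w_def)
    qed
    have "in_span A e' (Suc q) (e k)" if "k < q" for k
    proof -
      have "e' k = e k" using that by (simp add: e'_def)
      then show ?thesis using in_span_member[of k "Suc q" A e'] that by simp
    qed
    then have sub: "in_span A e' (Suc q) z" if "in_span A e q z" for z
      by (rule in_span_trans[OF that])
    have "in_span A e' (Suc q) (\<lambda>i. (h n i - w i) - (- sqrt (sq_norm A w) * e' q i))"
    proof (rule in_span_diff)
      show "in_span A e' (Suc q) (\<lambda>i. h n i - w i)" unfolding w_def by (rule sub, rule residual_span)
      show "in_span A e' (Suc q) (\<lambda>i. - sqrt (sq_norm A w) * e' q i)"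
        using in_span_sum[of "{q}" A e' "Suc q" e' "\<lambda>_. - sqrt (sq_norm A w)"] in_span_member[of q "Suc q" A e']
        by simp
    qed
    moreover have "(h n i - w i) - (- sqrt (sq_norm A w) * e' q i) = h n i" for i
      using False by (simp add: e'_def f_def)
    ultimately have "in_span A e' (Suc q) (h n)" by simp
    then show ?thesis using q on sub sp by (intro exI[of _ "Suc q"]) (auto simp: less_Suc_eq)
  qed
qed

text \<open>The \<open>h k\<close> may be dependent, so an orthonormal system of at most
  \<open>n\<close> vectors replaces them. The complementary trace is then nonzero, so some
  coordinate vector lies outside the span, and its normalised residual is \<open>w\<close>.\<close>

lemma ex_unit_orthogonal:
  assumes "finite A" "n < card A"
  shows "\<exists>w. sq_norm A w = 1 \<and> (\<forall>k<n. ip A w (h k) = 0)"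
proof -
  obtain q e where q: "q \<le> n" and e: "orthonormal A {..<q} e" and sp: "\<forall>k<n. in_span A e q (h k)"
    using orthonormal_spanning[OF assms(1)] by blast
  have "(\<Sum>i\<in>A. 1 - (\<Sum>k<q. (e k i)\<^sup>2)) \<noteq> 0" using orthonormal_trace[OF assms(1) e] assms q by simp
  then obtain i where i: "i \<in> A" "1 - (\<Sum>k<q. (e k i)\<^sup>2) \<noteq> 0" by (meson sum.neutral)
  define w where "w = residual A e q (\<lambda>j. if j = i then 1 else 0)"
  have "w i = 1 - (\<Sum>k<q. (e k i)\<^sup>2)"
    using residual_orthonormal[OF assms(1) e i(1), of "\<lambda>j. if j = i then 1 else 0"] i assms
    by (simp add: w_def ip_delta power2_eq_square)
  then have "w i \<noteq> 0" using i by simp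
  then have nz: "sq_norm A w \<noteq> 0" using assms i by (auto simp: ip_self_eq_0)
  have "ip A w (h k) = 0" if "k < n" for k
    using ip_in_span_eq_0[OF sp[rule_format, OF that], of w] residual_orth[OF assms(1)]
    by (simp add: w_def ip_commute)
  then show ?thesis using ip_normalize[OF nz]
    by (intro exI[of _ "\<lambda>i. inverse (sqrt (sq_norm A w)) * w i"]) (auto simp: ip_scale_left)
qed

text \<open>Vectors are added one at a time: the \<open>m\<close> constraints and the vectors found
  so far are together fewer than \<open>card A\<close>. The case \<open>q = 0\<close> gives
  orthogonal complements, the case \<open>m = 0\<close> completions to a basis.\<close>

lemma orthonormal_extend_orthogonal:
  assumes "finite A" "m + n \<le> card A" "orthonormal A {..<q} e" "q \<le> n"
    "\<And>k j. k < q \<Longrightarrow> j < m \<Longrightarrow> ip A (e k) (h j) = 0"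
  shows "\<exists>e'. orthonormal A {..<n} e' \<and> (\<forall>k<q. e' k = e k) \<and> (\<forall>k<n. \<forall>j<m. ip A (e' k) (h j) = 0)"
  using assms(4,2)
proof (induction rule: dec_induct)
  case base
  then show ?case using assms by blast
next
  case (step n)
  then obtain e' where e': "orthonormal A {..<n} e'" "\<forall>k<q. e' k = e k" "\<forall>k<n. \<forall>j<m. ip A (e' k) (h j) = 0"
    by auto
  obtain w where w: "sq_norm A w = 1" "\<forall>k<m+n. ip A w (if k < m then h k else e' (k - m)) = 0"
    using ex_unit_orthogonal[OF assms(1), of "m + n" "\<lambda>k. if k < m then h k else e' (k - m)"] step.prems by auto
  have wh: "ip A w (h j) = 0" if "j < m" for j using w(2)[rule_format, of j] that by simp
  have we: "ip A w (e' k) = 0" if "k < n" for k using w(2)[rule_format, of "m + k"] that by simp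
  have "orthonormal A {..<Suc n} (e'(n := w))" by (rule orthonormal_snoc[OF e'(1) w(1) we])
  moreover have "\<forall>k<q. (e'(n := w)) k = e k" using e'(2) step.hyps by simp
  moreover have "\<forall>k<Suc n. \<forall>j<m. ip A ((e'(n := w)) k) (h j) = 0" using e'(3) wh by (simp add: less_Suc_eq)
  ultimately show ?case by blast
qed

lemma orthonormal_complement:
  assumes "finite A" "m + n \<le> card A"
  shows "\<exists>e. orthonormal A {..<n} e \<and> (\<forall>k<n. \<forall>j<m. ip A (e k) (h j) = 0)"
  using orthonormal_extend_orthogonal[of A m n 0] assms by (auto simp: orthonormal_def)

lemma orthonormal_extend:
  assumes "finite A" "orthonormal A {..<q} e"
  shows "\<exists>e'. orthonormal A {..<card A} e' \<and> (\<forall>k<q. e' k = e k)"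
  using orthonormal_extend_orthogonal[of A 0 "card A" q e] assms orthonormal_card_le[OF assms] by auto

section \<open>Rotation invariance of Gaussian vectors\<close>

abbreviation stdn :: "real measure" where
  "stdn \<equiv> density lborel (\<lambda>x. ennreal (std_normal_density x))"

abbreviation gauss :: "'i set \<Rightarrow> ('i \<Rightarrow> real) measure" where
  "gauss A \<equiv> PiM A (\<lambda>_. stdn)"

interpretation stdn: prob_space stdn
  by (rule prob_space_normal_density) simp

interpretation stdn_prod: product_sigma_finite "\<lambda>_. stdn"
  by standard

lemma prob_space_gauss: "prob_space (gauss A)"
  by (rule prob_space_PiM) (rule stdn.prob_space_axioms)

lemma sigma_finite_gauss: "sigma_finite_measure (gauss A)"
  using prob_space_gauss prob_space_imp_sigma_finite by blast

lemma measurable_gauss_component: "(\<lambda>g. g i) \<in> borel_measurable (gauss A)"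
proof (cases "i \<in> A")
  case True
  then have "(\<lambda>g. g i) \<in> measurable (gauss A) stdn" by (rule measurable_component_singleton)
  then show ?thesis by simp
next
  case False
  have "(\<lambda>g. g i) \<in> borel_measurable (gauss A) \<longleftrightarrow> (\<lambda>g. undefined :: real) \<in> borel_measurable (gauss A)"
    by (rule measurable_cong) (use False in \<open>auto simp: space_PiM PiE_def extensional_def\<close>)
  then show ?thesis by simp
qed

lemma measurable_gaussI:
  assumes "\<And>i. i \<in> K \<Longrightarrow> (\<lambda>x. f x i) \<in> borel_measurable M" "\<And>x. x \<in> space M \<Longrightarrow> f x \<in> extensional K"
  shows "f \<in> measurable M (gauss K)"
  by (rule measurable_PiM_single') (use assms in \<open>auto simp: PiE_def extensional_def\<close>)

lemma measurable_ip [measurable]: "(\<lambda>g. ip A v g) \<in> borel_measurable (gauss B)"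
  unfolding ip_def by (intro borel_measurable_sum borel_measurable_times borel_measurable_const measurable_gauss_component)

lemma nn_integral_stdn:
  assumes [measurable]: "f \<in> borel_measurable borel"
  shows "(\<integral>\<^sup>+x. f x \<partial>stdn) = (\<integral>\<^sup>+x. ennreal (std_normal_density x) * f x \<partial>lborel)"
  by (rule nn_integral_density) auto

text \<open>The points \<open>(x, (c * x - z) / s)\<close> and \<open>(z, (x - c * z) / s)\<close>
  are related by the rotation, so they have the same sum of squares in the exponent.\<close>

lemma stdn_rotation_density:
  fixes c s x z :: real
  assumes cs: "c\<^sup>2 + s\<^sup>2 = 1" and s: "s \<noteq> 0"
  shows "std_normal_density x * std_normal_density ((c * x - z) / s)
       = std_normal_density z * std_normal_density ((x - c * z) / s)"
proof -
  have "x\<^sup>2 * s\<^sup>2 + (c * x - z)\<^sup>2 = z\<^sup>2 * s\<^sup>2 + (x - c * z)\<^sup>2"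
  proof -
    have "x\<^sup>2 * s\<^sup>2 + (c * x - z)\<^sup>2 = x\<^sup>2 * (c\<^sup>2 + s\<^sup>2) - 2 * c * x * z + z\<^sup>2"
      by (simp add: power2_eq_square algebra_simps)
    also have "\<dots> = z\<^sup>2 * (c\<^sup>2 + s\<^sup>2) - 2 * c * x * z + x\<^sup>2" using cs by simp
    also have "\<dots> = z\<^sup>2 * s\<^sup>2 + (x - c * z)\<^sup>2" by (simp add: power2_eq_square algebra_simps)
    finally show ?thesis .
  qed
  then have "x\<^sup>2 + ((c * x - z) / s)\<^sup>2 = z\<^sup>2 + ((x - c * z) / s)\<^sup>2"
    using s by (simp add: power_divide field_simps)
  then have "- x\<^sup>2 / 2 + - ((c * x - z) / s)\<^sup>2 / 2 = - z\<^sup>2 / 2 + - ((x - c * z) / s)\<^sup>2 / 2"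
    by (simp add: field_simps)
  then have "exp (- x\<^sup>2 / 2) * exp (- ((c * x - z) / s)\<^sup>2 / 2) = exp (- z\<^sup>2 / 2) * exp (- ((x - c * z) / s)\<^sup>2 / 2)"
    unfolding exp_add[symmetric] by simp
  then show ?thesis by (simp add: std_normal_density_def)
qed

lemma nn_integral_cmult2:
  fixes f :: "'a \<Rightarrow> ennreal"
  assumes [measurable]: "f \<in> borel_measurable M"
  shows "a * (b * (\<integral>\<^sup>+x. f x \<partial>M)) = (\<integral>\<^sup>+x. b * (a * f x) \<partial>M)"
  by (simp add: nn_integral_cmult mult.left_commute)

text \<open>Two affine substitutions on the line and an exchange of integrals replace the planar
  change of variables: \<open>y\<close> is traded for \<open>z = c * x - s * y\<close> at fixed
  \<open>x\<close>, and after the exchange \<open>x\<close> is traded for the other rotated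
  coordinate at fixed \<open>z\<close>. Both divide by \<open>s\<close>, and their factors
  \<open>\<kappa>\<close> cancel.\<close>

lemma nn_integral_stdn_rotation:
  assumes [measurable]: "f \<in> borel_measurable (borel \<Otimes>\<^sub>M borel)"
    and cs: "c\<^sup>2 + s\<^sup>2 = 1" and s: "s \<noteq> 0"
  shows "(\<integral>\<^sup>+x. \<integral>\<^sup>+y. f (c * x - s * y, s * x + c * y) \<partial>stdn \<partial>stdn) = (\<integral>\<^sup>+x. \<integral>\<^sup>+y. f (x, y) \<partial>stdn \<partial>stdn)"
proof -
  let ?\<phi> = "std_normal_density"
  define \<kappa> where "\<kappa> = ennreal \<bar>1 / s\<bar>"
  have "(\<integral>\<^sup>+x. \<integral>\<^sup>+y. f (c * x - s * y, s * x + c * y) \<partial>stdn \<partial>stdn)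
      = (\<integral>\<^sup>+x. ennreal (?\<phi> x) * (\<integral>\<^sup>+y. ennreal (?\<phi> y) * f (c * x - s * y, s * x + c * y) \<partial>lborel) \<partial>lborel)"
    by (subst nn_integral_stdn) (simp_all add: nn_integral_stdn)
  also have "\<dots> = (\<integral>\<^sup>+x. \<integral>\<^sup>+z. \<kappa> * (ennreal (?\<phi> z * ?\<phi> ((x - c * z) / s)) * f (z, (x - c * z) / s)) \<partial>lborel \<partial>lborel)"
  proof (rule nn_integral_cong)
    fix x :: real
    have 1: "c * x - s * (c * x / s + - 1 / s * z) = z" for z using s by (simp add: field_simps)
    have 2: "s * x + c * (c * x / s + - 1 / s * z) = (x - c * z) / s" for z
    proof -
      have "s * x + c * (c * x / s + - 1 / s * z) = (x * (c\<^sup>2 + s\<^sup>2) - c * z) / s"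
        using s by (simp add: field_simps power2_eq_square)
      then show ?thesis using cs by simp
    qed
    have 3: "c * x / s + - 1 / s * z = (c * x - z) / s" for z using s by (simp add: field_simps)
    have 4: "ennreal (?\<phi> x) * (ennreal (?\<phi> ((c * x - z) / s)) * F) = ennreal (?\<phi> z * ?\<phi> ((x - c * z) / s)) * F" for z F
      using stdn_rotation_density[OF cs s, of x z]
      by (metis ennreal_mult mult.assoc normal_density_nonneg)
    have "(\<integral>\<^sup>+y. ennreal (?\<phi> y) * f (c * x - s * y, s * x + c * y) \<partial>lborel)
        = ennreal \<bar>- 1 / s\<bar> * (\<integral>\<^sup>+z. ennreal (?\<phi> (c * x / s + - 1 / s * z)) *
            f (c * x - s * (c * x / s + - 1 / s * z), s * x + c * (c * x / s + - 1 / s * z)) \<partial>lborel)"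
      by (rule nn_integral_real_affine) (use s in auto)
    also have "\<dots> = \<kappa> * (\<integral>\<^sup>+z. ennreal (?\<phi> ((c * x - z) / s)) * f (z, (x - c * z) / s) \<partial>lborel)"
      unfolding 1 2 unfolding 3 by (simp add: \<kappa>_def)
    finally have 5: "(\<integral>\<^sup>+y. ennreal (?\<phi> y) * f (c * x - s * y, s * x + c * y) \<partial>lborel) = \<dots>" .
    have "ennreal (?\<phi> x) * (\<integral>\<^sup>+y. ennreal (?\<phi> y) * f (c * x - s * y, s * x + c * y) \<partial>lborel) = (\<integral>\<^sup>+z. \<kappa> * (ennreal (?\<phi> x) * (ennreal (?\<phi> ((c * x - z) / s)) * f (z, (x - c * z) / s))) \<partial>lborel)"
      unfolding 5 by (rule nn_integral_cmult2) measurable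
    also have "\<dots> = (\<integral>\<^sup>+z. \<kappa> * (ennreal (?\<phi> z * ?\<phi> ((x - c * z) / s)) * f (z, (x - c * z) / s)) \<partial>lborel)"
      by (rule nn_integral_cong) (rule arg_cong[where f = "\<lambda>u. \<kappa> * u", OF 4])
    finally show "ennreal (?\<phi> x) * (\<integral>\<^sup>+y. ennreal (?\<phi> y) * f (c * x - s * y, s * x + c * y) \<partial>lborel)
      = (\<integral>\<^sup>+z. \<kappa> * (ennreal (?\<phi> z * ?\<phi> ((x - c * z) / s)) * f (z, (x - c * z) / s)) \<partial>lborel)" .
  qed
  also have "\<dots> = (\<integral>\<^sup>+z. \<integral>\<^sup>+x. \<kappa> * (ennreal (?\<phi> z * ?\<phi> ((x - c * z) / s)) * f (z, (x - c * z) / s)) \<partial>lborel \<partial>lborel)"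
    by (rule lborel_pair.Fubini') measurable
  also have "\<dots> = (\<integral>\<^sup>+z. ennreal (?\<phi> z) * (\<integral>\<^sup>+w. ennreal (?\<phi> w) * f (z, w) \<partial>lborel) \<partial>lborel)"
  proof (rule nn_integral_cong)
    fix z :: real
    have 3: "- c * z / s + 1 / s * x = (x - c * z) / s" for x using s by (simp add: field_simps)
    have "(\<integral>\<^sup>+w. ennreal (?\<phi> w) * f (z, w) \<partial>lborel)
      = ennreal \<bar>1 / s\<bar> * (\<integral>\<^sup>+x. ennreal (?\<phi> (- c * z / s + 1 / s * x)) * f (z, - c * z / s + 1 / s * x) \<partial>lborel)"
      by (rule nn_integral_real_affine) (use s in auto)
    also have "\<dots> = \<kappa> * (\<integral>\<^sup>+x. ennreal (?\<phi> ((x - c * z) / s)) * f (z, (x - c * z) / s) \<partial>lborel)"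
      unfolding 3 by (simp add: \<kappa>_def)
    finally have 5: "(\<integral>\<^sup>+w. ennreal (?\<phi> w) * f (z, w) \<partial>lborel) = \<dots>" .
    have "ennreal (?\<phi> z) * (\<integral>\<^sup>+w. ennreal (?\<phi> w) * f (z, w) \<partial>lborel) = (\<integral>\<^sup>+x. \<kappa> * (ennreal (?\<phi> z * ?\<phi> ((x - c * z) / s)) * f (z, (x - c * z) / s)) \<partial>lborel)"
      unfolding ennreal_mult[OF normal_density_nonneg normal_density_nonneg] mult.assoc 5
      by (rule nn_integral_cmult2) measurable
    then show "(\<integral>\<^sup>+x. \<kappa> * (ennreal (?\<phi> z * ?\<phi> ((x - c * z) / s)) * f (z, (x - c * z) / s)) \<partial>lborel)
      = ennreal (?\<phi> z) * (\<integral>\<^sup>+w. ennreal (?\<phi> w) * f (z, w) \<partial>lborel)" by simp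
  qed
  also have "\<dots> = (\<integral>\<^sup>+x. \<integral>\<^sup>+y. f (x, y) \<partial>stdn \<partial>stdn)"
    by (subst (2) nn_integral_stdn) (simp_all add: nn_integral_stdn)
  finally show ?thesis .
qed

lemma nn_integral_stdn_sign:
  assumes [measurable]: "f \<in> borel_measurable borel" and "\<sigma>\<^sup>2 = (1::real)"
  shows "(\<integral>\<^sup>+x. f (\<sigma> * x) \<partial>stdn) = (\<integral>\<^sup>+x. f x \<partial>stdn)"
proof -
  consider "\<sigma> = 1" | "\<sigma> = -1" using assms(2) by (auto simp: power2_eq_1_iff)
  then show ?thesis
  proof cases
    case 2
    have "(\<integral>\<^sup>+x. ennreal (std_normal_density x) * f x \<partial>lborel)
        = ennreal \<bar>-1\<bar> * (\<integral>\<^sup>+x. ennreal (std_normal_density (0 + -1 * x)) * f (0 + -1 * x) \<partial>lborel)"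
      by (rule nn_integral_real_affine) auto
    moreover have "std_normal_density (- x) = std_normal_density x" for x by (simp add: std_normal_density_def)
    ultimately show ?thesis using 2 by (simp add: nn_integral_stdn)
  qed simp
qed

section \<open>Plane rotations and orthonormal families\<close>

definition rot :: "'i \<Rightarrow> 'i \<Rightarrow> real \<Rightarrow> real \<Rightarrow> ('i \<Rightarrow> real) \<Rightarrow> 'i \<Rightarrow> real" where
  "rot i j c s v = v(i := c * v i - s * v j, j := s * v i + c * v j)"

lemma ip_rot_adjoint:
  assumes "finite A" "i \<in> A" "j \<in> A" "i \<noteq> j"
  shows "ip A v (rot i j c s w) = ip A (rot i j c (- s) v) w"
proof -
  have A: "A = insert i (insert j (A - {i, j}))" using assms by auto
  have "(\<Sum>k\<in>A - {i, j}. v k * rot i j c s w k) = (\<Sum>k\<in>A - {i, j}. rot i j c (- s) v k * w k)"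
    by (rule sum.cong) (auto simp: rot_def)
  then show ?thesis unfolding ip_def using assms
    by (subst (1 2) A) (simp add: rot_def algebra_simps)
qed

lemma rot_rot:
  assumes "c\<^sup>2 + s\<^sup>2 = 1" "i \<noteq> j"
  shows "rot i j c (- s) (rot i j c s v) = v"
proof -
  have 1: "c * (c * x - s * y) + s * (s * x + c * y) = x" for x y
  proof -
    have "c * (c * x - s * y) + s * (s * x + c * y) = (c\<^sup>2 + s\<^sup>2) * x" by (simp add: algebra_simps power2_eq_square)
    then show ?thesis using assms by simp
  qed
  have 2: "c * (s * x + c * y) - s * (c * x - s * y) = y" for x y
  proof -
    have "c * (s * x + c * y) - s * (c * x - s * y) = (c\<^sup>2 + s\<^sup>2) * y" by (simp add: algebra_simps power2_eq_square)
    then show ?thesis using assms by simp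
  qed
  show ?thesis using 1 2 assms(2) by (auto simp: rot_def fun_eq_iff)
qed

lemma ip_rot:
  assumes "finite A" "i \<in> A" "j \<in> A" "i \<noteq> j" "c\<^sup>2 + s\<^sup>2 = 1"
  shows "ip A (rot i j c s v) (rot i j c s w) = ip A v w"
  using assms by (simp add: ip_rot_adjoint rot_rot)

lemma measurable_rot:
  assumes "i \<in> A" "j \<in> A" shows "rot i j c s \<in> measurable (gauss A) (gauss A)"
proof (rule measurable_gaussI)
  fix k
  consider "k = j" | "k = i" "k \<noteq> j" | "k \<noteq> i" "k \<noteq> j" by blast
  then show "(\<lambda>x. rot i j c s x k) \<in> borel_measurable (gauss A)"
    by cases (simp_all add: rot_def borel_measurable_add borel_measurable_diff borel_measurable_times
      measurable_gauss_component)
qed (use assms in \<open>auto simp: rot_def space_PiM PiE_def extensional_def\<close>)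

lemma nn_integral_gauss_rot:
  assumes "finite A" "i \<in> A" "j \<in> A" "i \<noteq> j" "c\<^sup>2 + s\<^sup>2 = 1" "s \<noteq> 0"
    and f: "f \<in> borel_measurable (gauss A)"
  shows "(\<integral>\<^sup>+g. f (rot i j c s g) \<partial>gauss A) = (\<integral>\<^sup>+g. f g \<partial>gauss A)"
proof -
  define B where "B = A - {i, j}"
  have A: "A = insert i (insert j B)" and fin: "finite B" and ni: "i \<notin> insert j B" "j \<notin> B"
    using assms by (auto simp: B_def)
  have two: "(\<integral>\<^sup>+g. F g \<partial>gauss A) = (\<integral>\<^sup>+x. \<integral>\<^sup>+b. \<integral>\<^sup>+a. F (x(j := b, i := a)) \<partial>stdn \<partial>stdn \<partial>gauss B)"
    if F[measurable]: "F \<in> borel_measurable (gauss A)" for F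
  proof -
    have F': "F \<in> borel_measurable (gauss (insert i (insert j B)))" using F unfolding A .
    have "(\<integral>\<^sup>+g. F g \<partial>gauss A) = (\<integral>\<^sup>+x. \<integral>\<^sup>+a. F (x(i := a)) \<partial>stdn \<partial>gauss (insert j B))"
      unfolding A by (rule stdn_prod.product_nn_integral_insert) (use fin ni F' in auto)
    also have "\<dots> = (\<integral>\<^sup>+x. \<integral>\<^sup>+b. \<integral>\<^sup>+a. F (x(j := b, i := a)) \<partial>stdn \<partial>stdn \<partial>gauss B)"
    proof (rule stdn_prod.product_nn_integral_insert)
      have "(\<lambda>(x, a). F (x(i := a))) \<in> borel_measurable (gauss (insert j B) \<Otimes>\<^sub>M stdn)"
        using measurable_comp[OF measurable_add_dim F'] by (simp add: comp_def case_prod_beta)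
      then show "(\<lambda>x. \<integral>\<^sup>+a. F (x(i := a)) \<partial>stdn) \<in> borel_measurable (gauss (insert j B))"
        by (rule stdn.borel_measurable_nn_integral)
    qed (use fin ni in auto)
    finally show ?thesis .
  qed
  have "(\<integral>\<^sup>+g. f (rot i j c s g) \<partial>gauss A)
      = (\<integral>\<^sup>+x. \<integral>\<^sup>+b. \<integral>\<^sup>+a. f (rot i j c s (x(j := b, i := a))) \<partial>stdn \<partial>stdn \<partial>gauss B)"
    by (rule two) (rule measurable_compose[OF measurable_rot f], use assms in auto)
  also have "\<dots> = (\<integral>\<^sup>+x. \<integral>\<^sup>+b. \<integral>\<^sup>+a. f (x(j := b, i := a)) \<partial>stdn \<partial>stdn \<partial>gauss B)"
  proof (rule nn_integral_cong)
    fix x assume x: "x \<in> space (gauss B)"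
    define F where "F = (\<lambda>(b, a). f (x(j := b, i := a)))"
    have 1: "(\<lambda>p. x(j := fst p, i := snd p)) \<in> measurable (borel \<Otimes>\<^sub>M borel) (gauss A)"
      by (rule measurable_gaussI) (use x in \<open>auto simp: A space_PiM PiE_def extensional_def\<close>)
    have F[measurable]: "F \<in> borel_measurable (borel \<Otimes>\<^sub>M borel)"
      using measurable_compose[OF 1 f] by (simp add: F_def case_prod_beta)
    have "(\<integral>\<^sup>+b. \<integral>\<^sup>+a. f (rot i j c s (x(j := b, i := a))) \<partial>stdn \<partial>stdn)
        = (\<integral>\<^sup>+b. \<integral>\<^sup>+a. F (c * b - (- s) * a, (- s) * b + c * a) \<partial>stdn \<partial>stdn)"
    proof (intro nn_integral_cong)
      fix a b
      \<comment> \<open>The coordinate \<open>j\<close> is integrated outside and \<open>i\<close>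
        inside, so the planar lemma sees the pair as \<open>(b, a)\<close> and the angle changes
        sign.\<close>
      have "rot i j c s (x(j := b, i := a)) = x(j := c * b - (- s) * a, i := (- s) * b + c * a)"
        using \<open>i \<noteq> j\<close> by (auto simp: rot_def fun_eq_iff)
      then show "f (rot i j c s (x(j := b, i := a))) = F (c * b - (- s) * a, (- s) * b + c * a)"
        by (simp add: F_def)
    qed
    also have "\<dots> = (\<integral>\<^sup>+b. \<integral>\<^sup>+a. F (b, a) \<partial>stdn \<partial>stdn)"
      by (rule nn_integral_stdn_rotation) (use assms in auto)
    finally show "(\<integral>\<^sup>+b. \<integral>\<^sup>+a. f (rot i j c s (x(j := b, i := a))) \<partial>stdn \<partial>stdn)
        = (\<integral>\<^sup>+b. \<integral>\<^sup>+a. f (x(j := b, i := a)) \<partial>stdn \<partial>stdn)" by (simp add: F_def)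
  qed
  also have "\<dots> = (\<integral>\<^sup>+g. f g \<partial>gauss A)" by (rule two[symmetric, OF f])
  finally show ?thesis .
qed

text \<open>The coefficients along the \<open>e k\<close> are independent standard Gaussians. An
  identity of integrals lets rotations and Fubini act directly on integrands; the restriction to
  \<open>K\<close> places the coefficient vector in the space of \<open>gauss K\<close>.\<close>

definition gauss_family :: "'i set \<Rightarrow> 'k set \<Rightarrow> ('k \<Rightarrow> 'i \<Rightarrow> real) \<Rightarrow> bool" where
  "gauss_family A K e \<longleftrightarrow> (\<forall>f\<in>borel_measurable (gauss K).
     (\<integral>\<^sup>+g. f (\<lambda>k\<in>K. ip A (e k) g) \<partial>gauss A) = (\<integral>\<^sup>+y. f y \<partial>gauss K))"

lemma measurable_ip_family: "(\<lambda>g. \<lambda>k\<in>K. ip A (e k) g) \<in> measurable (gauss B) (gauss K)"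
  by (rule measurable_gaussI) auto

lemma gauss_family_rot:
  assumes "finite A" "i \<in> A" "j \<in> A" "i \<noteq> j" "c\<^sup>2 + s\<^sup>2 = 1" "s \<noteq> 0"
    and fam: "gauss_family A K (\<lambda>k. rot i j c (- s) (e k))"
  shows "gauss_family A K e"
  unfolding gauss_family_def
proof
  fix f :: "_ \<Rightarrow> ennreal" assume f: "f \<in> borel_measurable (gauss K)"
  have "(\<integral>\<^sup>+g. f (\<lambda>k\<in>K. ip A (e k) g) \<partial>gauss A) = (\<integral>\<^sup>+g. f (\<lambda>k\<in>K. ip A (e k) (rot i j c s g)) \<partial>gauss A)"
    by (rule nn_integral_gauss_rot[symmetric])
      (use assms(1-6) measurable_compose[OF measurable_ip_family f] in auto)
  also have "\<dots> = (\<integral>\<^sup>+y. f y \<partial>gauss K)"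
    using fam f assms(1-4) by (simp add: ip_rot_adjoint gauss_family_def)
  finally show "(\<integral>\<^sup>+g. f (\<lambda>k\<in>K. ip A (e k) g) \<partial>gauss A) = (\<integral>\<^sup>+y. f y \<partial>gauss K)" .
qed

text \<open>The vector \<open>e k\<close> is a signed coordinate vector and the other vectors do not
  see that coordinate. It is therefore independent of the rest, and the sign disappears by symmetry
  of the normal density.\<close>

lemma gauss_family_insert:
  assumes "finite B" "i \<notin> B" "finite K" "k \<notin> K" "(e k i)\<^sup>2 = 1" "\<And>b. b \<in> B \<Longrightarrow> e k b = 0"
    "\<And>l. l \<in> K \<Longrightarrow> e l i = 0" and fam: "gauss_family B K e"
  shows "gauss_family (insert i B) (insert k K) e"
  unfolding gauss_family_def
proof
  fix f :: "_ \<Rightarrow> ennreal" assume f: "f \<in> borel_measurable (gauss (insert k K))"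
  have "(\<lambda>(y, a). f (y(k := a))) \<in> borel_measurable (gauss K \<Otimes>\<^sub>M stdn)"
    using measurable_comp[OF measurable_add_dim f] by (simp add: comp_def case_prod_beta)
  then have H: "(\<lambda>y. \<integral>\<^sup>+a. f (y(k := a)) \<partial>stdn) \<in> borel_measurable (gauss K)"
    by (rule stdn.borel_measurable_nn_integral)
  have "(\<integral>\<^sup>+g. f (\<lambda>l\<in>insert k K. ip (insert i B) (e l) g) \<partial>gauss (insert i B))
      = (\<integral>\<^sup>+x. \<integral>\<^sup>+a. f (\<lambda>l\<in>insert k K. ip (insert i B) (e l) (x(i := a))) \<partial>stdn \<partial>gauss B)"
    by (rule stdn_prod.product_nn_integral_insert)
      (use assms(1,2) measurable_compose[OF measurable_ip_family f] in auto)
  also have "\<dots> = (\<integral>\<^sup>+x. \<integral>\<^sup>+a. f ((\<lambda>l\<in>K. ip B (e l) x)(k := a)) \<partial>stdn \<partial>gauss B)"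
  proof (rule nn_integral_cong)
    fix x
    let ?y = "\<lambda>l\<in>K. ip B (e l) x"
    have 0: "(\<Sum>b\<in>B. e l b * (if b = i then a else x b)) = ip B (e l) x" for l a
      unfolding ip_def by (rule sum.cong) (use assms(2) in auto)
    have "(\<lambda>l\<in>insert k K. ip (insert i B) (e l) (x(i := a))) = ?y(k := e k i * a)" for a
    proof
      fix l
      show "(\<lambda>l\<in>insert k K. ip (insert i B) (e l) (x(i := a))) l = (?y(k := e k i * a)) l"
        using assms(1,2,4,6,7) 0[of l a] ip_zero_left[of B "e k" x] by (auto simp: ip_def)
    qed
    moreover have "(\<lambda>a. ?y(k := a)) \<in> measurable borel (gauss (insert k K))"
      by (rule measurable_gaussI) (auto simp: extensional_def)
    then have "(\<lambda>a. f (?y(k := a))) \<in> borel_measurable borel" by (rule measurable_compose[OF _ f])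
    ultimately show "(\<integral>\<^sup>+a. f (\<lambda>l\<in>insert k K. ip (insert i B) (e l) (x(i := a))) \<partial>stdn) = (\<integral>\<^sup>+a. f (?y(k := a)) \<partial>stdn)"
      using nn_integral_stdn_sign[of "\<lambda>a. f (?y(k := a))" "e k i"] assms(5) by simp
  qed
  also have "\<dots> = (\<integral>\<^sup>+y. \<integral>\<^sup>+a. f (y(k := a)) \<partial>stdn \<partial>gauss K)"
    by (rule bspec[OF fam[unfolded gauss_family_def] H])
  also have "\<dots> = (\<integral>\<^sup>+y. f y \<partial>gauss (insert k K))"
    by (rule stdn_prod.product_nn_integral_insert[symmetric]) (use assms(3,4) f in auto)
  finally show "(\<integral>\<^sup>+g. f (\<lambda>l\<in>insert k K. ip (insert i B) (e l) g) \<partial>gauss (insert i B)) = (\<integral>\<^sup>+y. f y \<partial>gauss (insert k K))" .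
qed

text \<open>Plane rotations move the first vector of the family to a multiple of a coordinate vector;
  the remaining vectors then live on the other coordinates.\<close>
theorem gauss_family_orthonormal:
  assumes "finite A" "finite K" "orthonormal A K e"
  shows "gauss_family A K e"
  using assms(2,1,3)
proof (induction K arbitrary: A e rule: finite_induct)
  case empty
  interpret prob_space "gauss A" by (rule prob_space_gauss)
  have "(\<lambda>k\<in>{}. ip A (e k) g) = (\<lambda>_. undefined)" for g by (simp add: fun_eq_iff)
  then show ?case
    by (auto simp: gauss_family_def PiM_empty nn_integral_count_space_finite emeasure_space_1)
next
  case (insert k K)
  have kk: "sq_norm A (e k) = 1" using insert.prems by (auto simp: orthonormal_def)
  then have "A \<noteq> {}" by (auto simp: ip_def)
  then obtain i where i: "i \<in> A" by blast
  show ?case using insert.prems(2) kk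
  \<comment> \<open>Every rotation removes at least one nonzero coordinate of \<open>e k\<close>
    away from the pivot \<open>i\<close>.\<close>
  proof (induction "card {j \<in> A - {i}. e k j \<noteq> 0}" arbitrary: e rule: less_induct)
    case less
    show ?case
    proof (cases "{j \<in> A - {i}. e k j \<noteq> 0} = {}")
      case True
      then have z: "\<And>b. b \<in> A - {i} \<Longrightarrow> e k b = 0" by auto
      have A: "A = insert i (A - {i})" using i by auto
      have ipk: "ip A (e k) v = e k i * v i" for v
        unfolding ip_def using z insert.prems(1) i by (simp add: sum.remove[of A i])
      have sq: "(e k i)\<^sup>2 = 1" using less.prems(2) ipk[of "e k"] by (simp add: power2_eq_square)
      have li: "e l i = 0" if "l \<in> K" for l
      proof -
        have "k \<noteq> l" using that insert.hyps(2) by auto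
        then have "e k i * e l i = 0" using ipk[of "e l"] orthonormalD[OF less.prems(1), of k l] that by simp
        then show ?thesis using sq by auto
      qed
      have ipl: "ip (A - {i}) (e l) v = ip A (e l) v" if "l \<in> K" for l v
        unfolding ip_def using li[OF that] insert.prems(1) i by (simp add: sum.remove[of A i])
      have "orthonormal (A - {i}) K e"
        using less.prems(1) by (simp add: orthonormal_def ipl)
      then have "gauss_family (A - {i}) K e" using insert.IH insert.prems(1) by simp
      then have "gauss_family (insert i (A - {i})) (insert k K) e"
        by (intro gauss_family_insert) (use insert.prems(1) insert.hyps sq z li in auto)
      then show ?thesis using A by simp
    next
      case False
      then obtain j where j: "j \<in> A" "j \<noteq> i" "e k j \<noteq> 0" by auto
      define \<rho> where "\<rho> = sqrt ((e k i)\<^sup>2 + (e k j)\<^sup>2)"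
      have rho2: "\<rho>\<^sup>2 = (e k i)\<^sup>2 + (e k j)\<^sup>2" by (simp add: \<rho>_def)
      have "\<rho> > 0" using j by (simp add: \<rho>_def add_nonneg_pos)
      \<comment> \<open>Cosine and sine of the rotation that moves \<open>(e k i, e k j)\<close> to
        \<open>(\<rho>, 0)\<close>.\<close>
      define c s where "c = e k i / \<rho>" and "s = e k j / \<rho>"
      have cs: "c\<^sup>2 + s\<^sup>2 = 1" using \<open>\<rho> > 0\<close>
        by (simp add: c_def s_def power_divide add_divide_distrib[symmetric] rho2[symmetric])
      have cs': "c\<^sup>2 + (- s)\<^sup>2 = 1" using cs by simp
      have s0: "s \<noteq> 0" using j \<open>\<rho> > 0\<close> by (simp add: s_def)
      let ?e = "\<lambda>k. rot i j c (- s) (e k)"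
      have ij: "i \<noteq> j" using j by simp
      have z: "?e k j = 0" using ij by (simp add: rot_def c_def s_def)
      have sub: "{l \<in> A - {i}. ?e k l \<noteq> 0} \<subseteq> {l \<in> A - {i}. e k l \<noteq> 0} - {j}"
        using z by (auto simp: rot_def split: if_splits)
      have "card {l \<in> A - {i}. ?e k l \<noteq> 0} < card {l \<in> A - {i}. e k l \<noteq> 0}"
        by (rule psubset_card_mono) (use sub j insert.prems(1) in auto)
      moreover have "orthonormal A (insert k K) ?e"
        using less.prems(1) ip_rot[OF insert.prems(1) i j(1) ij cs'] by (simp add: orthonormal_def)
      moreover have "sq_norm A (?e k) = 1"
        using less.prems(2) ip_rot[OF insert.prems(1) i j(1) ij cs'] by simp
      ultimately have "gauss_family A (insert k K) ?e" by (rule less.hyps)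
      then show ?thesis by (rule gauss_family_rot[OF insert.prems(1) i j(1) ij cs s0])
    qed
  qed
qed

lemma nn_integral_gauss_orthonormal:
  assumes "finite A" "finite K" "orthonormal A K e" "f \<in> borel_measurable (gauss K)"
  shows "(\<integral>\<^sup>+g. f (\<lambda>k\<in>K. ip A (e k) g) \<partial>gauss A) = (\<integral>\<^sup>+y. f y \<partial>gauss K)"
  using gauss_family_orthonormal[OF assms(1-3)] assms(4) by (simp add: gauss_family_def)

section \<open>Negative moments and dual bases\<close>

lemma nn_integral_stdn_exp:
  assumes "l > - 1 / 2"
  shows "(\<integral>\<^sup>+x. ennreal (exp (- l * x\<^sup>2)) \<partial>stdn) = ennreal ((1 + 2 * l) powr (- 1 / 2))"
proof -
  define \<sigma> where "\<sigma> = 1 / sqrt (1 + 2 * l)"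
  have pos: "1 + 2 * l > 0" using assms by simp
  then have \<sigma>: "\<sigma> > 0" and \<sigma>2: "\<sigma>\<^sup>2 = 1 / (1 + 2 * l)" by (simp_all add: \<sigma>_def power_divide)
  have \<sigma>powr: "\<sigma> = (1 + 2 * l) powr (- 1 / 2)"
    using pos by (simp add: \<sigma>_def powr_half_sqrt powr_minus_divide)
  have eq: "std_normal_density x * exp (- l * x\<^sup>2) = \<sigma> * normal_density 0 \<sigma> x" for x
  proof -
    have "- x\<^sup>2 / 2 + - l * x\<^sup>2 = - (x - 0)\<^sup>2 / (2 * \<sigma>\<^sup>2)" using pos by (simp add: \<sigma>2 field_simps)
    then have "exp (- x\<^sup>2 / 2) * exp (- l * x\<^sup>2) = exp (- (x - 0)\<^sup>2 / (2 * \<sigma>\<^sup>2))"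
      by (simp only: exp_add[symmetric])
    moreover have "\<sigma> / sqrt (2 * pi * \<sigma>\<^sup>2) = 1 / sqrt (2 * pi)" using \<sigma> by (simp add: real_sqrt_mult)
    moreover have "std_normal_density x * exp (- l * x\<^sup>2) = 1 / sqrt (2 * pi) * (exp (- x\<^sup>2 / 2) * exp (- l * x\<^sup>2))"
      by (simp add: std_normal_density_def)
    ultimately have "std_normal_density x * exp (- l * x\<^sup>2) = \<sigma> / sqrt (2 * pi * \<sigma>\<^sup>2) * exp (- (x - 0)\<^sup>2 / (2 * \<sigma>\<^sup>2))"
      by (simp only:)
    then show ?thesis by (simp add: normal_density_def)
  qed
  have "(\<integral>\<^sup>+x. ennreal (exp (- l * x\<^sup>2)) \<partial>stdn) = (\<integral>\<^sup>+x. ennreal \<sigma> * ennreal (normal_density 0 \<sigma> x) \<partial>lborel)"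
    by (subst nn_integral_stdn) (simp, metis (no_types, lifting) ennreal_mult eq exp_ge_zero less_imp_le normal_density_nonneg \<sigma>)
  also have "\<dots> = ennreal \<sigma> * (\<integral>\<^sup>+x. ennreal (normal_density 0 \<sigma> x) \<partial>lborel)"
    by (rule nn_integral_cmult) simp
  also have "(\<integral>\<^sup>+x. ennreal (normal_density 0 \<sigma> x) \<partial>lborel) = 1"
    using \<sigma> by (subst nn_integral_eq_integral) auto
  finally show ?thesis by (simp add: \<sigma>powr)
qed

text \<open>The integrand factors over the coordinates. Nonnegative \<open>l\<close> serves the
  Laplace representation of negative powers; \<open>l = - 1 / 4\<close> provides the exponential
  moment for the Chernoff bound.\<close>

lemma nn_integral_gauss_exp:
  assumes "finite K" "l > - 1 / 2"
  shows "(\<integral>\<^sup>+y. ennreal (exp (- l * (\<Sum>k\<in>K. (y k)\<^sup>2))) \<partial>gauss K) = ennreal ((1 + 2 * l) powr (- real (card K) / 2))"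
proof -
  have pos: "1 + 2 * l > 0" using assms by simp
  have "(\<integral>\<^sup>+y. ennreal (exp (- l * (\<Sum>k\<in>K. (y k)\<^sup>2))) \<partial>gauss K)
      = (\<integral>\<^sup>+y. (\<Prod>k\<in>K. ennreal (exp (- l * (y k)\<^sup>2))) \<partial>gauss K)"
    using assms(1) by (simp add: sum_distrib_left exp_sum prod_ennreal sum_negf[symmetric])
  also have "\<dots> = (\<Prod>k\<in>K. \<integral>\<^sup>+x. ennreal (exp (- l * x\<^sup>2)) \<partial>stdn)"
    by (rule stdn_prod.product_nn_integral_prod) (use assms(1) in auto)
  also have "\<dots> = ennreal (((1 + 2 * l) powr (- 1 / 2)) ^ card K)"
    using assms(2) by (simp only: nn_integral_stdn_exp prod_constant ennreal_power powr_ge_zero)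
  also have "((1 + 2 * l) powr (- 1 / 2)) ^ card K = (1 + 2 * l) powr (- real (card K) / 2)"
    using pos by (simp add: powr_realpow[symmetric] powr_powr)
  finally show ?thesis .
qed

text \<open>The substitution \<open>t = y * l\<close> in the Gamma integral gives equality for
  \<open>y > 0\<close>. At \<open>y = 0\<close> the left side is zero by the convention for
  \<open>0 powr\<close>, so the inequality covers both cases.\<close>

lemma powr_le_Gamma_integral:
  assumes "a > 0" "y \<ge> 0"
  shows "ennreal (Gamma a * y powr (- a)) \<le> (\<integral>\<^sup>+l. ennreal (indicator {0..} l * l powr (a - 1)) * ennreal (exp (- l * y)) \<partial>lborel)"
proof (cases "y = 0")
  case False
  then have y: "y > 0" using assms by simp
  let ?I = "\<integral>\<^sup>+l. ennreal (indicator {0..} l * l powr (a - 1)) * ennreal (exp (- l * y)) \<partial>lborel"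
  have ind: "indicator {0..} (y * l) = (indicator {0..} l :: real)" for l
    using y by (auto simp: indicator_def zero_le_mult_iff)
  have "indicator {0..} (0 + y * l) * (0 + y * l) powr (a - 1) / exp (0 + y * l)
      = y powr (a - 1) * (indicator {0..} l * l powr (a - 1) * exp (- l * y))" for l
    using y ind[of l] by (cases "l \<ge> 0") (auto simp: powr_mult exp_minus field_simps)
  then have *: "ennreal (indicator {0..} (0 + y * l) * (0 + y * l) powr (a - 1) / exp (0 + y * l))
      = ennreal (y powr (a - 1)) * (ennreal (indicator {0..} l * l powr (a - 1)) * ennreal (exp (- l * y)))" for l
    by (simp add: ennreal_mult[symmetric])
  have "ennreal (Gamma a) = (\<integral>\<^sup>+t. ennreal (indicator {0..} t * t powr (a - 1) / exp t) \<partial>lborel)"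
    by (rule Gamma_conv_nn_integral_real[OF assms(1)])
  also have "\<dots> = ennreal \<bar>y\<bar> * (\<integral>\<^sup>+l. ennreal (indicator {0..} (0 + y * l) * (0 + y * l) powr (a - 1) / exp (0 + y * l)) \<partial>lborel)"
    by (rule nn_integral_real_affine) (use y in auto)
  also have "\<dots> = ennreal y * (ennreal (y powr (a - 1)) * ?I)"
    unfolding * using y by (subst nn_integral_cmult) auto
  also have "\<dots> = ennreal (y powr a) * ?I"
    using y by (simp add: mult.assoc[symmetric] ennreal_mult[symmetric] powr_mult_base)
  finally have G: "ennreal (Gamma a) = ennreal (y powr a) * ?I" .
  have "ennreal (Gamma a * y powr (- a)) = ennreal (y powr (- a)) * ennreal (Gamma a)"
    using assms Gamma_real_pos[of a] by (simp add: ennreal_mult[symmetric] mult.commute)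
  also have "\<dots> = ennreal (y powr (- a) * y powr a) * ?I" unfolding G by (simp add: mult.assoc[symmetric] ennreal_mult)
  also have "y powr (- a) * y powr a = 1" using y by (simp add: powr_add[symmetric])
  finally show ?thesis by simp
qed simp

lemma nn_integral_three_halves:
  "(\<integral>\<^sup>+l. ennreal ((1 + 2 * l) powr (- 3 / 2)) * indicator {0..} l \<partial>lborel) = 1"
proof -
  have "(\<integral>\<^sup>+l. ennreal ((1 + 2 * l) powr (- 3 / 2)) * indicator {0..} l \<partial>lborel) = ennreal (0 - (- ((1 + 2 * 0) powr (- 1 / 2))))"
  proof (rule nn_integral_FTC_atLeast)
    show "((\<lambda>l. - ((1 + 2 * l) powr (- 1 / 2 :: real))) has_real_derivative (1 + 2 * x) powr (- 3 / 2)) (at x)"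
      if "0 \<le> x" for x
      by (rule derivative_eq_intros refl | use that in simp)+
    show "((\<lambda>l. - ((1 + 2 * l) powr (- 1 / 2 :: real))) \<longlongrightarrow> 0) at_top" by real_asymp
  qed auto
  then show ?thesis by simp
qed

text \<open>In HOL \<open>0 powr (- a) = 0\<close>, which would destroy antitonicity at \<open>0\<close>.\<close>
definition ipow :: "real \<Rightarrow> real \<Rightarrow> ennreal" where
  "ipow a y = (if y = 0 then \<infinity> else ennreal (y powr (- a)))"

lemma measurable_ipow [measurable]: "ipow a \<in> borel_measurable borel"
  unfolding ipow_def by measurable

lemma ipow_antimono: "0 \<le> x \<Longrightarrow> x \<le> y \<Longrightarrow> 0 \<le> a \<Longrightarrow> ipow a y \<le> ipow a x"
  by (auto simp: ipow_def intro!: ennreal_leI powr_mono2')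

lemma measurable_gauss_sum_sq [measurable]: "(\<lambda>y. \<Sum>k\<in>K. (y k)\<^sup>2) \<in> borel_measurable (gauss A)"
  by (intro borel_measurable_sum borel_measurable_power measurable_gauss_component)

lemma AE_gauss_sum_sq_nonzero:
  assumes "finite K" "K \<noteq> {}"
  shows "AE y in gauss K. (\<Sum>k\<in>K. (y k)\<^sup>2) \<noteq> 0"
proof -
  obtain k where k: "k \<in> K" using assms by auto
  have "AE x in stdn. x \<noteq> 0"
    by (subst AE_density) (auto simp: AE_lborel_singleton[of 0] intro: AE_mp[OF AE_lborel_singleton[of 0]])
  then have "AE y in gauss K. y k \<noteq> 0"
    by (intro AE_PiM_component) (use k stdn.prob_space_axioms in auto)
  then show ?thesis by eventually_elim (use k assms(1) in \<open>auto simp: sum_nonneg_eq_0_iff\<close>)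
qed

text \<open>The Laplace representation of the power turns the negative moment of the chi-square
  distribution with \<open>2 a + 1\<close> degrees of freedom into a one-dimensional integral, whose integrand
  is at most \<open>2 powr (1 - a) * (1 + 2 * l) powr (- 3 / 2)\<close>.\<close>
lemma chi_square_negative_moment:
  assumes "finite K" "real (card K) = 2 * a + 1" "a \<ge> 1"
  shows "(\<integral>\<^sup>+y. ipow a (\<Sum>k\<in>K. (y k)\<^sup>2) \<partial>gauss K) \<le> ennreal (2 powr (1 - a) / Gamma a)"
proof -
  interpret prob_space "gauss K" by (rule prob_space_gauss)
  interpret P: pair_sigma_finite "gauss K" lborel
    by (intro pair_sigma_finite.intro sigma_finite_gauss lborel.sigma_finite_measure_axioms)
  have G: "Gamma a > 0" using assms by (intro Gamma_real_pos) simp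
  have "K \<noteq> {}" using assms by auto
  let ?w = "\<lambda>l. ennreal (indicator {0..} l * l powr (a - 1))"
  have "ennreal (Gamma a) * (\<integral>\<^sup>+y. ipow a (\<Sum>k\<in>K. (y k)\<^sup>2) \<partial>gauss K)
      = (\<integral>\<^sup>+y. ennreal (Gamma a) * ipow a (\<Sum>k\<in>K. (y k)\<^sup>2) \<partial>gauss K)"
    by (subst nn_integral_cmult) (auto intro: measurable_compose[OF measurable_gauss_sum_sq measurable_ipow])
  also have "\<dots> \<le> (\<integral>\<^sup>+y. \<integral>\<^sup>+l. ?w l * ennreal (exp (- l * (\<Sum>k\<in>K. (y k)\<^sup>2))) \<partial>lborel \<partial>gauss K)"
  proof (rule nn_integral_mono_AE)
    show "AE y in gauss K. ennreal (Gamma a) * ipow a (\<Sum>k\<in>K. (y k)\<^sup>2)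
        \<le> (\<integral>\<^sup>+l. ?w l * ennreal (exp (- l * (\<Sum>k\<in>K. (y k)\<^sup>2))) \<partial>lborel)"
      using AE_gauss_sum_sq_nonzero[OF assms(1) \<open>K \<noteq> {}\<close>]
    proof eventually_elim
      case (elim y)
      then show ?case
        using powr_le_Gamma_integral[of a "\<Sum>k\<in>K. (y k)\<^sup>2"] assms G
        by (simp add: ipow_def ennreal_mult[symmetric] sum_nonneg)
    qed
  qed
  also have "\<dots> = (\<integral>\<^sup>+l. \<integral>\<^sup>+y. ?w l * ennreal (exp (- l * (\<Sum>k\<in>K. (y k)\<^sup>2))) \<partial>gauss K \<partial>lborel)"
    by (rule P.Fubini'[symmetric]) measurable
  also have "\<dots> \<le> (\<integral>\<^sup>+l. ennreal (2 powr (1 - a)) * (ennreal ((1 + 2 * l) powr (- 3 / 2)) * indicator {0..} l) \<partial>lborel)"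
  proof (rule nn_integral_mono)
    fix l :: real
    show "(\<integral>\<^sup>+y. ?w l * ennreal (exp (- l * (\<Sum>k\<in>K. (y k)\<^sup>2))) \<partial>gauss K)
       \<le> ennreal (2 powr (1 - a)) * (ennreal ((1 + 2 * l) powr (- 3 / 2)) * indicator {0..} l)"
    proof (cases "l \<ge> 0")
      case True
      have pos: "1 + 2 * l > 0" using True by simp
      \<comment> \<open>Of this exponent, \<open>a - 1\<close> compensates the growth of
        \<open>l powr (a - 1)\<close>; the remaining \<open>3 / 2\<close> makes the integral over
        \<open>l\<close> converge.\<close>
      have card: "- real (card K) / 2 = - a - 1 / 2" using assms(2) by (simp add: field_simps)
      have "(\<integral>\<^sup>+y. ?w l * ennreal (exp (- l * (\<Sum>k\<in>K. (y k)\<^sup>2))) \<partial>gauss K)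
          = ?w l * ennreal ((1 + 2 * l) powr (- real (card K) / 2))"
        using nn_integral_gauss_exp[OF assms(1), of l] True by (subst nn_integral_cmult) auto
      also have "\<dots> = ennreal (l powr (a - 1) * (1 + 2 * l) powr (- a - 1 / 2))"
        unfolding card using True by (simp add: ennreal_mult[symmetric])
      also have "l powr (a - 1) * (1 + 2 * l) powr (- a - 1 / 2)
          = l powr (a - 1) * (1 + 2 * l) powr (- (a - 1)) * (1 + 2 * l) powr (- 3 / 2)"
      proof -
        have e: "- a - 1 / 2 = - (a - 1) + - 3 / 2" by simp
        show ?thesis unfolding e powr_add by (simp only: mult.assoc)
      qed
      also have "l powr (a - 1) * (1 + 2 * l) powr (- (a - 1)) \<le> 2 powr (1 - a)"
      proof -
        have "(2 * l) powr (a - 1) \<le> (1 + 2 * l) powr (a - 1)"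
          by (rule powr_mono2) (use True assms in auto)
        then have "2 powr (a - 1) * l powr (a - 1) \<le> (1 + 2 * l) powr (a - 1)"
          using True by (simp add: powr_mult)
        then have "l powr (a - 1) / (1 + 2 * l) powr (a - 1) \<le> 1 / 2 powr (a - 1)"
          using pos by (simp add: field_simps)
        then show ?thesis using pos by (simp add: powr_minus_divide[of _ "a - 1"] powr_diff)
      qed
      finally show ?thesis using True
        by (simp add: ennreal_mult[symmetric] mult_right_mono ennreal_leI)
    qed simp
  qed
  also have "\<dots> = ennreal (2 powr (1 - a)) * (\<integral>\<^sup>+l. ennreal ((1 + 2 * l) powr (- 3 / 2)) * indicator {0..} l \<partial>lborel)"
    by (rule nn_integral_cmult) measurable
  also have "\<dots> = ennreal (2 powr (1 - a))" by (simp only: nn_integral_three_halves mult_1_right)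
  finally have "ennreal (Gamma a) * (\<integral>\<^sup>+y. ipow a (\<Sum>k\<in>K. (y k)\<^sup>2) \<partial>gauss K) \<le> ennreal (2 powr (1 - a))" .
  then have "ennreal (1 / Gamma a) * (ennreal (Gamma a) * (\<integral>\<^sup>+y. ipow a (\<Sum>k\<in>K. (y k)\<^sup>2) \<partial>gauss K))
      \<le> ennreal (1 / Gamma a) * ennreal (2 powr (1 - a))" by (rule mult_left_mono) simp
  then show ?thesis using G by (simp add: mult.assoc[symmetric] ennreal_mult[symmetric])
qed

section \<open>Dual bases and distances from a column to the span of the others\<close>

lemma residual_cong:
  assumes "\<And>k i. k < n \<Longrightarrow> i \<in> A \<Longrightarrow> h k i = h' k i" "\<And>i. i \<in> A \<Longrightarrow> v i = v' i" "i \<in> A"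
  shows "residual A h n v i = residual A h' n v' i"
  using assms
proof (induction n arbitrary: v v' i)
  case (Suc n)
  have 1: "residual A h n v j = residual A h' n v' j" if "j \<in> A" for j
    using Suc.IH[of v v' j] Suc.prems that by auto
  have 2: "residual A h n (h n) j = residual A h' n (h' n) j" if "j \<in> A" for j
    using Suc.IH[of "h n" "h' n" j] Suc.prems that by auto
  have "ip A (residual A h n v) (residual A h n (h n)) = ip A (residual A h' n v') (residual A h' n (h' n))"
    "sq_norm A (residual A h n (h n)) = sq_norm A (residual A h' n (h' n))"
    using 1 2 by (auto intro!: ip_cong)
  then show ?case using 1 2 Suc.prems by simp
qed simp

lemma measurable_ip2:
  assumes "\<And>i. (\<lambda>x. v x i) \<in> borel_measurable M" "\<And>i. (\<lambda>x. w x i) \<in> borel_measurable M"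
  shows "(\<lambda>x. ip A (v x) (w x)) \<in> borel_measurable M"
  unfolding ip_def by (intro borel_measurable_sum borel_measurable_times assms)

lemma measurable_residual:
  assumes "\<And>k i. (\<lambda>x. h x k i) \<in> borel_measurable M" "\<And>i. (\<lambda>x. v x i) \<in> borel_measurable M"
  shows "(\<lambda>x. residual A (h x) n (v x) i) \<in> borel_measurable M"
  using assms(2)
proof (induction n arbitrary: v i)
  case (Suc n)
  have "(\<lambda>x. residual A (h x) n (v x) j) \<in> borel_measurable M" "(\<lambda>x. residual A (h x) n (h x n) j) \<in> borel_measurable M" for j
    using Suc.IH Suc.prems assms(1) by auto
  then show ?case
    by (auto intro!: borel_measurable_diff borel_measurable_times borel_measurable_divide measurable_ip2)
qed simp

text \<open>Each \<open>e i\<close> is orthogonal to everything that is subtracted from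
  \<open>v\<close>, so Bessel's inequality can be applied to the residual. The bound holds whether
  or not the \<open>h j\<close> are linearly independent.\<close>

lemma residual_ge:
  fixes e :: "nat \<Rightarrow> 'a \<Rightarrow> real"
  assumes "finite A" "orthonormal A {..<q} e" "\<And>i j. i < q \<Longrightarrow> j < n \<Longrightarrow> ip A (e i) (h j) = 0"
  shows "(\<Sum>i<q. (ip A v (e i))\<^sup>2) \<le> sq_norm A (residual A h n v)"
proof -
  have "ip A v (e i) = ip A (residual A h n v) (e i)" if "i < q" for i
  proof -
    have "ip A (\<lambda>a. v a - residual A h n v a) (e i) = 0"
      by (rule ip_in_span_eq_0[OF residual_span]) (use assms(3)[OF that] in \<open>simp add: ip_commute\<close>)
    then show ?thesis by (simp add: ip_diff_left)
  qed
  then have "(\<Sum>i<q. (ip A v (e i))\<^sup>2) = (\<Sum>i<q. (ip A (residual A h n v) (e i))\<^sup>2)" by simp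
  also have "\<dots> \<le> sq_norm A (residual A h n v)" by (rule bessel[OF assms(1,2)])
  finally show ?thesis .
qed

definition others :: "nat \<Rightarrow> (nat \<Rightarrow> 'a) \<Rightarrow> nat \<Rightarrow> 'a" where
  "others k h = (\<lambda>j. h (if j < k then j else Suc j))"

abbreviation col_residual :: "'a set \<Rightarrow> (nat \<Rightarrow> 'a \<Rightarrow> real) \<Rightarrow> nat \<Rightarrow> nat \<Rightarrow> 'a \<Rightarrow> real" where
  "col_residual S h r k \<equiv> residual S (others k h) (r - 1) (h k)"

abbreviation col_dist2 :: "'a set \<Rightarrow> (nat \<Rightarrow> 'a \<Rightarrow> real) \<Rightarrow> nat \<Rightarrow> nat \<Rightarrow> real" where
  "col_dist2 S h r k \<equiv> sq_norm S (col_residual S h r k)"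

text \<open>When all distances are nonzero, this is row \<open>k\<close> of the Moore-Penrose left
  inverse of the matrix with columns \<open>h j\<close>. Expressing it through residuals makes it an
  explicit measurable function of the columns; a zero distance gives the zero vector because
  \<open>inverse 0 = 0\<close>.\<close>

definition dual :: "'a set \<Rightarrow> (nat \<Rightarrow> 'a \<Rightarrow> real) \<Rightarrow> nat \<Rightarrow> nat \<Rightarrow> 'a \<Rightarrow> real" where
  "dual S h r k = (\<lambda>a. inverse (col_dist2 S h r k) * col_residual S h r k a)"

lemma othersE:
  assumes "i < r - 1" "k < r" obtains j where "j < r" "j \<noteq> k" "others k h i = h j"
  by (rule that[of "if i < k then i else Suc i"]) (use assms in \<open>auto simp: others_def\<close>)

lemma ex_others:
  assumes "j < r" "j \<noteq> k" "k < r" shows "\<exists>i<r - 1. others k h i = h j"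
  using assms by (intro exI[of _ "if j < k then j else j - 1"]) (auto simp: others_def)

lemma in_span_scale:
  assumes "in_span A h n z" shows "in_span A h n (\<lambda>i. c * z i)"
  using in_span_sum[of "{0::nat}" A h n "\<lambda>_. z" "\<lambda>_. c"] assms by simp

lemma ip_residual_self:
  assumes "finite S" shows "ip S (residual S h n v) v = sq_norm S (residual S h n v)"
proof -
  have "ip S (\<lambda>a. v a - residual S h n v a) (residual S h n v) = 0"
    by (rule ip_in_span_eq_0[OF residual_span]) (use residual_orth[OF assms] in \<open>simp add: ip_commute\<close>)
  then show ?thesis by (simp add: ip_diff_left ip_commute)
qed

lemma ip_dual:
  assumes "finite S" "k < r" "j < r" "col_dist2 S h r k \<noteq> 0"
  shows "ip S (dual S h r k) (h j) = (if j = k then 1 else 0)"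
proof (cases "j = k")
  case True
  then show ?thesis using assms by (simp add: dual_def ip_scale_left ip_residual_self)
next
  case False
  then obtain i where "i < r - 1" "others k h i = h j" using ex_others assms by metis
  then show ?thesis using residual_orth[OF assms(1), of i "r - 1" "others k h" "h k"] False
    by (simp add: dual_def ip_scale_left)
qed

lemma dual_in_span:
  assumes "k < r" shows "in_span S h r (dual S h r k)"
proof -
  have "in_span S h r (\<lambda>a. h k a - col_residual S h r k a)"
  proof (rule in_span_trans[OF residual_span])
    fix i assume "i < r - 1"
    then obtain j where "j < r" "others k h i = h j" using othersE assms by blast
    then show "in_span S h r (others k h i)" by (simp add: in_span_member)
  qed
  then have "in_span S h r (\<lambda>a. h k a - (h k a - col_residual S h r k a))"
    by (rule in_span_diff[OF in_span_member[OF assms]])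
  then have "in_span S h r (col_residual S h r k)" by (rule iffD1[OF in_span_cong, rotated]) simp
  then show ?thesis unfolding dual_def by (rule in_span_scale)
qed

lemma ip_double_sum:
  "ip S (\<lambda>a. \<Sum>k\<in>K. c k * f k a) (\<lambda>a. \<Sum>l\<in>L. d l * g l a) = (\<Sum>k\<in>K. \<Sum>l\<in>L. c k * d l * ip S (f k) (g l))"
  by (simp add: ip_sum_left ip_sum_right sum_distrib_left mult.assoc)

text \<open>A unit combination \<open>z\<close> of the dual basis is the dual vector of \<open>c 0\<close> with respect to the
  rotated basis \<open>c\<close>, so its norm is the inverse of a distance.\<close>
lemma dual_combination:
  assumes S: "finite S" and v: "orthonormal {..<r} {..<r} v" and r: "0 < r"
    and nd: "\<And>k. k < r \<Longrightarrow> col_dist2 S h r k \<noteq> 0"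
  defines "z \<equiv> \<lambda>a. \<Sum>k<r. v 0 k * dual S h r k a" and "c \<equiv> \<lambda>j a. \<Sum>k<r. v j k * h k a"
  shows "sq_norm S z * col_dist2 S c r 0 = 1"
proof -
  let ?f = "col_residual S c r 0"
  have zc: "ip S z (c j) = (if j = 0 then 1 else 0)" if "j < r" for j
  proof -
    have "ip S z (c j) = (\<Sum>k<r. \<Sum>l<r. v 0 k * v j l * (if l = k then 1 else 0))"
      unfolding z_def c_def ip_double_sum using ip_dual[OF S _ _ nd] by simp
    also have "\<dots> = ip {..<r} (v 0) (v j)" by (simp add: ip_def if_distrib[of "\<lambda>c. _ * c"] cong: if_cong)
    finally show ?thesis using orthonormalD[OF v, of 0 j] r that by simp
  qed
  \<comment> \<open>The square matrix \<open>v\<close> has orthonormal columns as well, so its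
    transpose recovers the \<open>h k\<close> from the \<open>c j\<close>.\<close>
  have hc: "in_span S c r (h k)" if k: "k < r" for k
    unfolding in_span_def
  proof (intro exI[of _ "\<lambda>j. v j k"] ballI)
    fix a
    have "(\<Sum>j<r. v j k * c j a) = (\<Sum>l<r. (\<Sum>j<r. v j k * v j l) * h l a)"
      unfolding c_def sum_distrib_left sum_distrib_right by (subst sum.swap) (simp add: mult.assoc)
    also have "\<dots> = (\<Sum>l<r. (if k = l then 1 else 0) * h l a)"
      using orthonormal_complete[of "{..<r}" v k] v k by (intro sum.cong) auto
    also have "\<dots> = h k a" using k by (simp add: if_distrib[of "\<lambda>c. c * _"] cong: if_cong)
    finally show "h k a = (\<Sum>j<r. v j k * c j a)" by simp
  qed
  have "in_span S h r z" unfolding z_def by (rule in_span_sum) (use dual_in_span in auto)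
  then have "in_span S c r z" by (rule in_span_trans) (rule hc)
  then obtain \<alpha> where \<alpha>: "\<forall>a\<in>S. z a = (\<Sum>j<r. \<alpha> j * c j a)" by (auto simp: in_span_def)
  have ipz: "ip S z w = (\<Sum>j<r. \<alpha> j * ip S (c j) w)" for w
  proof -
    have "ip S z w = ip S (\<lambda>a. \<Sum>j<r. \<alpha> j * c j a) w" using \<alpha> by (intro ip_cong) auto
    then show ?thesis by (simp add: ip_sum_left)
  qed
  have "sq_norm S z = (\<Sum>j<r. \<alpha> j * (if j = 0 then 1 else 0))"
    unfolding ipz[of z] using zc by (intro sum.cong) (auto simp: ip_commute)
  then have 1: "sq_norm S z = \<alpha> 0" using r by (simp add: if_distrib[of "\<lambda>c. _ * c"] cong: if_cong)
  have "ip S (\<lambda>a. c 0 a - ?f a) z = 0"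
  proof (rule ip_in_span_eq_0[OF residual_span])
    fix k assume "k < r - 1"
    then show "ip S (others 0 c k) z = 0" using zc[of "Suc k"] by (simp add: others_def ip_commute)
  qed
  then have 2: "ip S z ?f = 1" using zc[of 0] r by (simp add: ip_diff_left ip_commute)
  \<comment> \<open>The same inner product is evaluated again through the expansion of
    \<open>z\<close>: every \<open>c j\<close> with \<open>j \<noteq> 0\<close> is orthogonal to
    \<open>?f\<close>, and \<open>\<alpha> 0\<close> is already known to be the squared norm of
    \<open>z\<close>.\<close>
  have "ip S z ?f = (\<Sum>j<r. \<alpha> j * (if j = 0 then col_dist2 S c r 0 else 0))"
    unfolding ipz[of ?f]
  proof (rule sum.cong)
    fix j assume j: "j \<in> {..<r}"
    show "\<alpha> j * ip S (c j) ?f = \<alpha> j * (if j = 0 then col_dist2 S c r 0 else 0)"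
    proof (cases "j = 0")
      case True
      then show ?thesis using ip_residual_self[OF S, of "others 0 c" "r - 1" "c 0"] by (simp add: ip_commute)
    next
      case False
      then obtain i where "i < r - 1" "others 0 c i = c j" using ex_others[of j r 0 c] j by auto
      then show ?thesis using residual_orth[OF S, of i "r - 1" "others 0 c" "c 0"] False
        by (simp add: ip_commute)
    qed
  qed simp
  also have "\<dots> = \<alpha> 0 * col_dist2 S c r 0" using r by (simp add: if_distrib[of "\<lambda>c. _ * c"] cong: if_cong)
  finally show ?thesis using 1 2 by simp
qed

lemma ip_times: "ip (S \<times> R) v w = (\<Sum>a\<in>S. \<Sum>k\<in>R. v (a, k) * w (a, k))"
  unfolding ip_def by (simp add: sum.cartesian_product case_prod_beta)

lemma measurable_col_dist2 [measurable]:
  "(\<lambda>g. col_dist2 S (\<lambda>j a. g (a, j)) r k) \<in> borel_measurable (gauss A)"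
  by (intro measurable_ip2 measurable_residual) (simp_all add: others_def measurable_gauss_component)

text \<open>For fixed other columns there are \<open>q\<close> orthonormal vectors orthogonal to all
  of them. Column \<open>k\<close> has independent Gaussian coordinates along these vectors, and its
  squared distance is at least their sum of squares. The vectors are chosen separately for each
  value of the other columns; the bound does not depend on that value, so measurability of the
  choice never arises.\<close>

lemma nn_integral_col_dist2:
  fixes F :: "real \<Rightarrow> ennreal" and S :: "'a set"
  assumes S: "finite S" and k: "k < r" and q: "(r - 1) + q \<le> card S"
    and F[measurable]: "F \<in> borel_measurable borel" and anti: "\<And>x y. 0 \<le> x \<Longrightarrow> x \<le> y \<Longrightarrow> F y \<le> F x"
  shows "(\<integral>\<^sup>+g. F (col_dist2 S (\<lambda>j a. g (a, j)) r k) \<partial>gauss (S \<times> {..<r}))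
     \<le> (\<integral>\<^sup>+y. F (\<Sum>i<q. (y i)\<^sup>2) \<partial>gauss {..<q})" (is "_ \<le> ?R")
proof -
  define A where "A = S \<times> ({..<r} - {k})"
  define B where "B = S \<times> {k}"
  have AB: "S \<times> {..<r} = A \<union> B" "A \<inter> B = {}" "finite A" "finite B" using S k by (auto simp: A_def B_def)
  interpret A: prob_space "gauss A" by (rule prob_space_gauss)
  let ?G = "\<lambda>g. F (col_dist2 S (\<lambda>j a. g (a, j)) r k)"
  have "(\<integral>\<^sup>+g. ?G g \<partial>gauss (S \<times> {..<r})) = (\<integral>\<^sup>+x. \<integral>\<^sup>+y. ?G (merge A B (x, y)) \<partial>gauss B \<partial>gauss A)"
    unfolding AB(1) by (rule stdn_prod.product_nn_integral_fold) (use AB in \<open>auto intro: measurable_compose[OF measurable_col_dist2 F, simplified]\<close>)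
  also have "\<dots> \<le> (\<integral>\<^sup>+x. ?R \<partial>gauss A)"
  proof (rule nn_integral_mono)
    fix x :: "'a \<times> nat \<Rightarrow> real"
    define h :: "nat \<Rightarrow> 'a \<Rightarrow> real" where "h = (\<lambda>i a. x (a, if i < k then i else Suc i))"
    obtain e where e: "orthonormal S {..<q} e" and eh: "\<forall>i<q. \<forall>j<r - 1. ip S (e i) (h j) = 0"
      using orthonormal_complement[OF S q] by blast
    define e' where "e' = (\<lambda>i (a, j :: nat). e i a)"
    have e': "orthonormal B {..<q} e'"
      using e by (simp add: orthonormal_def B_def ip_times e'_def) (simp add: ip_def)
    have "(\<integral>\<^sup>+y. ?G (merge A B (x, y)) \<partial>gauss B) \<le> (\<integral>\<^sup>+y. F (\<Sum>i<q. (ip B (e' i) y)\<^sup>2) \<partial>gauss B)"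
    proof (rule nn_integral_mono)
      fix y
      let ?m = "\<lambda>j a. merge A B (x, y) (a, j)"
      have "(\<Sum>i<q. (ip B (e' i) y)\<^sup>2) = (\<Sum>i<q. (ip S (?m k) (e i))\<^sup>2)"
      proof (rule sum.cong)
        fix i
        have "ip B (e' i) y = ip S (?m k) (e i)"
          by (simp add: B_def ip_times e'_def) (auto simp: ip_def merge_def A_def mult.commute intro!: sum.cong)
        then show "(ip B (e' i) y)\<^sup>2 = (ip S (?m k) (e i))\<^sup>2" by simp
      qed simp
      also have "\<dots> \<le> col_dist2 S ?m r k"
      proof (rule residual_ge[OF S e])
        fix i j assume ij: "i < q" "j < r - 1"
        have "ip S (e i) (others k ?m j) = ip S (e i) (h j)"
          using ij k by (intro ip_cong) (auto simp: others_def h_def merge_def A_def)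
        then show "ip S (e i) (others k ?m j) = 0" using eh ij by simp
      qed
      finally show "?G (merge A B (x, y)) \<le> F (\<Sum>i<q. (ip B (e' i) y)\<^sup>2)"
        by (intro anti) (auto simp: sum_nonneg)
    qed
    also have "\<dots> = (\<integral>\<^sup>+y. (\<lambda>z. F (\<Sum>i<q. (z i)\<^sup>2)) (\<lambda>i\<in>{..<q}. ip B (e' i) y) \<partial>gauss B)"
      by (intro nn_integral_cong arg_cong[where f = F] sum.cong) auto
    also have "\<dots> = ?R"
      by (rule nn_integral_gauss_orthonormal[OF AB(4) _ e']) (auto intro: measurable_compose[OF measurable_gauss_sum_sq F])
    finally show "(\<integral>\<^sup>+y. ?G (merge A B (x, y)) \<partial>gauss B) \<le> ?R" .
  qed
  also have "\<dots> = ?R" by (simp add: A.emeasure_space_1)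
  finally show ?thesis .
qed

lemma nn_integral_ipow_col_dist2:
  assumes "finite S" "k < r" "(r - 1) + q \<le> card S" "real q = 2 * a + 1" "a \<ge> 1"
  shows "(\<integral>\<^sup>+g. ipow a (col_dist2 S (\<lambda>j a. g (a, j)) r k) \<partial>gauss (S \<times> {..<r})) \<le> ennreal (2 powr (1 - a) / Gamma a)"
proof -
  have "(\<integral>\<^sup>+g. ipow a (col_dist2 S (\<lambda>j a. g (a, j)) r k) \<partial>gauss (S \<times> {..<r})) \<le> (\<integral>\<^sup>+y. ipow a (\<Sum>i<q. (y i)\<^sup>2) \<partial>gauss {..<q})"
    by (rule nn_integral_col_dist2) (use assms in \<open>auto intro: ipow_antimono\<close>)
  also have "\<dots> \<le> ennreal (2 powr (1 - a) / Gamma a)"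
    by (rule chi_square_negative_moment) (use assms in auto)
  finally show ?thesis .
qed

text \<open>A finite integral of \<open>ipow\<close>, which is infinite at zero, excludes a zero
  distance almost surely. Thus the moment bound also yields linear independence of the
  columns.\<close>

lemma AE_col_dist2_nonzero:
  assumes "finite S" "(r - 1) + q \<le> card S" "real q = 2 * a + 1" "a \<ge> 1"
  shows "AE g in gauss (S \<times> {..<r}). \<forall>k<r. col_dist2 S (\<lambda>j a. g (a, j)) r k \<noteq> 0"
proof -
  have "AE g in gauss (S \<times> {..<r}). col_dist2 S (\<lambda>j a. g (a, j)) r k \<noteq> 0" if "k < r" for k
  proof -
    have "AE g in gauss (S \<times> {..<r}). ipow a (col_dist2 S (\<lambda>j a. g (a, j)) r k) \<noteq> \<infinity>"
    proof (rule nn_integral_noteq_infinite)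
      show "(\<lambda>g. ipow a (col_dist2 S (\<lambda>j a. g (a, j)) r k)) \<in> borel_measurable (gauss (S \<times> {..<r}))"
        by (rule measurable_compose[OF measurable_col_dist2 measurable_ipow])
    qed (use nn_integral_ipow_col_dist2[OF assms(1) that assms(2-4)] in \<open>auto simp: top_unique\<close>)
    then show ?thesis by eventually_elim (auto simp: ipow_def)
  qed
  then have "AE g in gauss (S \<times> {..<r}). \<forall>k\<in>{..<r}. col_dist2 S (\<lambda>j a. g (a, j)) r k \<noteq> 0"
    by (intro AE_finite_allI) auto
  then show ?thesis unfolding Ball_def lessThan_iff .
qed

lemma powr_le_ipow:
  assumes "x * y = 1" "0 \<le> y" shows "ennreal (x powr a) \<le> ipow a y"
proof -
  have "y \<noteq> 0" using assms(1) by auto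
  moreover from this have "x = 1 / y" using assms(1) by (metis nonzero_eq_divide_eq)
  ultimately show ?thesis using assms(2) by (simp add: ipow_def powr_divide powr_minus_divide)
qed

text \<open>An orthogonal matrix with first row \<open>n\<close> mixes the Gaussian columns into
  columns with the same joint law. With respect to these the combination is a single dual vector, so
  the bound for one column distance applies.\<close>

lemma dual_moment:
  fixes S :: "'a set"
  assumes S: "finite S" and r: "0 < r" and q: "(r - 1) + q \<le> card S" "real q = 2 * a + 1" "a \<ge> 1"
    and n: "sq_norm {..<r} n = 1"
  defines "z \<equiv> \<lambda>g a. \<Sum>k<r. n k * dual S (\<lambda>j a. g (a, j)) r k a"
  shows "(\<integral>\<^sup>+g. ennreal (sq_norm S (z g) powr a) \<partial>gauss (S \<times> {..<r})) \<le> ennreal (2 powr (1 - a) / Gamma a)"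
proof -
  have "orthonormal {..<r} {..<1} (\<lambda>_::nat. n)" using n by (simp add: orthonormal_def)
  then obtain v where v: "orthonormal {..<r} {..<r} v" and v0: "v 0 = n"
    using orthonormal_extend[of "{..<r}" 1 "\<lambda>_. n"] by auto
  let ?A = "S \<times> {..<r}"
  \<comment> \<open>Coordinate \<open>(a, j)\<close> along this family is entry \<open>a\<close> of
    the mixed column \<open>j\<close>: each row of the matrix is multiplied by
    \<open>v\<close>.\<close>
  define E where "E = (\<lambda>(a :: 'a, j) (b :: 'a, k). if b = a then v j k else 0 :: real)"
  have ipE: "ip ?A (E (a, j)) g = (\<Sum>k<r. v j k * g (a, k))" if "a \<in> S" for a j g
  proof -
    have "ip ?A (E (a, j)) g = (\<Sum>b\<in>S. if b = a then (\<Sum>k<r. v j k * g (a, k)) else 0)"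
      unfolding ip_times E_def by (intro sum.cong) auto
    then show ?thesis using that S by simp
  qed
  have E: "orthonormal ?A ?A E"
    unfolding orthonormal_def
  proof (clarify)
    fix a j a' j' assume *: "a \<in> S" "j < r" "a' \<in> S" "j' < r"
    have "ip ?A (E (a, j)) (E (a', j')) = (\<Sum>k<r. v j k * (if a = a' then v j' k else 0))"
      using * by (simp add: ipE) (simp add: E_def)
    also have "\<dots> = (if (a, j) = (a', j') then 1 else 0)"
      using orthonormalD[OF v, of j j'] * by (cases "a = a'") (auto simp: ip_def)
    finally show "ip ?A (E (a, j)) (E (a', j')) = (if (a, j) = (a', j') then 1 else 0)" .
  qed
  let ?c = "\<lambda>g j a. \<Sum>k<r. v j k * g (a, k)"
  have "(\<integral>\<^sup>+g. ennreal (sq_norm S (z g) powr a) \<partial>gauss ?A) \<le> (\<integral>\<^sup>+g. ipow a (col_dist2 S (?c g) r 0) \<partial>gauss ?A)"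
  proof (rule nn_integral_mono_AE)
    show "AE g in gauss ?A. ennreal (sq_norm S (z g) powr a) \<le> ipow a (col_dist2 S (?c g) r 0)"
      using AE_col_dist2_nonzero[OF S q]
    proof eventually_elim
      case (elim g)
      have 1: "sq_norm S (z g) * col_dist2 S (?c g) r 0 = 1"
        using dual_combination[OF S v r, of "\<lambda>j a. g (a, j)"] elim by (simp add: z_def v0)
      then show ?case by (rule powr_le_ipow) simp
    qed
  qed
  also have "\<dots> = (\<integral>\<^sup>+g. (\<lambda>y. ipow a (col_dist2 S (\<lambda>j a. y (a, j)) r 0)) (\<lambda>p\<in>?A. ip ?A (E p) g) \<partial>gauss ?A)"
  proof (intro nn_integral_cong arg_cong[where f = "ipow a"])
    fix g
    have "col_residual S (?c g) r 0 a = col_residual S (\<lambda>j a. (\<lambda>p\<in>?A. ip ?A (E p) g) (a, j)) r 0 a" if "a \<in> S" for a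
      using that r by (intro residual_cong) (auto simp: others_def ipE)
    then show "col_dist2 S (?c g) r 0 = col_dist2 S (\<lambda>j a. (\<lambda>p\<in>?A. ip ?A (E p) g) (a, j)) r 0"
      by (intro ip_cong)
  qed
  also have "\<dots> = (\<integral>\<^sup>+y. ipow a (col_dist2 S (\<lambda>j a. y (a, j)) r 0) \<partial>gauss ?A)"
    by (rule nn_integral_gauss_orthonormal[OF _ _ E measurable_compose[OF measurable_col_dist2 measurable_ipow]])
      (use S in auto)
  also have "\<dots> \<le> ennreal (2 powr (1 - a) / Gamma a)"
    by (rule nn_integral_ipow_col_dist2) (use assms in auto)
  finally show ?thesis .
qed

section \<open>The randomized range finder\<close>

lemma rotation_maximum:
  assumes "\<And>c s :: real. c\<^sup>2 + s\<^sup>2 = 1 \<Longrightarrow> c * \<alpha> + s * \<beta> \<le> \<alpha>"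
  shows "\<beta> = 0"
proof (rule ccontr)
  assume b: "\<beta> \<noteq> 0"
  define \<rho> where "\<rho> = sqrt (\<alpha>\<^sup>2 + \<beta>\<^sup>2)"
  have r2: "\<rho>\<^sup>2 = \<alpha>\<^sup>2 + \<beta>\<^sup>2" by (simp add: \<rho>_def)
  have pos: "\<rho> > 0" using b by (simp add: \<rho>_def add_nonneg_pos)
  \<comment> \<open>At this unit vector the linear form takes the value \<open>\<rho>\<close>, which
    exceeds \<open>\<alpha>\<close> unless \<open>\<beta> = 0\<close>. This serves as a first-order
    condition without derivatives.\<close>
  have "(\<alpha> / \<rho>)\<^sup>2 + (\<beta> / \<rho>)\<^sup>2 = 1"
    using pos by (simp add: power_divide add_divide_distrib[symmetric] r2[symmetric])
  then have "\<alpha> / \<rho> * \<alpha> + \<beta> / \<rho> * \<beta> \<le> \<alpha>" by (rule assms)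
  moreover have "\<alpha> / \<rho> * \<alpha> + \<beta> / \<rho> * \<beta> = (\<alpha>\<^sup>2 + \<beta>\<^sup>2) / \<rho>"
    by (simp add: add_divide_distrib power2_eq_square)
  ultimately have "\<rho> \<le> \<alpha>" using pos unfolding r2[symmetric] by (simp add: power2_eq_square)
  then have "\<rho>\<^sup>2 \<le> \<alpha>\<^sup>2" using pos by (intro power_mono) auto
  then show False using b r2 by simp
qed

lemma continuous_on_coordinate: "continuous_on UNIV (\<lambda>x :: 'i \<Rightarrow> real. x i)"
  by (rule continuous_on_product_coordinates)

text \<open>A continuous function attains its maximum on the compact set of orthonormal systems.
  Compactness is shown in the product topology on all functions, after extending systems by zero
  outside the relevant indices.\<close>

lemma ex_max_orthonormal:
  fixes S :: "'a set" and L :: "nat \<Rightarrow> 'a \<Rightarrow> real"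
  assumes S: "finite S" and r: "r \<le> card S"
  shows "\<exists>q. orthonormal S {..<r} q \<and>
    (\<forall>q'. orthonormal S {..<r} q' \<longrightarrow> (\<Sum>k<r. ip S (L k) (q' k)) \<le> (\<Sum>k<r. ip S (L k) (q k)))"
proof -
  \<comment> \<open>Entries of orthonormal systems lie between -1 and 1, and all irrelevant entries
    are pinned to 0, so the product of these sets is compact by Tychonoff's theorem.\<close>
  define T where "T = (\<lambda>(k, a). if k < r \<and> a \<in> S then {-1..1} else {0 :: real})"
  define B where "B = {Q :: nat \<times> 'a \<Rightarrow> real. \<forall>p. Q p \<in> T p}"
  define O' where "O' = {Q :: nat \<times> 'a \<Rightarrow> real. orthonormal S {..<r} (\<lambda>k a. Q (k, a))}"
  define F where "F = (\<lambda>Q :: nat \<times> 'a \<Rightarrow> real. \<Sum>k<r. ip S (L k) (\<lambda>a. Q (k, a)))"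
  have "compactin (product_topology (\<lambda>_. euclidean) UNIV) (PiE UNIV T)"
    by (subst compactin_PiE) (auto simp: T_def)
  then have "compact (PiE UNIV T)" by (simp add: euclidean_product_topology)
  moreover have "PiE UNIV T = B" by (auto simp: B_def PiE_def)
  moreover have "O' = (\<Inter>k\<in>{..<r}. \<Inter>l\<in>{..<r}. {Q. ip S (\<lambda>a. Q (k, a)) (\<lambda>a. Q (l, a)) = (if k = l then 1 else 0)})"
    by (auto simp: O'_def orthonormal_def)
  moreover have "closed {Q :: nat \<times> 'a \<Rightarrow> real. ip S (\<lambda>a. Q (k, a)) (\<lambda>a. Q (l, a)) = (if k = l then 1 else 0)}" for k l :: nat
    unfolding ip_def
    by (intro closed_Collect_eq continuous_on_sum continuous_on_mult continuous_on_coordinate continuous_on_const)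
  ultimately have cpt: "compact (B \<inter> O')" by (intro compact_Int_closed) auto
  define cut where "cut = (\<lambda>q :: nat \<Rightarrow> 'a \<Rightarrow> real. \<lambda>(k, a). if k < r \<and> a \<in> S then q k a else 0)"
  have ipcut: "ip S v (\<lambda>a. cut q (k, a)) = ip S v (q k)" if "k < r" for v q k
    using that by (intro ip_cong) (auto simp: cut_def)
  have cut: "cut q \<in> B \<inter> O'" "F (cut q) = (\<Sum>k<r. ip S (L k) (q k))" if q: "orthonormal S {..<r} q" for q
  proof -
    have "orthonormal S {..<r} (\<lambda>k a. cut q (k, a))"
    proof -
      have "ip S (\<lambda>a. cut q (k, a)) (\<lambda>a. cut q (l, a)) = ip S (q k) (q l)" if "k < r" "l < r" for k l
        using that by (metis ipcut ip_commute)
      then show ?thesis using q by (simp add: orthonormal_def)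
    qed
    moreover have "\<bar>q k a\<bar> \<le> 1" if "k < r" "a \<in> S" for k a
    proof -
      have "(q k a)\<^sup>2 \<le> (\<Sum>a\<in>S. (q k a)\<^sup>2)" using that S by (intro member_le_sum) auto
      also have "\<dots> = 1" using orthonormalD[OF q, of k k] that by (simp add: ip_def power2_eq_square)
      finally show ?thesis by (simp add: abs_square_le_1)
    qed
    ultimately show "cut q \<in> B \<inter> O'"
      by (auto simp: B_def O'_def T_def cut_def abs_le_iff split: if_splits)
    show "F (cut q) = (\<Sum>k<r. ip S (L k) (q k))" by (simp add: F_def ipcut)
  qed
  obtain e where "orthonormal S {..<r} e" using orthonormal_complement[OF S, of 0 r] r by auto
  then have ne: "B \<inter> O' \<noteq> {}" using cut by blast
  have "continuous_on (B \<inter> O') F"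
    unfolding F_def ip_def
    by (rule continuous_on_subset[of UNIV])
      (auto intro!: continuous_on_sum continuous_on_mult continuous_on_coordinate continuous_on_const)
  then obtain Q where Q: "Q \<in> B \<inter> O'" "\<forall>Q'\<in>B \<inter> O'. F Q' \<le> F Q"
    using continuous_attains_sup[OF cpt ne] by blast
  show ?thesis
  proof (intro exI[of _ "\<lambda>k a. Q (k, a)"] conjI allI impI)
    show "orthonormal S {..<r} (\<lambda>k a. Q (k, a))" using Q by (simp add: O'_def)
    fix q' assume q': "orthonormal S {..<r} q'"
    have "F (cut q') \<le> F Q" using Q(2) cut(1)[OF q'] by blast
    then show "(\<Sum>k<r. ip S (L k) (q' k)) \<le> (\<Sum>k<r. ip S (L k) (\<lambda>a. Q (k, a)))"
      unfolding cut(2)[OF q'] unfolding F_def .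
  qed
qed

lemma ip_lincomb2: "ip A v (\<lambda>a. c * x a + d * y a) = c * ip A v x + d * ip A v y"
  by (simp add: ip_def sum.distrib sum_distrib_left algebra_simps)

text \<open>Polar decomposition \<open>L = A Q\<close> with symmetric \<open>A\<close>: at a maximiser of the trace
  \<open>\<Sum>k. ip S (L k) (q k)\<close> the derivative along every plane rotation vanishes.\<close>
lemma polar_decomposition:
  fixes S :: "'a set" and L :: "nat \<Rightarrow> 'a \<Rightarrow> real"
  assumes S: "finite S" and r: "r \<le> card S"
  obtains q where "orthonormal S {..<r} q"
    "\<And>j k. j < r \<Longrightarrow> k < r \<Longrightarrow> ip S (L j) (q k) = ip S (L k) (q j)"
    "\<And>k a. k < r \<Longrightarrow> a \<in> S \<Longrightarrow> L k a = (\<Sum>j<r. ip S (L k) (q j) * q j a)"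
proof -
  obtain q where q: "orthonormal S {..<r} q"
    and max: "\<And>q'. orthonormal S {..<r} q' \<Longrightarrow> (\<Sum>k<r. ip S (L k) (q' k)) \<le> (\<Sum>k<r. ip S (L k) (q k))"
    using ex_max_orthonormal[OF assms, of L] by blast
  note on = orthonormalD[OF q]
  have sym: "ip S (L j) (q k) = ip S (L k) (q j)" if jk: "j < r" "k < r" "j \<noteq> k" for j k
  proof -
    have "c * (ip S (L j) (q j) + ip S (L k) (q k)) + s * (ip S (L j) (q k) - ip S (L k) (q j))
       \<le> ip S (L j) (q j) + ip S (L k) (q k)" if cs: "c\<^sup>2 + s\<^sup>2 = 1" for c s
    proof -
      \<comment> \<open>After this rotation the two affected terms of the trace become
        \<open>c\<close> times their old sum plus \<open>s\<close> times the antisymmetric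
        difference that has to vanish.\<close>
      define x y where "x = (\<lambda>a. c * q j a + s * q k a)" and "y = (\<lambda>a. - s * q j a + c * q k a)"
      have cs': "c * c + s * s = 1" using cs by (simp add: power2_eq_square)
      have ipx: "ip S v x = c * ip S v (q j) + s * ip S v (q k)"
        and ipy: "ip S v y = - s * ip S v (q j) + c * ip S v (q k)" for v
        unfolding x_def y_def by (rule ip_lincomb2)+
      have xx: "sq_norm S x = 1" "sq_norm S y = 1" "ip S x y = 0" "ip S y x = 0"
        using on jk cs' by (simp_all add: ipx ipy ip_commute[of S x] ip_commute[of S y] add.commute)
      have xo: "ip S x (q l) = 0" "ip S y (q l) = 0" "ip S (q l) x = 0" "ip S (q l) y = 0"
        if "l < r" "l \<noteq> j" "l \<noteq> k" for l
        using on jk that by (simp_all add: ipx ipy ip_commute[of S x] ip_commute[of S y])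
      have "orthonormal S {..<r} (q(j := x, k := y))"
        using xx xo on jk by (auto simp: orthonormal_def)
      then have "(\<Sum>l<r. ip S (L l) ((q(j := x, k := y)) l)) \<le> (\<Sum>l<r. ip S (L l) (q l))" by (rule max)
      moreover have "{..<r} = insert j (insert k ({..<r} - {j, k}))" using jk by auto
      then have split: "(\<Sum>l<r. f l) = f j + (f k + (\<Sum>l\<in>{..<r} - {j, k}. f l))" for f :: "nat \<Rightarrow> real"
        using jk by (metis Diff_iff finite_Diff finite_insert finite_lessThan insertCI insertE sum.insert)
      have "(\<Sum>l\<in>{..<r} - {j, k}. ip S (L l) ((q(j := x, k := y)) l)) = (\<Sum>l\<in>{..<r} - {j, k}. ip S (L l) (q l))"
        by (rule sum.cong) auto
      ultimately have "ip S (L j) x + ip S (L k) y \<le> ip S (L j) (q j) + ip S (L k) (q k)"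
        unfolding split using jk by simp
      then show ?thesis unfolding ipx ipy by (simp add: algebra_simps)
    qed
    then show ?thesis using rotation_maximum by fastforce
  qed
  \<comment> \<open>If \<open>L k\<close> had a part outside the span of the \<open>q j\<close>,
    turning \<open>q k\<close> towards that direction would increase the trace.\<close>
  have span: "L k a = (\<Sum>j<r. ip S (L k) (q j) * q j a)" if k: "k < r" and a: "a \<in> S" for k a
  proof -
    define w where "w = residual S q r (L k)"
    have "sq_norm S w = 0"
    proof (rule ccontr)
      assume nz: "sq_norm S w \<noteq> 0"
      define v where "v = (\<lambda>a. inverse (sqrt (sq_norm S w)) * w a)"
      have vv: "sq_norm S v = 1" using ip_normalize[OF nz] by (simp add: v_def)
      have vq: "ip S v (q l) = 0" "ip S (q l) v = 0" if "l < r" for l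
        using residual_orth[OF S that, of q "L k"] by (simp_all add: v_def ip_scale_left ip_scale_right w_def ip_commute)
      have "c * ip S (L k) (q k) + s * ip S (L k) v \<le> ip S (L k) (q k)" if cs: "c\<^sup>2 + s\<^sup>2 = 1" for c s
      proof -
        define x where "x = (\<lambda>a. c * q k a + s * v a)"
        have ipx: "ip S u x = c * ip S u (q k) + s * ip S u v" for u
          unfolding x_def by (rule ip_lincomb2)
        have xx: "sq_norm S x = 1"
          using on k cs vv vq by (simp add: ipx ip_commute[of S x] power2_eq_square)
        have xo: "ip S x (q l) = 0" "ip S (q l) x = 0" if "l < r" "l \<noteq> k" for l
          using on k that vq by (simp_all add: ipx ip_commute[of S x])
        have "orthonormal S {..<r} (q(k := x))"
          using xx xo on k by (auto simp: orthonormal_def)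
        then have "(\<Sum>l<r. ip S (L l) ((q(k := x)) l)) \<le> (\<Sum>l<r. ip S (L l) (q l))" by (rule max)
        then have "ip S (L k) x \<le> ip S (L k) (q k)"
          using k by (simp add: sum.remove[of "{..<r}" k])
        then show ?thesis unfolding ipx .
      qed
      then have "ip S (L k) v = 0" by (rule rotation_maximum)
      then have "ip S (L k) w = 0" using nz by (simp add: v_def ip_scale_right)
      then show False using nz ip_residual_self[OF S, of q r "L k"] by (simp add: w_def ip_commute)
    qed
    then have "w a = 0" using S a by (simp add: ip_self_eq_0)
    then show ?thesis using residual_orthonormal[OF S q a, of "L k"] by (simp add: w_def)
  qed
  show thesis
  proof (rule that[OF q _ span])
    show "ip S (L j) (q k) = ip S (L k) (q j)" if "j < r" "k < r" for j k
      using sym[OF that] by (cases "j = k") auto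
  qed
qed

text \<open>Both sides depend on \<open>L\<close> only through the symmetric factor of its polar decomposition.\<close>
lemma nn_integral_gauss_polar:
  fixes S :: "'a set" and M :: "'m set" and C :: "'c set" and F :: "real \<Rightarrow> ennreal"
  assumes S: "finite S" and r: "r \<le> card S" and M: "finite M" and F[measurable]: "F \<in> borel_measurable borel"
  shows "(\<integral>\<^sup>+g. F (\<Sum>c\<in>C. \<Sum>k<r. (ip S (L k) (\<lambda>a. \<Sum>l\<in>M. g (a, l) * D l c))\<^sup>2) \<partial>gauss (S \<times> M))
    = (\<integral>\<^sup>+N. F (\<Sum>c\<in>C. sq_norm S (\<lambda>a. \<Sum>k<r. (\<Sum>l\<in>M. N (k, l) * D l c) * L k a)) \<partial>gauss ({..<r} \<times> M))"
proof -
  obtain q where q: "orthonormal S {..<r} q"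
    and sym: "\<And>j k. j < r \<Longrightarrow> k < r \<Longrightarrow> ip S (L j) (q k) = ip S (L k) (q j)"
    and L: "\<And>k a. k < r \<Longrightarrow> a \<in> S \<Longrightarrow> L k a = (\<Sum>j<r. ip S (L k) (q j) * q j a)"
    using polar_decomposition[OF S r, of L] by metis
  \<comment> \<open>In matrix form \<open>L = A Q\<close>, where \<open>Q\<close> has the rows
    \<open>q j\<close>.\<close>
  define A where "A = (\<lambda>k j. ip S (L k) (q j))"
  define n where "n = (\<lambda>N c k. \<Sum>l\<in>M. N (k :: nat, l) * D l c)"
  define E where "E = (\<lambda>(j :: nat, l :: 'm) (a :: 'a, l' :: 'm). if l' = l then q j a else 0)"
  have ipE: "ip (S \<times> M) (E (j, l)) g = (\<Sum>a\<in>S. q j a * g (a, l))" if "l \<in> M" for j l g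
    unfolding ip_times E_def using that M by (simp add: if_distrib[of "\<lambda>c. c * _"] cong: if_cong)
  have E: "orthonormal (S \<times> M) ({..<r} \<times> M) E"
    unfolding orthonormal_def
  proof (clarify)
    fix j l j' l' assume *: "j < r" "j' < r" "l \<in> M" "l' \<in> M"
    have "ip (S \<times> M) (E (j, l)) (E (j', l')) = (\<Sum>a\<in>S. q j a * (if l = l' then q j' a else 0))"
      using * by (simp add: ipE) (simp add: E_def)
    also have "\<dots> = (if (j, l) = (j', l') then 1 else 0)"
      using orthonormalD[OF q, of j j'] * by (cases "l = l'") (auto simp: ip_def)
    finally show "ip (S \<times> M) (E (j, l)) (E (j', l')) = (if (j, l) = (j', l') then 1 else 0)" .
  qed
  \<comment> \<open>Because \<open>Q\<close> has orthonormal rows, \<open>Q G\<close> is a Gaussian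
    matrix with \<open>r\<close> rows, and \<open>L G D = A (Q G) D\<close>.\<close>
  have left: "ip S (L k) (\<lambda>a. \<Sum>l\<in>M. g (a, l) * D l c) = (\<Sum>j<r. A k j * n (\<lambda>p\<in>{..<r} \<times> M. ip (S \<times> M) (E p) g) c j)"
    if k: "k < r" for k g c
  proof -
    have "ip S (L k) (\<lambda>a. \<Sum>l\<in>M. g (a, l) * D l c) = ip S (\<lambda>a. \<Sum>j<r. A k j * q j a) (\<lambda>a. \<Sum>l\<in>M. g (a, l) * D l c)"
      using L[OF k] by (intro ip_cong) (auto simp: A_def)
    also have "\<dots> = (\<Sum>j<r. A k j * ip S (q j) (\<lambda>a. \<Sum>l\<in>M. D l c * g (a, l)))"
      by (simp add: ip_sum_left mult.commute)
    also have "\<dots> = (\<Sum>j<r. A k j * (\<Sum>l\<in>M. D l c * ip S (q j) (\<lambda>a. g (a, l))))"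
      by (simp only: ip_sum_right)
    also have "\<dots> = (\<Sum>j<r. A k j * n (\<lambda>p\<in>{..<r} \<times> M. ip (S \<times> M) (E p) g) c j)"
    proof -
      have "ip (S \<times> M) (E (j, l)) g = ip S (q j) (\<lambda>a. g (a, l))" if "l \<in> M" for j l
        using that by (simp add: ipE) (simp add: ip_def)
      then show ?thesis by (simp add: n_def mult.commute)
    qed
    finally show ?thesis .
  qed
  \<comment> \<open>Here \<open>L\<close> acts transposed: the vector \<open>Q^T A^T x\<close> has
    the length of \<open>A^T x\<close>, and symmetry turns this into \<open>A x\<close>.\<close>
  have right: "sq_norm S (\<lambda>a. \<Sum>k<r. x k * L k a) = (\<Sum>j<r. (\<Sum>k<r. A j k * x k)\<^sup>2)" for x
  proof -
    have "sq_norm S (\<lambda>a. \<Sum>k<r. x k * L k a)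
      = sq_norm S (\<lambda>a. \<Sum>j<r. (\<Sum>k<r. A j k * x k) * q j a)"
    proof -
      have "(\<Sum>k<r. x k * L k a) = (\<Sum>j<r. (\<Sum>k<r. A j k * x k) * q j a)" if "a \<in> S" for a
      proof -
        have "(\<Sum>k<r. x k * L k a) = (\<Sum>k<r. \<Sum>j<r. x k * (A k j * q j a))"
          using L that by (intro sum.cong) (auto simp: A_def sum_distrib_left)
        also have "\<dots> = (\<Sum>j<r. \<Sum>k<r. x k * (A k j * q j a))" by (rule sum.swap)
        also have "\<dots> = (\<Sum>j<r. (\<Sum>k<r. A j k * x k) * q j a)"
          unfolding sum_distrib_right using sym by (intro sum.cong) (auto simp: A_def)
        finally show ?thesis .
      qed
      then show ?thesis by (intro ip_cong) auto
    qed
    also have "\<dots> = (\<Sum>j<r. \<Sum>j'<r. (\<Sum>k<r. A j k * x k) * (\<Sum>k<r. A j' k * x k) * ip S (q j) (q j'))"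
      by (rule ip_double_sum)
    also have "\<dots> = (\<Sum>j<r. \<Sum>j'<r. if j' = j then (\<Sum>k<r. A j k * x k) * (\<Sum>k<r. A j' k * x k) else 0)"
      using orthonormalD[OF q] by (intro sum.cong) auto
    also have "\<dots> = (\<Sum>j<r. (\<Sum>k<r. A j k * x k)\<^sup>2)" by (simp add: power2_eq_square)
    finally show ?thesis .
  qed
  have "(\<integral>\<^sup>+g. F (\<Sum>c\<in>C. \<Sum>k<r. (ip S (L k) (\<lambda>a. \<Sum>l\<in>M. g (a, l) * D l c))\<^sup>2) \<partial>gauss (S \<times> M))
    = (\<integral>\<^sup>+g. (\<lambda>N. F (\<Sum>c\<in>C. \<Sum>k<r. (\<Sum>j<r. A k j * n N c j)\<^sup>2)) (\<lambda>p\<in>{..<r} \<times> M. ip (S \<times> M) (E p) g) \<partial>gauss (S \<times> M))"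
    by (intro nn_integral_cong arg_cong[where f = F] sum.cong refl) (simp add: left)
  also have "\<dots> = (\<integral>\<^sup>+N. F (\<Sum>c\<in>C. \<Sum>k<r. (\<Sum>j<r. A k j * n N c j)\<^sup>2) \<partial>gauss ({..<r} \<times> M))"
  proof (rule nn_integral_gauss_orthonormal[OF _ _ E])
    have "(\<lambda>N. \<Sum>c\<in>C. \<Sum>k<r. (\<Sum>j<r. A k j * n N c j)\<^sup>2) \<in> borel_measurable (gauss ({..<r} \<times> M))"
      unfolding n_def by (intro borel_measurable_sum borel_measurable_power borel_measurable_times
          borel_measurable_const measurable_gauss_component)
    then show "(\<lambda>N. F (\<Sum>c\<in>C. \<Sum>k<r. (\<Sum>j<r. A k j * n N c j)\<^sup>2)) \<in> borel_measurable (gauss ({..<r} \<times> M))"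
      by (rule measurable_compose[OF _ F])
  qed (use S M in auto)
  finally show ?thesis by (simp add: right n_def)
qed

section \<open>Moment and tail bounds for one sketch\<close>

lemma weighted_power_mean:
  fixes b y :: "'c \<Rightarrow> real"
  assumes C: "finite C" and b: "\<And>c. c \<in> C \<Longrightarrow> 0 \<le> b c" and y: "\<And>c. c \<in> C \<Longrightarrow> 0 \<le> y c" and a: "1 \<le> a"
  shows "(\<Sum>c\<in>C. b c * y c) powr a \<le> (\<Sum>c\<in>C. b c) powr (a - 1) * (\<Sum>c\<in>C. b c * y c powr a)"
proof -
  \<comment> \<open>Jensen's inequality for the convex power uses the normalised weights
    \<open>b c / W\<close>. Terms with zero weight or zero value contribute nothing and are removed
    beforehand, so that \<open>W\<close> is positive if anything is left.\<close>
  define T where "T = {c \<in> C. b c > 0 \<and> y c > 0}"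
  define W where "W = (\<Sum>c\<in>T. b c)"
  have T: "finite T" "T \<subseteq> C" using C by (auto simp: T_def)
  have eq: "(\<Sum>c\<in>C. b c * y c) = (\<Sum>c\<in>T. b c * y c)"
    by (rule sum.mono_neutral_right) (use C b y in \<open>force simp: T_def\<close>)+
  show ?thesis
  proof (cases "T = {}")
    case True
    then show ?thesis using eq b C by (simp add: sum_nonneg)
  next
    case False
    have W: "W > 0" unfolding W_def using T False by (intro sum_pos) (auto simp: T_def)
    have "(\<Sum>c\<in>T. (b c / W) *\<^sub>R y c) powr a \<le> (\<Sum>c\<in>T. b c / W * y c powr a)"
    proof (rule convex_on_sum[OF T(1) False powr_convex[OF a]])
      show "(\<Sum>c\<in>T. b c / W) = 1" using W by (simp add: sum_divide_distrib[symmetric] W_def)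
    qed (use W in \<open>auto simp: T_def\<close>)
    also have "(\<Sum>c\<in>T. (b c / W) *\<^sub>R y c) = (\<Sum>c\<in>T. b c * y c) / W" by (simp add: sum_divide_distrib)
    also have "(\<Sum>c\<in>T. b c / W * y c powr a) = (\<Sum>c\<in>T. b c * y c powr a) / W" by (simp add: sum_divide_distrib)
    finally have "(\<Sum>c\<in>T. b c * y c) powr a / W powr a \<le> (\<Sum>c\<in>T. b c * y c powr a) / W"
      using W by (simp add: powr_divide sum_nonneg T_def less_imp_le)
    then have "(\<Sum>c\<in>T. b c * y c) powr a \<le> W powr (a - 1) * (\<Sum>c\<in>T. b c * y c powr a)"
      using W by (simp add: powr_diff field_simps)
    also have "\<dots> \<le> (\<Sum>c\<in>C. b c) powr (a - 1) * (\<Sum>c\<in>C. b c * y c powr a)"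
      using W C T b a unfolding W_def
      by (intro mult_mono powr_mono2 sum_mono2 sum_nonneg mult_nonneg_nonneg) (auto simp: T_def)
    finally show ?thesis using eq by simp
  qed
qed

text \<open>Convexity of \<open>exp\<close> with weights \<open>e c / d\<close> reduces the
  exponential moment of the total energy to those of single columns, each a multiple of a chi-square
  variable with \<open>r\<close> degrees of freedom. This takes the place of diagonalising
  \<open>D\<close>. The threshold uses the nominal rank \<open>r0\<close>, which the attained rank
  \<open>r\<close> does not exceed.\<close>

lemma gauss_energy_tail:
  fixes D :: "'m \<Rightarrow> 'c \<Rightarrow> real"
  assumes M: "finite M" and C: "finite C" and r: "r \<le> r0"
  defines "d \<equiv> \<Sum>c\<in>C. \<Sum>l\<in>M. (D l c)\<^sup>2"
  shows "(\<integral>\<^sup>+N. indicator {2 * (real r0 + u\<^sup>2) * d<..} (\<Sum>c\<in>C. \<Sum>k<r. (\<Sum>l\<in>M. N (k, l) * D l c)\<^sup>2) \<partial>gauss ({..<r} \<times> M))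
    \<le> ennreal (exp (- u\<^sup>2 / 2))"
proof -
  define \<rho> where "\<rho> = 2 * (real r0 + u\<^sup>2)"
  define \<beta> where "\<beta> = (\<lambda>N. \<Sum>c\<in>C. \<Sum>k<r. (\<Sum>l\<in>M. N (k, l) * D l c)\<^sup>2)"
  define e where "e = (\<lambda>c. \<Sum>l\<in>M. (D l c)\<^sup>2)"
  have e0: "e c \<ge> 0" for c by (simp add: e_def sum_nonneg)
  have ez: "D l c = 0" if "e c = 0" "l \<in> M" for l c
    using that M by (simp add: e_def sum_nonneg_eq_0_iff)
  have d: "d = (\<Sum>c\<in>C. e c)" by (simp add: d_def e_def)
  show ?thesis
  proof (cases "d = 0")
    case True
    then have "e c = 0" if "c \<in> C" for c using that C e0 by (simp add: d sum_nonneg_eq_0_iff)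
    then have "(\<Sum>c\<in>C. \<Sum>k<r. (\<Sum>l\<in>M. N (k, l) * D l c)\<^sup>2) = 0" for N :: "nat \<times> 'm \<Rightarrow> real"
      using ez by simp
    then show ?thesis using True by simp
  next
    case False
    then have dpos: "d > 0" using e0 by (simp add: d less_le sum_nonneg)
    have Cne: "C \<noteq> {}" using False by (auto simp: d)
    \<comment> \<open>\<open>N\<close> is applied to the normalised column \<open>c\<close>; the
      factor \<open>1 / 4\<close> is the Chernoff parameter.\<close>
    define x where "x = (\<lambda>N c. (\<Sum>k<r. (\<Sum>l\<in>M. D l c / sqrt (e c) * N (k, l))\<^sup>2) / 4)"
    have ex: "(\<Sum>k<r. (\<Sum>l\<in>M. N (k, l) * D l c)\<^sup>2) = 4 * e c * x N c" for N c
    proof (cases "e c = 0")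
      case True
      then show ?thesis using ez by simp
    next
      case False
      have "(\<Sum>l\<in>M. N (k, l) * D l c) = sqrt (e c) * (\<Sum>l\<in>M. D l c / sqrt (e c) * N (k, l))" for k
        unfolding sum_distrib_left using False by (intro sum.cong) auto
      then have "(\<Sum>k<r. (\<Sum>l\<in>M. N (k, l) * D l c)\<^sup>2) = (\<Sum>k<r. e c * (\<Sum>l\<in>M. D l c / sqrt (e c) * N (k, l))\<^sup>2)"
        by (simp only: power_mult_distrib real_sqrt_pow2[OF e0])
      then show ?thesis unfolding x_def sum_distrib_left[symmetric] by (simp only: mult_ac)
    qed
    have pw: "indicator {\<rho> * d<..} (\<beta> N) \<le> ennreal (exp (- \<rho> / 4)) * (\<Sum>c\<in>C. ennreal (e c / d) * ennreal (exp (x N c)))" for N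
    proof (cases "\<beta> N > \<rho> * d")
      case True
      have "exp (\<Sum>c\<in>C. (e c / d) *\<^sub>R x N c) \<le> (\<Sum>c\<in>C. e c / d * exp (x N c))"
      proof (rule convex_on_sum[OF C Cne exp_convex])
        show "(\<Sum>c\<in>C. e c / d) = 1" using False by (simp add: sum_divide_distrib[symmetric] d)
      qed (use dpos e0 in auto)
      moreover have "\<beta> N = 4 * d * (\<Sum>c\<in>C. (e c / d) *\<^sub>R x N c)"
        using dpos by (simp add: \<beta>_def ex sum_distrib_left mult.assoc)
      then have "\<rho> / 4 < (\<Sum>c\<in>C. (e c / d) *\<^sub>R x N c)" using True dpos by (simp add: field_simps)
      then have "exp (- \<rho> / 4) * exp (\<Sum>c\<in>C. (e c / d) *\<^sub>R x N c) \<ge> 1"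
        unfolding exp_add[symmetric] by simp
      ultimately have "1 \<le> exp (- \<rho> / 4) * (\<Sum>c\<in>C. e c / d * exp (x N c))"
        by (smt (verit) exp_ge_zero mult_left_mono)
      then have "ennreal 1 \<le> ennreal (exp (- \<rho> / 4) * (\<Sum>c\<in>C. e c / d * exp (x N c)))"
        by (rule ennreal_leI)
      also have "\<dots> = ennreal (exp (- \<rho> / 4)) * (\<Sum>c\<in>C. ennreal (e c / d) * ennreal (exp (x N c)))"
        using dpos e0 by (simp add: ennreal_mult[symmetric] sum_nonneg)
      finally show ?thesis using True by simp
    qed simp
    have xm [measurable]: "(\<lambda>N. x N c) \<in> borel_measurable (gauss ({..<r} \<times> M))" for c
      unfolding x_def by (intro borel_measurable_divide borel_measurable_sum borel_measurable_power borel_measurable_times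
          borel_measurable_const measurable_gauss_component)
    \<comment> \<open>Keeping the weight in front disposes of columns with \<open>e c = 0\<close>,
      whose normalisation divides by zero.\<close>
    have mgf: "ennreal (e c / d) * (\<integral>\<^sup>+N. ennreal (exp (x N c)) \<partial>gauss ({..<r} \<times> M)) = ennreal (e c / d) * ennreal ((1 / 2) powr (- real r / 2))" for c
    proof (cases "e c = 0")
      case False
      define E where "E = (\<lambda>k (k' :: nat, l). if k' = k then D l c / sqrt (e c) else 0)"
      have ipE: "ip ({..<r} \<times> M) (E k) N = (\<Sum>l\<in>M. D l c / sqrt (e c) * N (k, l))" if "k < r" for k N
      proof -
        have "ip ({..<r} \<times> M) (E k) N = (\<Sum>k'<r. if k' = k then \<Sum>l\<in>M. D l c / sqrt (e c) * N (k, l) else 0)"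
          unfolding ip_times E_def by (intro sum.cong) auto
        then show ?thesis using that by simp
      qed
      have "(\<Sum>l\<in>M. D l c / sqrt (e c) * (D l c / sqrt (e c))) = (\<Sum>l\<in>M. (D l c)\<^sup>2 / e c)"
        using e0 by (intro sum.cong) (auto simp: power2_eq_square)
      also have "\<dots> = 1" using False by (simp add: sum_divide_distrib[symmetric] e_def)
      finally have on: "orthonormal ({..<r} \<times> M) {..<r} E"
        by (auto simp: orthonormal_def ipE) (auto simp: E_def)
      have "(\<integral>\<^sup>+N. ennreal (exp (x N c)) \<partial>gauss ({..<r} \<times> M))
        = (\<integral>\<^sup>+N. (\<lambda>y. ennreal (exp (- (- 1 / 4) * (\<Sum>k<r. (y k)\<^sup>2)))) (\<lambda>k\<in>{..<r}. ip ({..<r} \<times> M) (E k) N) \<partial>gauss ({..<r} \<times> M))"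
        by (intro nn_integral_cong arg_cong[where f = ennreal] arg_cong[where f = exp]) (simp add: x_def ipE)
      also have "\<dots> = (\<integral>\<^sup>+y. ennreal (exp (- (- 1 / 4) * (\<Sum>k<r. (y k)\<^sup>2))) \<partial>gauss {..<r})"
        by (rule nn_integral_gauss_orthonormal[OF _ _ on]) (use M in auto)
      also have "\<dots> = ennreal ((1 / 2) powr (- real r / 2))"
        using nn_integral_gauss_exp[of "{..<r}" "- 1 / 4"] by simp
      finally show ?thesis by simp
    qed simp
    have "(\<integral>\<^sup>+N. indicator {\<rho> * d<..} (\<beta> N) \<partial>gauss ({..<r} \<times> M))
       \<le> (\<integral>\<^sup>+N. ennreal (exp (- \<rho> / 4)) * (\<Sum>c\<in>C. ennreal (e c / d) * ennreal (exp (x N c))) \<partial>gauss ({..<r} \<times> M))"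
      by (intro nn_integral_mono pw)
    also have "\<dots> = ennreal (exp (- \<rho> / 4)) * (\<Sum>c\<in>C. ennreal (e c / d) * (\<integral>\<^sup>+N. ennreal (exp (x N c)) \<partial>gauss ({..<r} \<times> M)))"
      by (simp add: nn_integral_cmult nn_integral_sum)
    also have "\<dots> = ennreal (exp (- \<rho> / 4) * (\<Sum>c\<in>C. e c / d * (1 / 2) powr (- real r / 2)))"
      unfolding mgf using dpos e0 by (simp add: ennreal_mult[symmetric] sum_nonneg)
    also have "(\<Sum>c\<in>C. e c / d * (1 / 2) powr (- real r / 2)) = (1 / 2) powr (- real r / 2)"
      using False by (simp add: sum_distrib_right[symmetric] sum_divide_distrib[symmetric] d)
    also have "exp (- \<rho> / 4) * (1 / 2) powr (- real r / 2) \<le> exp (- u\<^sup>2 / 2)"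
    proof -
      \<comment> \<open>The exponential moment is \<open>2 powr (r / 2)\<close>, at most
        \<open>exp (r0 / 2)\<close>. Since \<open>\<rho> / 4 = (r0 + u\<^sup>2) / 2\<close>, the
        product with \<open>exp (- \<rho> / 4)\<close> leaves
        \<open>exp (- u\<^sup>2 / 2)\<close>.\<close>
      have "(1 / 2 :: real) powr (- real r / 2) = exp (real r / 2 * ln 2)"
        by (simp add: powr_def ln_div)
      also have "\<dots> \<le> exp (real r0 / 2)"
      proof -
        have "ln 2 \<le> (1 :: real)" using ln_le_minus_one[of "2::real"] by simp
        then have "real r / 2 * ln 2 \<le> real r / 2 * 1" by (intro mult_left_mono) auto
        then show ?thesis using r by simp
      qed
      finally have "exp (- \<rho> / 4) * (1 / 2) powr (- real r / 2) \<le> exp (- \<rho> / 4) * exp (real r0 / 2)"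
        by (intro mult_left_mono) auto
      also have "\<dots> = exp (- u\<^sup>2 / 2)" unfolding exp_add[symmetric] by (simp add: \<rho>_def field_simps)
      finally show ?thesis .
    qed
    finally show ?thesis by (simp add: \<rho>_def \<beta>_def ennreal_leI)
  qed
qed

lemma measurable_dual:
  assumes "\<And>i. (\<lambda>x. h x i) \<in> borel_measurable M"
  shows "(\<lambda>x. dual S (\<lambda>j a. h x (a, j)) r k a) \<in> borel_measurable M"
  unfolding dual_def
  by (intro borel_measurable_times borel_measurable_inverse measurable_ip2 measurable_residual) (simp_all add: others_def assms)

text \<open>Jensen's inequality for the power \<open>a\<close>, weighted by the squared lengths of
  the coefficient vectors \<open>n c\<close>, reduces the energy to unit combinations of the dual
  basis, all with the same moment bound.\<close>

lemma dual_energy_moment: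
  fixes S :: "'a set" and n :: "'c \<Rightarrow> nat \<Rightarrow> real"
  assumes S: "finite S" and C: "finite C" and q: "(r - 1) + q \<le> card S" "real q = 2 * a + 1" "a \<ge> 1"
  defines "\<beta> \<equiv> \<Sum>c\<in>C. \<Sum>k<r. (n c k)\<^sup>2"
    and "w \<equiv> \<lambda>g c a. \<Sum>k<r. n c k * dual S (\<lambda>j a. g (a, j)) r k a"
  shows "(\<integral>\<^sup>+g. ennreal ((\<Sum>c\<in>C. sq_norm S (w g c)) powr a) \<partial>gauss (S \<times> {..<r}))
    \<le> ennreal (\<beta> powr a * (2 powr (1 - a) / Gamma a))"
proof -
  define \<kappa> where "\<kappa> = 2 powr (1 - a) / Gamma a"
  have \<kappa>: "\<kappa> \<ge> 0" using Gamma_real_pos[of a] q by (simp add: \<kappa>_def)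
  define b where "b = (\<lambda>c. \<Sum>k<r. (n c k)\<^sup>2)"
  have b0: "b c \<ge> 0" for c by (simp add: b_def sum_nonneg)
  have \<beta>: "\<beta> = (\<Sum>c\<in>C. b c)" by (simp add: \<beta>_def b_def)
  define z where "z = (\<lambda>g c a. \<Sum>k<r. n c k / sqrt (b c) * dual S (\<lambda>j a. g (a, j)) r k a)"
  define y where "y = (\<lambda>g c. sq_norm S (z g c))"
  have wz: "sq_norm S (w g c) = b c * y g c" for g c
  proof (cases "b c = 0")
    case True
    then have "n c k = 0" if "k < r" for k using that by (simp add: b_def sum_nonneg_eq_0_iff)
    then show ?thesis using True by (simp add: w_def ip_def)
  next
    case False
    have "w g c = (\<lambda>a. sqrt (b c) * z g c a)"
      unfolding w_def z_def sum_distrib_left using False by (intro ext sum.cong) auto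
    then have "sq_norm S (w g c) = sqrt (b c) * (sqrt (b c) * y g c)"
      by (simp only: ip_scale_left ip_scale_right y_def)
    then show ?thesis using b0 by (simp add: mult.assoc[symmetric])
  qed
  have ym [measurable]: "(\<lambda>g. y g c) \<in> borel_measurable (gauss (S \<times> {..<r}))" for c
    unfolding y_def z_def
    by (intro measurable_ip2 borel_measurable_sum borel_measurable_times borel_measurable_const measurable_dual measurable_gauss_component)
  have int: "ennreal (b c) * (\<integral>\<^sup>+g. ennreal (y g c powr a) \<partial>gauss (S \<times> {..<r})) \<le> ennreal (b c) * ennreal \<kappa>" for c
  proof (cases "b c = 0")
    case False
    then have r: "0 < r" by (auto simp: b_def intro!: Nat.gr0I)
    have "sq_norm {..<r} (\<lambda>k. n c k / sqrt (b c)) = (\<Sum>k<r. (n c k)\<^sup>2 / b c)"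
      unfolding ip_def using b0 by (intro sum.cong) (auto simp: power2_eq_square)
    also have "\<dots> = 1" using False by (simp add: sum_divide_distrib[symmetric] b_def)
    finally have "sq_norm {..<r} (\<lambda>k. n c k / sqrt (b c)) = 1" .
    from dual_moment[OF S r q this] show ?thesis
      unfolding y_def z_def \<kappa>_def by (intro mult_left_mono) auto
  qed simp
  have pw: "ennreal ((\<Sum>c\<in>C. sq_norm S (w g c)) powr a)
     \<le> ennreal (\<beta> powr (a - 1)) * (\<Sum>c\<in>C. ennreal (b c) * ennreal (y g c powr a))" for g
  proof -
    have "(\<Sum>c\<in>C. sq_norm S (w g c)) powr a \<le> \<beta> powr (a - 1) * (\<Sum>c\<in>C. b c * y g c powr a)"
      unfolding wz \<beta> by (rule weighted_power_mean) (use C b0 q in \<open>auto simp: y_def\<close>)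
    then have "ennreal ((\<Sum>c\<in>C. sq_norm S (w g c)) powr a) \<le> ennreal (\<beta> powr (a - 1) * (\<Sum>c\<in>C. b c * y g c powr a))"
      by (rule ennreal_leI)
    also have "\<dots> = ennreal (\<beta> powr (a - 1)) * (\<Sum>c\<in>C. ennreal (b c) * ennreal (y g c powr a))"
      using b0 by (simp add: ennreal_mult[symmetric] sum_nonneg)
    finally show ?thesis .
  qed
  have "(\<integral>\<^sup>+g. ennreal ((\<Sum>c\<in>C. sq_norm S (w g c)) powr a) \<partial>gauss (S \<times> {..<r}))
    \<le> (\<integral>\<^sup>+g. ennreal (\<beta> powr (a - 1)) * (\<Sum>c\<in>C. ennreal (b c) * ennreal (y g c powr a)) \<partial>gauss (S \<times> {..<r}))"
    by (intro nn_integral_mono pw)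
  also have "\<dots> = ennreal (\<beta> powr (a - 1)) * (\<Sum>c\<in>C. ennreal (b c) * (\<integral>\<^sup>+g. ennreal (y g c powr a) \<partial>gauss (S \<times> {..<r})))"
    by (simp add: nn_integral_cmult nn_integral_sum)
  also have "\<dots> \<le> ennreal (\<beta> powr (a - 1)) * (\<Sum>c\<in>C. ennreal (b c) * ennreal \<kappa>)"
    by (intro mult_left_mono sum_mono int) auto
  also have "\<dots> = ennreal (\<beta> powr (a - 1) * (\<beta> * \<kappa>))"
    using b0 \<kappa> by (simp add: ennreal_mult[symmetric] sum_nonneg \<beta> sum_distrib_right)
  also have "\<beta> powr (a - 1) * (\<beta> * \<kappa>) = \<beta> powr a * \<kappa>"
  proof (cases "\<beta> = 0")
    case False
    then have "\<beta> > 0" using b0 by (simp add: \<beta> less_le sum_nonneg)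
    then show ?thesis by (simp add: powr_diff)
  qed simp
  finally show ?thesis by (simp add: \<kappa>_def)
qed

lemma dual_cong:
  assumes "\<And>j a. j < r \<Longrightarrow> a \<in> S \<Longrightarrow> h j a = h' j a" "k < r" "a \<in> S"
  shows "dual S h r k a = dual S h' r k a"
proof -
  have 1: "col_residual S h r k a = col_residual S h' r k a" if "a \<in> S" for a
    using that assms by (intro residual_cong) (auto simp: others_def)
  then have "col_dist2 S h r k = col_dist2 S h' r k" by (intro ip_cong)
  then show ?thesis using 1 assms by (simp add: dual_def)
qed

text \<open>For fixed first \<open>r\<close> columns the columns in \<open>M\<close> are exchanged
  for \<open>N\<close>; only then is the order of integration reversed, so that Markov's inequality
  is applied to the first columns with \<open>N\<close> fixed. Draws \<open>N\<close> of energy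
  above \<open>\<rho> * d\<close> are charged to the energy tail. The attained rank \<open>r\<close>
  may lie below the nominal rank \<open>r0\<close>.\<close>

lemma gauss_deviation:
  fixes S :: "'a set" and D :: "nat \<Rightarrow> 'c \<Rightarrow> real" and M :: "nat set" and \<theta> u :: real
  assumes S: "finite S" and M: "finite M" "M \<inter> {..<r} = {}" and C: "finite C"
    and card: "card S = r0 + p" and r: "r \<le> r0" "1 \<le> r0" and p: "2 \<le> p" and \<theta>: "\<theta> > 0"
  defines "d \<equiv> \<Sum>c\<in>C. \<Sum>l\<in>M. (D l c)\<^sup>2" and "\<rho> \<equiv> 2 * (real r0 + u\<^sup>2)" and "a \<equiv> real p / 2"
  defines "h \<equiv> \<lambda>g. \<Sum>c\<in>C. \<Sum>k<r. (ip S (dual S (\<lambda>j a. g (a, j)) r k) (\<lambda>a. \<Sum>l\<in>M. g (a, l) * D l c))\<^sup>2"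
  shows "(\<integral>\<^sup>+g. indicator {\<theta> * d<..} (h g) \<partial>gauss (S \<times> ({..<r} \<union> M)))
    \<le> ennreal (exp (- u\<^sup>2 / 2)) + ennreal ((\<rho> / \<theta>) powr a * (2 powr (1 - a) / Gamma a))"
proof -
  define \<kappa> where "\<kappa> = 2 powr (1 - a) / Gamma a"
  have a: "a \<ge> 1" using p by (simp add: a_def)
  have \<kappa>: "\<kappa> \<ge> 0" using Gamma_real_pos[of a] a by (simp add: \<kappa>_def)
  have \<rho>: "\<rho> \<ge> 0" by (simp add: \<rho>_def)
  have d0: "d \<ge> 0" by (simp add: d_def sum_nonneg)
  define A where "A = S \<times> {..<r}"
  define B where "B = S \<times> M"
  define N' where "N' = {..<r} \<times> M"
  have AB: "S \<times> ({..<r} \<union> M) = A \<union> B" "A \<inter> B = {}" "finite A" "finite B" "finite N'"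
    using S M by (auto simp: A_def B_def N'_def)
  interpret P: pair_sigma_finite "gauss A" "gauss N'"
    by (intro pair_sigma_finite.intro sigma_finite_gauss)
  interpret N: prob_space "gauss N'" by (rule prob_space_gauss)
  define L where "L = (\<lambda>x :: 'a \<times> nat \<Rightarrow> real. dual S (\<lambda>j a. x (a, j)) r)"
  define n where "n = (\<lambda>N :: nat \<times> nat \<Rightarrow> real. \<lambda>c k. \<Sum>l\<in>M. N (k, l) * D l c)"
  define Y where "Y = (\<lambda>x N. \<Sum>c\<in>C. sq_norm S (\<lambda>a. \<Sum>k<r. n N c k * L x k a))"
  define \<beta> where "\<beta> = (\<lambda>N. \<Sum>c\<in>C. \<Sum>k<r. (n N c k)\<^sup>2)"
  have fst: "(\<lambda>p. fst p i) \<in> borel_measurable (gauss A \<Otimes>\<^sub>M gauss N')" for i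
    by (rule measurable_compose[OF measurable_fst measurable_gauss_component])
  have snd: "(\<lambda>p. snd p i) \<in> borel_measurable (gauss A \<Otimes>\<^sub>M gauss N')" for i
    by (rule measurable_compose[OF measurable_snd measurable_gauss_component])
  have "(\<lambda>p. Y (fst p) (snd p)) \<in> borel_measurable (gauss A \<Otimes>\<^sub>M gauss N')"
    unfolding Y_def n_def L_def
    by (intro borel_measurable_sum measurable_ip2 borel_measurable_times borel_measurable_const snd
        measurable_dual[where h = "\<lambda>p. fst p"] fst)
  then have Ym [measurable]: "(\<lambda>(x, N). Y x N) \<in> borel_measurable (gauss A \<Otimes>\<^sub>M gauss N')"
    by (simp add: case_prod_beta)
  have hm: "(\<lambda>g. h g) \<in> borel_measurable (gauss (A \<union> B))"
    unfolding h_def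
    by (intro borel_measurable_sum borel_measurable_power measurable_ip2 borel_measurable_times borel_measurable_const
        measurable_dual measurable_gauss_component)
  have \<beta>m [measurable]: "\<beta> \<in> borel_measurable (gauss N')"
    unfolding \<beta>_def n_def
    by (intro borel_measurable_sum borel_measurable_power borel_measurable_times borel_measurable_const measurable_gauss_component)
  let ?I = "\<lambda>y. indicator {\<theta> * d<..} y :: ennreal"
  have "(\<integral>\<^sup>+g. ?I (h g) \<partial>gauss (A \<union> B)) = (\<integral>\<^sup>+x. \<integral>\<^sup>+y. ?I (h (merge A B (x, y))) \<partial>gauss B \<partial>gauss A)"
    by (rule stdn_prod.product_nn_integral_fold) (use AB measurable_compose[OF hm, of ?I borel] in auto)
  also have "\<dots> = (\<integral>\<^sup>+x. \<integral>\<^sup>+N. ?I (Y x N) \<partial>gauss N' \<partial>gauss A)"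
  proof (rule nn_integral_cong)
    fix x
    have "h (merge A B (x, y)) = (\<Sum>c\<in>C. \<Sum>k<r. (ip S (L x k) (\<lambda>a. \<Sum>l\<in>M. y (a, l) * D l c))\<^sup>2)" for y
      unfolding h_def
    proof (intro sum.cong refl arg_cong[where f = "\<lambda>v. v\<^sup>2"] ip_cong)
      fix c k b assume k: "k \<in> {..<r}" and b: "b \<in> S"
      show "dual S (\<lambda>j a. merge A B (x, y) (a, j)) r k b = L x k b"
        unfolding L_def by (rule dual_cong) (use k b in \<open>auto simp: merge_def A_def\<close>)
    next
      fix c k b l assume "b \<in> S" "l \<in> M"
      then show "merge A B (x, y) (b, l) * D l c = y (b, l) * D l c"
        using M(2) by (auto simp: merge_def A_def B_def)
    qed
    then show "(\<integral>\<^sup>+y. ?I (h (merge A B (x, y))) \<partial>gauss B) = (\<integral>\<^sup>+N. ?I (Y x N) \<partial>gauss N')"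
      unfolding Y_def n_def B_def N'_def
      using nn_integral_gauss_polar[OF S _ M(1), where r = r and F = "?I" and C = C and L = "L x" and D = D] card r by simp
  qed
  also have "\<dots> = (\<integral>\<^sup>+N. \<integral>\<^sup>+x. ?I (Y x N) \<partial>gauss A \<partial>gauss N')"
    by (rule P.Fubini'[symmetric]) measurable
  also have "\<dots> \<le> (\<integral>\<^sup>+N. indicator {\<rho> * d<..} (\<beta> N) + ennreal ((\<rho> / \<theta>) powr a * \<kappa>) \<partial>gauss N')"
  proof (rule nn_integral_mono)
    fix N
    interpret A: prob_space "gauss A" by (rule prob_space_gauss)
    have Y0: "Y x N \<ge> 0" for x by (simp add: Y_def sum_nonneg)
    have b0: "\<beta> N \<ge> 0" by (simp add: \<beta>_def sum_nonneg)
    \<comment> \<open>For \<open>d = 0\<close> Markov's inequality would divide by zero; there the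
      energy bound forces \<open>\<beta> N = 0\<close> and hence \<open>Y x N = 0\<close>.\<close>
    consider "\<beta> N > \<rho> * d" | "\<beta> N \<le> \<rho> * d" "d = 0" | "\<beta> N \<le> \<rho> * d" "d > 0" using d0 by linarith
    then show "(\<integral>\<^sup>+x. ?I (Y x N) \<partial>gauss A) \<le> indicator {\<rho> * d<..} (\<beta> N) + ennreal ((\<rho> / \<theta>) powr a * \<kappa>)"
    proof cases
      case 1
      have "(\<integral>\<^sup>+x. ?I (Y x N) \<partial>gauss A) \<le> (\<integral>\<^sup>+x. 1 \<partial>gauss A)"
        by (intro nn_integral_mono) (simp add: indicator_def)
      also have "\<dots> = 1" by (simp add: A.emeasure_space_1)
      finally show ?thesis using 1 by (simp add: add_increasing2)
    next
      case 2
      then have "\<beta> N = 0" using b0 by simp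
      then have "\<forall>c\<in>C. (\<Sum>k<r. (n N c k)\<^sup>2) = 0"
        unfolding \<beta>_def using C by (subst (asm) sum_nonneg_eq_0_iff) (auto simp: sum_nonneg)
      then have "n N c k = 0" if "c \<in> C" "k < r" for c k using that by (simp add: sum_nonneg_eq_0_iff)
      then have "Y x N = 0" for x by (simp add: Y_def ip_def)
      then show ?thesis using 2 by simp
    next
      case 3
      then have td: "\<theta> * d > 0" using \<theta> by simp
      have pw: "?I (Y x N) \<le> ennreal ((1 / (\<theta> * d)) powr a) * ennreal (Y x N powr a)" for x
      proof (cases "Y x N > \<theta> * d")
        case True
        then have "1 \<le> (1 / (\<theta> * d) * Y x N)" using td by (simp add: field_simps)
        then have "1 \<le> (1 / (\<theta> * d) * Y x N) powr a" using a by (simp add: ge_one_powr_ge_zero)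
        also have "\<dots> = (1 / (\<theta> * d)) powr a * Y x N powr a" using td Y0 by (subst powr_mult) auto
        finally have "ennreal 1 \<le> ennreal ((1 / (\<theta> * d)) powr a * Y x N powr a)" by (rule ennreal_leI)
        then show ?thesis using True by (simp add: ennreal_mult)
      qed simp
      have Yx: "(\<lambda>x. Y x N) \<in> borel_measurable (gauss A)"
        unfolding Y_def n_def L_def
        by (intro borel_measurable_sum measurable_ip2 borel_measurable_times borel_measurable_const
            measurable_dual measurable_gauss_component)
      have "(\<integral>\<^sup>+x. ?I (Y x N) \<partial>gauss A) \<le> (\<integral>\<^sup>+x. ennreal ((1 / (\<theta> * d)) powr a) * ennreal (Y x N powr a) \<partial>gauss A)"
        by (intro nn_integral_mono pw)
      also have "\<dots> = ennreal ((1 / (\<theta> * d)) powr a) * (\<integral>\<^sup>+x. ennreal (Y x N powr a) \<partial>gauss A)"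
        by (intro nn_integral_cmult measurable_compose[OF Yx, of "\<lambda>y. ennreal (y powr a)" borel]) measurable
      also have "(\<integral>\<^sup>+x. ennreal (Y x N powr a) \<partial>gauss A) \<le> ennreal (\<beta> N powr a * \<kappa>)"
        unfolding Y_def \<beta>_def \<kappa>_def A_def L_def
        \<comment> \<open>The other \<open>r - 1\<close> columns leave codimension at least
          \<open>p + 1\<close>, as \<open>card S = r0 + p\<close> and \<open>r \<le> r0\<close>. For
          \<open>r = 0\<close> the subtraction is truncated, and \<open>1 \<le> r0\<close> supplies
          the missing dimension.\<close>
        by (rule dual_energy_moment[OF S C, of r "p + 1"]) (use card r p a in \<open>auto simp: a_def\<close>)
      also have "ennreal ((1 / (\<theta> * d)) powr a) * ennreal (\<beta> N powr a * \<kappa>) = ennreal ((1 / (\<theta> * d)) powr a * (\<beta> N powr a * \<kappa>))"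
        using \<kappa> by (simp add: ennreal_mult)
      also have "(1 / (\<theta> * d)) powr a * (\<beta> N powr a * \<kappa>) \<le> (\<rho> / \<theta>) powr a * \<kappa>"
      proof -
        have "(1 / (\<theta> * d)) powr a * \<beta> N powr a = (1 / (\<theta> * d) * \<beta> N) powr a"
          using td b0 by (subst powr_mult) auto
        also have "\<dots> \<le> (\<rho> / \<theta>) powr a"
        proof (rule powr_mono2)
          show "1 / (\<theta> * d) * \<beta> N \<le> \<rho> / \<theta>" using 3 \<theta> by (simp add: field_simps)
        qed (use a td b0 in auto)
        finally show ?thesis using \<kappa> by (simp add: mult.assoc[symmetric] mult_right_mono)
      qed
      finally show ?thesis
        by (simp add: add_increasing mult_left_mono ennreal_leI)
    qed
  qed
  also have "\<dots> = (\<integral>\<^sup>+N. indicator {\<rho> * d<..} (\<beta> N) \<partial>gauss N') + ennreal ((\<rho> / \<theta>) powr a * \<kappa>)"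
    by (subst nn_integral_add) (auto simp: N.emeasure_space_1)
  also have "(\<integral>\<^sup>+N. indicator {\<rho> * d<..} (\<beta> N) \<partial>gauss N') \<le> ennreal (exp (- u\<^sup>2 / 2))"
    unfolding \<beta>_def n_def \<rho>_def d_def N'_def by (rule gauss_energy_tail[OF M(1) C r(1)])
  finally show ?thesis unfolding AB(1) \<kappa>_def by (simp add: add_right_mono)
qed

section \<open>Numerical estimates for the constants\<close>

lemma Gamma_plus1_ge:
  assumes "x > (0::real)" shows "x powr x * exp (- x) \<le> Gamma (x + 1)"
proof -
  have G: "Gamma (x + 1) > 0" using assms by (intro Gamma_real_pos) simp
  have "ennreal (x powr x * exp (- x)) = ennreal (x powr x) * ennreal (exp (- x))" by (simp add: ennreal_mult)
  also have "ennreal (exp (- x)) = (\<integral>\<^sup>+t. ennreal (exp (- t)) * indicator {x..} t \<partial>lborel)"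
  proof -
    have "(\<integral>\<^sup>+t. ennreal (exp (- t)) * indicator {x..} t \<partial>lborel) = ennreal (0 - (- exp (- x)))"
    proof (rule nn_integral_FTC_atLeast)
      show "((\<lambda>t. - exp (- t)) has_real_derivative exp (- t)) (at t)" for t :: real
        by (auto intro!: derivative_eq_intros)
      show "((\<lambda>t. - exp (- t :: real)) \<longlongrightarrow> 0) at_top" by real_asymp
    qed auto
    then show ?thesis by simp
  qed
  also have "ennreal (x powr x) * \<dots> = (\<integral>\<^sup>+t. ennreal (x powr x) * (ennreal (exp (- t)) * indicator {x..} t) \<partial>lborel)"
    by (rule nn_integral_cmult[symmetric]) measurable
  \<comment> \<open>Only the part \<open>t \<ge> x\<close> of the Gamma integral is kept, where
    \<open>t powr x\<close> is at least \<open>x powr x\<close>.\<close>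
  also have "\<dots> \<le> (\<integral>\<^sup>+t. ennreal (indicator {0..} t * t powr (x + 1 - 1) / exp t) \<partial>lborel)"
  proof (rule nn_integral_mono)
    fix t :: real
    show "ennreal (x powr x) * (ennreal (exp (- t)) * indicator {x..} t) \<le> ennreal (indicator {0..} t * t powr (x + 1 - 1) / exp t)"
    proof (cases "x \<le> t")
      case True
      have "x powr x * exp (- t) \<le> t powr x * exp (- t)"
        using assms True by (intro mult_right_mono powr_mono2) auto
      then show ?thesis using True assms by (simp add: ennreal_mult[symmetric] exp_minus divide_inverse ennreal_leI)
    qed simp
  qed
  also have "\<dots> = ennreal (Gamma (x + 1))"
    by (rule Gamma_conv_nn_integral_real[symmetric]) (use assms in simp)
  finally show ?thesis using G by simp
qed

text \<open>The Stirling-type bound gives \<open>a powr a / Gamma a \<le> a * exp a\<close>, and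
  \<open>(2 * a + 1) powr a\<close> is at most \<open>2 powr a * a powr a * exp (1 / 2)\<close>.
  What remains is \<open>2 * a * exp (1 / 2) \<le> 5 * exp (a * (1 - ln 2))\<close>, linear against
  exponential growth, settled by \<open>y \<le> exp (y - 1)\<close>. The constant 5 is chosen for
  this comparison.\<close>

lemma Gamma_moment_bound:
  assumes "a > (0::real)" shows "2 * (2 * a + 1) powr a / Gamma a \<le> 5 * exp (2 * a)"
proof -
  have G: "Gamma (a + 1) = a * Gamma a" using assms by (intro Gamma_plus1) (auto simp: nonpos_Ints_def)
  have Gp: "Gamma a > 0" using assms by (rule Gamma_real_pos)
  have "a powr a \<le> a * Gamma a * exp a"
    using Gamma_plus1_ge[OF assms] unfolding G by (simp add: exp_minus field_simps)
  then have 1: "a powr a / Gamma a \<le> a * exp a" using Gp by (simp add: field_simps)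
  have "2 * a + 1 = 2 * a * (1 + 1 / (2 * a))" using assms by (simp add: distrib_left)
  then have "(2 * a + 1) powr a = (2 * a * (1 + 1 / (2 * a))) powr a" by simp
  also have "\<dots> = 2 powr a * a powr a * (1 + 1 / (2 * a)) powr a" using assms by (simp add: powr_mult)
  also have "(1 + 1 / (2 * a)) powr a \<le> exp (1 / (2 * a)) powr a"
    using assms exp_ge_add_one_self[of "1 / (2 * a)"] by (intro powr_mono2) auto
  also have "exp (1 / (2 * a)) powr a = exp (1 / 2)" using assms by (simp add: powr_def)
  finally have 2: "(2 * a + 1) powr a \<le> 2 powr a * a powr a * exp (1 / 2)" using assms by simp
  have "2 * (2 * a + 1) powr a / Gamma a \<le> 2 * (2 powr a * a powr a * exp (1 / 2)) / Gamma a"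
    using 2 Gp by (intro divide_right_mono mult_left_mono) auto
  also have "\<dots> = 2 * 2 powr a * exp (1 / 2) * (a powr a / Gamma a)" by simp
  also have "\<dots> \<le> 2 * 2 powr a * exp (1 / 2) * (a * exp a)" using 1 by (intro mult_left_mono) auto
  also have "\<dots> = 2 * a * exp (1 / 2) * exp (a * ln 2 + a)" by (simp add: powr_def exp_add)
  also have "\<dots> \<le> 5 * exp (a * (1 - ln 2)) * exp (a * ln 2 + a)"
  proof (rule mult_right_mono)
    have ln2: "ln 2 \<le> (7 / 10 :: real)" using ln2_le_25_over_36 by simp
    have e: "exp (1 / 2 :: real) \<ge> 3 / 2" using exp_ge_add_one_self[of "1 / 2 :: real"] by simp
    \<comment> \<open>With \<open>exp (1 / 2) \<ge> 3 / 2\<close> and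
      \<open>1 - ln 2 \<ge> 3 / 10\<close> the right side is at least \<open>9 / 4\<close>.\<close>
    have "2 \<le> 5 * (exp (1 / 2) * (1 - ln 2 :: real))"
      using mult_mono[OF e, of "3 / 10" "1 - ln 2"] ln2 by simp
    then have "2 * (a * exp (1 / 2)) \<le> 5 * (exp (1 / 2) * (1 - ln 2)) * (a * exp (1 / 2))"
      using assms by (intro mult_right_mono) auto
    also have "\<dots> = 5 * (exp (1 / 2) * exp (1 / 2)) * (a * (1 - ln 2))" by simp
    also have "\<dots> = 5 * exp 1 * (a * (1 - ln 2))" by (simp add: exp_add[symmetric])
    also have "\<dots> \<le> 5 * exp 1 * exp (a * (1 - ln 2) - 1)"
      using exp_ge_add_one_self[of "a * (1 - ln 2) - 1"] by (intro mult_left_mono) auto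
    also have "\<dots> = 5 * exp (a * (1 - ln 2))" by (simp add: exp_diff)
    finally show "2 * a * exp (1 / 2) \<le> 5 * exp (a * (1 - ln 2))" by simp
  qed simp
  also have "\<dots> = 5 * exp (2 * a)" by (simp add: exp_add[symmetric] algebra_simps)
  finally show ?thesis .
qed

text \<open>With \<open>k = exp 1 / sqrt (p + 1)\<close> the summands of \<open>K\<close> are at
  least \<open>t * k * sqrt r\<close> and \<open>t * u * k\<close>: the first because
  \<open>exp 2 \<le> 9 \<le> 12\<close>, the second because \<open>r \<ge> 1\<close>. Hence
  \<open>K\<^sup>2 \<ge> t\<^sup>2 * k\<^sup>2 * (r + u\<^sup>2)\<close>, the dependence on
  \<open>r\<close> and \<open>u\<close> cancels in the ratio, and its power \<open>p / 2\<close>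
  leads to the preceding estimate with \<open>a = p / 2\<close>.\<close>

lemma deviation_bound:
  fixes r p :: nat and u t :: real
  assumes r: "1 \<le> r" and p: "4 \<le> p" and u: "1 \<le> u" and t: "1 \<le> t"
  defines "K \<equiv> t * sqrt (12 * real r / real p) + u * t * exp 1 * sqrt (real (r + p)) / real (p + 1)"
  shows "(2 * (real r + u\<^sup>2) / K\<^sup>2) powr (real p / 2) * (2 powr (1 - real p / 2) / Gamma (real p / 2)) \<le> 5 * t powr (- real p)"
    and "K > 0"
proof -
  define a where "a = real p / 2"
  have a: "a > 0" "2 * a = real p" using p by (simp_all add: a_def)
  define k where "k = exp 1 / sqrt (real p + 1)"
  have k: "k > 0" by (simp add: k_def)
  have k2: "k\<^sup>2 = exp 2 / (real p + 1)"
    by (simp add: k_def power_divide power2_eq_square exp_add[symmetric])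
  have 1: "k * sqrt (real r) \<le> sqrt (12 * real r / real p)"
  proof -
    have "exp 2 \<le> (9 :: real)"
    proof -
      have "exp 1 * exp 1 \<le> 3 * (3 :: real)" by (intro mult_mono exp_le) auto
      then show ?thesis by (simp add: exp_add[symmetric])
    qed
    then have "k\<^sup>2 \<le> 12 / real p" unfolding k2 using p
      by (intro frac_le) auto
    then have "k \<le> sqrt (12 / real p)" by (rule real_le_rsqrt)
    then have "k * sqrt (real r) \<le> sqrt (12 / real p) * sqrt (real r)" by (intro mult_right_mono) auto
    then show ?thesis by (simp add: real_sqrt_mult[symmetric])
  qed
  have 2: "k \<le> exp 1 * sqrt (real (r + p)) / real (p + 1)"
  proof -
    have "sqrt (real p + 1) \<le> sqrt (real (r + p))" using r by simp
    then have "exp 1 * sqrt (real p + 1) / (real p + 1) \<le> exp 1 * sqrt (real (r + p)) / (real p + 1)"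
      by (intro divide_right_mono mult_left_mono) auto
    moreover have "exp 1 * sqrt (real p + 1) / (real p + 1) = k"
    proof -
      have "sqrt (real p + 1) * sqrt (real p + 1) = real p + 1" by simp
      then show ?thesis unfolding k_def by (simp add: field_simps)
    qed
    ultimately show ?thesis by (simp add: add.commute)
  qed
  have "t * (k * sqrt (real r)) + t * (u * k) \<le> K"
    unfolding K_def using 1 mult_left_mono[OF 2, of "u * t"] u t
    by (intro add_mono) (auto simp: mult_ac)
  then have K: "t * k * (sqrt (real r) + u) \<le> K" by (simp add: algebra_simps)
  show Kpos: "K > 0"
    by (rule less_le_trans[OF _ K]) (use t u k in \<open>auto intro!: mult_pos_pos add_nonneg_pos\<close>)
  have "(t * k * (sqrt (real r) + u))\<^sup>2 \<le> K\<^sup>2"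
    by (rule power_mono[OF K]) (use t u k in auto)
  moreover have "t\<^sup>2 * k\<^sup>2 * (real r + u\<^sup>2) \<le> (t * k * (sqrt (real r) + u))\<^sup>2"
    using u by (simp add: power_mult_distrib power2_sum mult_left_mono)
  ultimately have K2: "t\<^sup>2 * k\<^sup>2 * (real r + u\<^sup>2) \<le> K\<^sup>2" by linarith
  have ru: "real r + u\<^sup>2 > 0" using r by (simp add: add_pos_nonneg)
  have "2 * (real r + u\<^sup>2) / K\<^sup>2 \<le> 2 / (t\<^sup>2 * k\<^sup>2)"
    using K2 Kpos t k by (simp add: field_simps)
  also have "\<dots> = 2 * (2 * a + 1) * (exp (- 2) * (1 / t\<^sup>2))"
    using t unfolding k2 a(2) by (simp add: exp_minus field_simps)
  finally have "(2 * (real r + u\<^sup>2) / K\<^sup>2) powr a \<le> (2 * (2 * a + 1) * (exp (- 2) * (1 / t\<^sup>2))) powr a"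
    using ru a by (intro powr_mono2) auto
  also have "\<dots> = 2 powr a * (2 * a + 1) powr a * (exp (- 2 * a) * t powr (- (2 * a)))"
  proof -
    have "1 / t\<^sup>2 = t powr (- 2)" using t by (simp add: powr_minus_divide)
    then have "(1 / t\<^sup>2) powr a = t powr (- (2 * a))" by (simp add: powr_powr)
    moreover have "exp (- 2) powr a = exp (- 2 * a)" by (simp add: powr_def)
    ultimately show ?thesis using a(1) t by (simp only: powr_mult)
  qed
  finally have 3: "(2 * (real r + u\<^sup>2) / K\<^sup>2) powr a \<le> 2 powr a * (2 * a + 1) powr a * (exp (- 2 * a) * t powr (- (2 * a)))" .
  have G: "Gamma a > 0" using a by (intro Gamma_real_pos)
  have "(2 * (real r + u\<^sup>2) / K\<^sup>2) powr a * (2 powr (1 - a) / Gamma a)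
     \<le> 2 powr a * (2 * a + 1) powr a * (exp (- 2 * a) * t powr (- (2 * a))) * (2 powr (1 - a) / Gamma a)"
    by (rule mult_right_mono[OF 3]) (use G in simp)
  also have "\<dots> = (2 powr a * 2 powr (1 - a)) * ((2 * a + 1) powr a / Gamma a) * (exp (- 2 * a) * t powr (- (2 * a)))"
    by simp
  also have "2 powr a * 2 powr (1 - a) = (2 :: real)" by (simp add: powr_add[symmetric])
  also have "2 * ((2 * a + 1) powr a / Gamma a) * (exp (- 2 * a) * t powr (- (2 * a)))
     \<le> 5 * exp (2 * a) * (exp (- 2 * a) * t powr (- (2 * a)))"
    using Gamma_moment_bound[OF a(1)] by (intro mult_right_mono) auto
  also have "\<dots> = 5 * t powr (- (2 * a))" by (simp add: exp_minus)
  finally show "(2 * (real r + u\<^sup>2) / K\<^sup>2) powr (real p / 2) * (2 powr (1 - real p / 2) / Gamma (real p / 2)) \<le> 5 * t powr (- real p)"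
    unfolding a(2) by (simp add: a_def)
qed

section \<open>The error of one sketched projection\<close>

lemma nn_integral_gauss_reindex:
  assumes "finite A" "finite K" "inj_on \<iota> K" "\<iota> ` K \<subseteq> A" and f: "f \<in> borel_measurable (gauss K)"
  shows "(\<integral>\<^sup>+g. f (\<lambda>k\<in>K. g (\<iota> k)) \<partial>gauss A) = (\<integral>\<^sup>+y. f y \<partial>gauss K)"
proof -
  define e where "e = (\<lambda>k i. if i = \<iota> k then 1 else 0 :: real)"
  have ip: "ip A (e k) g = g (\<iota> k)" if "k \<in> K" for k g
    using ip_delta[OF assms(1), of "\<iota> k" g] that assms(4) by (auto simp: e_def)
  have "orthonormal A K e"
    using assms(3) by (auto simp: orthonormal_def ip) (auto simp: e_def inj_on_def)
  from nn_integral_gauss_orthonormal[OF assms(1,2) this f] show ?thesis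
    by (simp add: ip cong: restrict_cong)
qed

lemma orthonormal_sum_squares:
  fixes x :: "nat \<Rightarrow> real"
  assumes "finite I" "orthonormal I {..<m} v"
  shows "(\<Sum>i\<in>I. (\<Sum>k<m. v k i * x k)\<^sup>2) = (\<Sum>k<m. (x k)\<^sup>2)"
proof -
  have "(\<Sum>i\<in>I. (\<Sum>k<m. v k i * x k)\<^sup>2) = sq_norm I (\<lambda>i. \<Sum>k<m. x k * v k i)"
    by (simp add: ip_def power2_eq_square mult.commute)
  also have "\<dots> = (\<Sum>k<m. \<Sum>l<m. if l = k then x k * x l else 0)"
    unfolding ip_double_sum using orthonormalD[OF assms(2)] by (intro sum.cong) auto
  finally show ?thesis by (simp add: power2_eq_square)
qed

text \<open>Squared Frobenius distance of the matrix \<open>X\<close> from its projection onto the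
  row space of \<open>G X\<close>, where \<open>G\<close> is the sketching matrix with entries
  \<open>g (k, i)\<close>.\<close>

definition sketch_error2 :: "'a set \<Rightarrow> 'c set \<Rightarrow> nat \<Rightarrow> ('a \<Rightarrow> 'c \<Rightarrow> real) \<Rightarrow> (nat \<times> 'a \<Rightarrow> real) \<Rightarrow> real" where
  "sketch_error2 I C s X g = (\<Sum>i\<in>I. sq_norm C (residual C (\<lambda>k c. \<Sum>i\<in>I. g (k, i) * X i c) s (X i)))"

text \<open>Combining the sketched rows with the dual basis of the first \<open>q\<close> columns of the sketching
  matrix reproduces the first \<open>q\<close> rows up to an error coming from the remaining ones.\<close>
lemma sketch_error2_le:
  fixes Xt :: "nat \<Rightarrow> 'c \<Rightarrow> real" and gt :: "nat \<Rightarrow> nat \<Rightarrow> real"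
  assumes I: "finite I" and C: "finite C" and v: "orthonormal I {..<card I} v" and q: "q \<le> card I"
    and Xt: "\<And>k c. Xt k c = (\<Sum>i\<in>I. v k i * X i c)"
    and gt: "\<And>j a. gt j a = (\<Sum>i\<in>I. v j i * g (a, i))"
    and nd: "\<And>k. k < q \<Longrightarrow> col_dist2 {..<s} gt q k \<noteq> 0"
  shows "sketch_error2 I C s X g \<le> (\<Sum>c\<in>C. \<Sum>l\<in>{q..<card I}. (Xt l c)\<^sup>2)
    + (\<Sum>c\<in>C. \<Sum>k<q. (ip {..<s} (dual {..<s} gt q k) (\<lambda>a. \<Sum>l\<in>{q..<card I}. gt l a * Xt l c))\<^sup>2)"
proof -
  define m where "m = card I"
  define h where "h = (\<lambda>k c. \<Sum>i\<in>I. g (k :: nat, i) * X i c)"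
  define l where "l = dual {..<s} gt q"
  \<comment> \<open>Row \<open>k\<close> of the left inverse applied to the sketch: an element of
    its row space that approximates \<open>Xt k\<close>.\<close>
  define \<zeta> where "\<zeta> = (\<lambda>k c. \<Sum>a<s. l k a * h a c)"
  define w where "w = (\<lambda>k c. if k < q then Xt k c - \<zeta> k c else Xt k c)"
  have X: "X i c = (\<Sum>k<m. v k i * Xt k c)" if "i \<in> I" for i c
  proof -
    have "(\<Sum>k<m. v k i * Xt k c) = (\<Sum>i'\<in>I. (\<Sum>k<m. v k i * v k i') * X i' c)"
      unfolding Xt sum_distrib_left sum_distrib_right by (subst sum.swap) (simp add: mult.assoc)
    also have "\<dots> = (\<Sum>i'\<in>I. if i = i' then X i' c else 0)"
      using orthonormal_complete[OF I v that] by (intro sum.cong) (auto simp: m_def)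
    finally show ?thesis using that I by simp
  qed
  have h: "h a c = (\<Sum>j<m. gt j a * Xt j c)" for a c
  proof -
    have "h a c = (\<Sum>i\<in>I. \<Sum>j<m. g (a, i) * (v j i * Xt j c))"
      unfolding h_def by (intro sum.cong) (auto simp: X sum_distrib_left)
    also have "\<dots> = (\<Sum>j<m. gt j a * Xt j c)"
      unfolding gt sum_distrib_right by (subst sum.swap) (simp add: mult_ac)
    finally show ?thesis .
  qed
  \<comment> \<open>The left inverse turns the first \<open>q\<close> columns of the sketching
    matrix into the identity, so \<open>Xt k\<close> cancels and only the tail columns
    contribute.\<close>
  have wk: "w k c = - ip {..<s} (l k) (\<lambda>a. \<Sum>j\<in>{q..<m}. gt j a * Xt j c)" if k: "k < q" for k c
  proof -
    have split: "{..<m} = {..<q} \<union> {q..<m}" using q by (auto simp: m_def)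
    have "\<zeta> k c = ip {..<s} (l k) (\<lambda>a. \<Sum>j<m. Xt j c * gt j a)"
      by (simp add: \<zeta>_def ip_def h mult.commute)
    also have "\<dots> = (\<Sum>j<m. Xt j c * ip {..<s} (l k) (gt j))" by (rule ip_sum_right)
    also have "\<dots> = (\<Sum>j<q. Xt j c * ip {..<s} (l k) (gt j)) + (\<Sum>j\<in>{q..<m}. Xt j c * ip {..<s} (l k) (gt j))"
      unfolding split by (rule sum.union_disjoint) auto
    also have "(\<Sum>j<q. Xt j c * ip {..<s} (l k) (gt j)) = (\<Sum>j<q. if j = k then Xt j c else 0)"
      unfolding l_def using ip_dual[OF finite_lessThan k _ nd[OF k]] by (intro sum.cong) auto
    also have "\<dots> = Xt k c" using k by simp
    also have "(\<Sum>j\<in>{q..<m}. Xt j c * ip {..<s} (l k) (gt j)) = ip {..<s} (l k) (\<lambda>a. \<Sum>j\<in>{q..<m}. gt j a * Xt j c)"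
      unfolding ip_sum_right[symmetric] by (simp add: mult.commute)
    finally show ?thesis using k by (simp add: w_def)
  qed
  have "sketch_error2 I C s X g \<le> (\<Sum>i\<in>I. \<Sum>c\<in>C. (\<Sum>k<m. v k i * w k c)\<^sup>2)"
    unfolding sketch_error2_def h_def[symmetric]
  proof (rule sum_mono)
    fix i assume i: "i \<in> I"
    define z where "z = (\<lambda>c. \<Sum>k<q. v k i * \<zeta> k c)"
    have "in_span C h s (\<zeta> k)" for k
      unfolding \<zeta>_def by (rule in_span_sum) (auto intro: in_span_member)
    then have z: "in_span C h s z" unfolding z_def by (intro in_span_sum)
    have "sq_norm C (residual C h s (X i)) \<le> sq_norm C (\<lambda>c. X i c - z c)"
      by (rule residual_min[OF C z])
    also have "\<dots> = (\<Sum>c\<in>C. (\<Sum>k<m. v k i * w k c)\<^sup>2)"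
    proof -
      have "X i c - z c = (\<Sum>k<m. v k i * w k c)" for c
      proof -
        have "(\<Sum>k<m. v k i * w k c) = (\<Sum>k<m. v k i * Xt k c - (if k < q then v k i * \<zeta> k c else 0))"
          by (intro sum.cong) (auto simp: w_def right_diff_distrib)
        also have "\<dots> = X i c - (\<Sum>k<m. if k < q then v k i * \<zeta> k c else 0)"
          by (simp add: sum_subtractf X[OF i])
        also have "(\<Sum>k<m. if k < q then v k i * \<zeta> k c else 0) = z c"
          unfolding z_def using q by (intro sum.mono_neutral_cong_right) (auto simp: m_def)
        finally show ?thesis by simp
      qed
      then show ?thesis by (simp add: ip_def power2_eq_square)
    qed
    finally show "sq_norm C (residual C h s (X i)) \<le> (\<Sum>c\<in>C. (\<Sum>k<m. v k i * w k c)\<^sup>2)" .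
  qed
  also have "\<dots> = (\<Sum>c\<in>C. \<Sum>k<m. (w k c)\<^sup>2)"
    by (subst sum.swap) (simp add: orthonormal_sum_squares[OF I v[folded m_def]])
  also have "\<dots> = (\<Sum>c\<in>C. (\<Sum>k<q. (w k c)\<^sup>2) + (\<Sum>k\<in>{q..<m}. (w k c)\<^sup>2))"
  proof (rule sum.cong[OF refl])
    fix c
    have split: "{..<m} = {..<q} \<union> {q..<m}" using q by (auto simp: m_def)
    show "(\<Sum>k<m. (w k c)\<^sup>2) = (\<Sum>k<q. (w k c)\<^sup>2) + (\<Sum>k\<in>{q..<m}. (w k c)\<^sup>2)"
      unfolding split by (rule sum.union_disjoint) auto
  qed
  also have "\<dots> = (\<Sum>c\<in>C. \<Sum>k<q. (w k c)\<^sup>2) + (\<Sum>c\<in>C. \<Sum>k\<in>{q..<m}. (w k c)\<^sup>2)"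
    by (rule sum.distrib)
  also have "(\<Sum>c\<in>C. \<Sum>k<q. (w k c)\<^sup>2) = (\<Sum>c\<in>C. \<Sum>k<q. (ip {..<s} (l k) (\<lambda>a. \<Sum>l\<in>{q..<m}. gt l a * Xt l c))\<^sup>2)"
    by (intro sum.cong refl) (simp add: wk)
  also have "(\<Sum>c\<in>C. \<Sum>k\<in>{q..<m}. (w k c)\<^sup>2) = (\<Sum>c\<in>C. \<Sum>k\<in>{q..<m}. (Xt k c)\<^sup>2)"
    by (intro sum.cong refl) (simp add: w_def)
  finally show ?thesis by (simp add: m_def l_def add.commute)
qed

lemma measurable_sketch_error2:
  assumes "\<And>i c. (\<lambda>x. X x i c) \<in> borel_measurable M" "\<And>p. (\<lambda>x. g x p) \<in> borel_measurable M"
  shows "(\<lambda>x. sketch_error2 I C s (X x) (g x)) \<in> borel_measurable M"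
  unfolding sketch_error2_def
  by (intro borel_measurable_sum measurable_ip2 measurable_residual borel_measurable_times assms)

text \<open>\<open>Y\<close> matters only through its column space. In an orthonormal basis adapted
  to that space the tail rows annihilate \<open>Y\<close>, so the tail energy \<open>d\<close> of
  \<open>X\<close> is at most \<open>|X - Y|^2\<close>. Outside the bad event the error is at most
  \<open>(1 + K\<^sup>2) * d\<close>, which \<open>(1 + K)\<^sup>2\<close> dominates; this explains
  the summand 1 in the error factor.\<close>

theorem randomized_range_finder:
  fixes X Y :: "'a \<Rightarrow> 'c \<Rightarrow> real" and r p :: nat and u t :: real
  assumes I: "finite I" and C: "finite C" and r: "1 \<le> r" and p: "4 \<le> p" and u: "1 \<le> u" and t: "1 \<le> t"
    and Y: "\<And>i c. i \<in> I \<Longrightarrow> c \<in> C \<Longrightarrow> Y i c = (\<Sum>k<r. L k i * R k c)"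
  defines "\<eta> \<equiv> 1 + t * sqrt (12 * real r / real p) + u * t * exp 1 * sqrt (real (r + p)) / real (p + 1)"
  shows "(\<integral>\<^sup>+g. indicator {\<eta>\<^sup>2 * (\<Sum>i\<in>I. \<Sum>c\<in>C. (X i c - Y i c)\<^sup>2)<..} (sketch_error2 I C (r + p) X g) \<partial>gauss ({..<r + p} \<times> I))
    \<le> ennreal (5 * t powr (- real p) + 2 * exp (- u\<^sup>2 / 2))"
proof -
  define s where "s = r + p"
  define S where "S = {..<s}"
  define E where "E = (\<Sum>i\<in>I. \<Sum>c\<in>C. (X i c - Y i c)\<^sup>2)"
  obtain q e where q: "q \<le> r" and e: "orthonormal I {..<q} e" and sp: "\<forall>k<r. in_span I e q (L k)"
    using orthonormal_spanning[OF I] by blast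
  have qm: "q \<le> card I" by (rule orthonormal_card_le[OF I e])
  obtain v where v: "orthonormal I {..<card I} v" and ve: "\<forall>k<q. v k = e k"
    using orthonormal_extend[OF I e] by blast
  define m where "m = card I"
  define M where "M = {q..<m}"
  have split: "{..<m} = {..<q} \<union> M" using qm by (auto simp: m_def M_def)
  define D where "D = (\<lambda>k c. \<Sum>i\<in>I. v k i * X i c)"
  define d where "d = (\<Sum>c\<in>C. \<Sum>l\<in>M. (D l c)\<^sup>2)"
  have d0: "d \<ge> 0" by (simp add: d_def sum_nonneg)
  have vL: "(\<Sum>i\<in>I. v k i * L j i) = 0" if k: "k \<in> M" and j: "j < r" for k j
  proof -
    have "ip I (L j) (v k) = 0"
    proof (rule ip_in_span_eq_0[OF sp[rule_format, OF j]])
      fix k' assume k': "k' < q"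
      have "ip I (v k') (v k) = 0" using orthonormalD[OF v, of k' k] k k' qm by (simp add: M_def m_def)
      then show "ip I (e k') (v k) = 0" using ve k' by simp
    qed
    then show ?thesis by (simp add: ip_def mult.commute)
  qed
  have dE: "d \<le> E"
  proof -
    have "D k c = ip I (\<lambda>i. X i c - Y i c) (v k)" if "k \<in> M" "c \<in> C" for k c
    proof -
      have "(\<Sum>i\<in>I. v k i * Y i c) = (\<Sum>i\<in>I. \<Sum>j<r. v k i * (L j i * R j c))"
        using Y that by (intro sum.cong) (auto simp: sum_distrib_left)
      also have "\<dots> = (\<Sum>j<r. (\<Sum>i\<in>I. v k i * L j i) * R j c)"
        by (subst sum.swap) (simp add: sum_distrib_right mult.assoc)
      also have "\<dots> = 0" using vL that by simp
      finally show ?thesis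
        by (simp add: D_def ip_def right_diff_distrib sum_subtractf mult.commute[of _ "v k _"])
    qed
    then have "d = (\<Sum>c\<in>C. \<Sum>k\<in>M. (ip I (\<lambda>i. X i c - Y i c) (v k))\<^sup>2)" by (simp add: d_def)
    also have "\<dots> \<le> (\<Sum>c\<in>C. \<Sum>k<m. (ip I (\<lambda>i. X i c - Y i c) (v k))\<^sup>2)"
      by (intro sum_mono sum_mono2) (auto simp: M_def)
    also have "\<dots> \<le> (\<Sum>c\<in>C. sq_norm I (\<lambda>i. X i c - Y i c))"
      by (intro sum_mono bessel[OF I v[folded m_def]])
    also have "\<dots> = E" unfolding E_def by (subst sum.swap) (simp add: ip_def power2_eq_square)
    finally show ?thesis .
  qed
  define K where "K = t * sqrt (12 * real r / real p) + u * t * exp 1 * sqrt (real (r + p)) / real (p + 1)"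
  have \<eta>: "\<eta> = 1 + K" by (simp add: \<eta>_def K_def)
  note db = deviation_bound[OF r p u t, folded K_def]
  define h where "h = (\<lambda>y. \<Sum>c\<in>C. \<Sum>k<q. (ip S (dual S (\<lambda>j a. y (a, j)) q k) (\<lambda>a. \<Sum>l\<in>M. y (a, l) * D l c))\<^sup>2)"
  define deg where "deg = (\<lambda>y. \<Sum>k<q. indicator {0} (col_dist2 S (\<lambda>j a. y (a, j)) q k) :: ennreal)"
  have hm: "h \<in> borel_measurable (gauss A)" for A
    unfolding h_def
    by (intro borel_measurable_sum borel_measurable_power measurable_ip2 borel_measurable_times borel_measurable_const
        measurable_dual measurable_gauss_component)
  have degm: "deg \<in> borel_measurable (gauss A)" for A
    unfolding deg_def by (intro borel_measurable_sum measurable_compose[OF measurable_col_dist2]) auto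
  define f where "f = (\<lambda>y. indicator {K\<^sup>2 * d<..} (h y) + deg y)"
  have fm: "f \<in> borel_measurable (gauss A)" for A
    unfolding f_def by (intro borel_measurable_add degm measurable_compose[OF hm]) auto
  define V where "V = (\<lambda>(a :: nat, k) (a' :: nat, i). if a' = a then v k i else 0)"
  have ipV: "ip (S \<times> I) (V (a, k)) g = (\<Sum>i\<in>I. v k i * g (a, i))" if "a \<in> S" for a k g
  proof -
    have "ip (S \<times> I) (V (a, k)) g = (\<Sum>a'\<in>S. if a' = a then \<Sum>i\<in>I. v k i * g (a, i) else 0)"
      unfolding ip_times V_def by (intro sum.cong) auto
    then show ?thesis using that by (simp add: S_def)
  qed
  have V: "orthonormal (S \<times> I) (S \<times> {..<m}) V"
    unfolding orthonormal_def
  proof (clarify)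
    fix a k a' k' assume *: "a \<in> S" "k < m" "a' \<in> S" "k' < m"
    have "ip (S \<times> I) (V (a, k)) (V (a', k')) = (\<Sum>i\<in>I. v k i * (if a = a' then v k' i else 0))"
      using * by (simp add: ipV) (simp add: V_def)
    also have "\<dots> = (if (a, k) = (a', k') then 1 else 0)"
      using orthonormalD[OF v[folded m_def], of k k'] * by (cases "a = a'") (auto simp: ip_def)
    finally show "ip (S \<times> I) (V (a, k)) (V (a', k')) = (if (a, k) = (a', k') then 1 else 0)" .
  qed
  have "(\<integral>\<^sup>+g. indicator {\<eta>\<^sup>2 * E<..} (sketch_error2 I C s X g) \<partial>gauss (S \<times> I))
      \<le> (\<integral>\<^sup>+g. f (\<lambda>p\<in>S \<times> {..<m}. ip (S \<times> I) (V p) g) \<partial>gauss (S \<times> I))"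
  proof (rule nn_integral_mono)
    fix g
    let ?y = "\<lambda>p\<in>S \<times> {..<m}. ip (S \<times> I) (V p) g"
    define gt where "gt = (\<lambda>j a. \<Sum>i\<in>I. v j i * g (a, i))"
    have y: "?y (a, j) = gt j a" if "a \<in> S" "j < m" for a j using that by (simp add: ipV gt_def)
    show "indicator {\<eta>\<^sup>2 * E<..} (sketch_error2 I C s X g) \<le> f ?y"
    proof (cases "(\<forall>k<q. col_dist2 S (\<lambda>j a. ?y (a, j)) q k \<noteq> 0) \<and> h ?y \<le> K\<^sup>2 * d")
      case True
      have cd: "col_dist2 S gt q k = col_dist2 S (\<lambda>j a. ?y (a, j)) q k" if "k < q" for k
      proof -
        have "col_residual S gt q k a = col_residual S (\<lambda>j a. ?y (a, j)) q k a" if "a \<in> S" for a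
          using that \<open>k < q\<close> qm by (intro residual_cong) (auto simp: others_def ipV gt_def m_def)
        then show ?thesis by (intro ip_cong)
      qed
      have hy: "h ?y = (\<Sum>c\<in>C. \<Sum>k<q. (ip S (dual S gt q k) (\<lambda>a. \<Sum>l\<in>M. gt l a * D l c))\<^sup>2)"
        unfolding h_def
      proof (intro sum.cong refl arg_cong[where f = "\<lambda>v. v\<^sup>2"] ip_cong)
        fix c k a assume "k \<in> {..<q}" "a \<in> S"
        then show "dual S (\<lambda>j a. ?y (a, j)) q k a = dual S gt q k a"
          using qm by (intro dual_cong) (auto simp: ipV gt_def m_def)
      next
        fix c k a l assume "a \<in> S" "l \<in> M"
        then show "?y (a, l) * D l c = gt l a * D l c" by (simp add: ipV gt_def M_def)
      qed
      have "sketch_error2 I C s X g \<le> d + h ?y"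
        unfolding hy unfolding d_def M_def m_def S_def
        by (rule sketch_error2_le[OF I C v qm]) (use True cd in \<open>auto simp: D_def gt_def S_def\<close>)
      also have "\<dots> \<le> d + K\<^sup>2 * d" using True by simp
      also have "\<dots> = (1 + K\<^sup>2) * d" by (simp add: algebra_simps)
      also have "\<dots> \<le> \<eta>\<^sup>2 * E"
        using dE d0 db(2) by (intro mult_mono) (auto simp: \<eta> power2_sum)
      finally show ?thesis by simp
    next
      case False
      have "1 \<le> f ?y"
      proof (cases "h ?y \<le> K\<^sup>2 * d")
        case True
        with False obtain k where k: "k < q" "col_dist2 S (\<lambda>j a. ?y (a, j)) q k = 0" by blast
        have "(1 :: ennreal) = indicator {0} (col_dist2 S (\<lambda>j a. ?y (a, j)) q k)" by (simp only: k(2)) simp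
        also have "\<dots> \<le> deg ?y" unfolding deg_def by (rule member_le_sum) (use k in auto)
        finally show ?thesis by (simp add: f_def add_increasing)
      next
        case False
        then show ?thesis by (simp add: f_def)
      qed
      then show ?thesis by (rule order_trans[rotated]) (simp add: indicator_def)
    qed
  qed
  also have "\<dots> = (\<integral>\<^sup>+y. f y \<partial>gauss (S \<times> {..<m}))"
    by (rule nn_integral_gauss_orthonormal[OF _ _ V fm]) (use I in \<open>auto simp: S_def\<close>)
  also have "\<dots> = (\<integral>\<^sup>+y. indicator {K\<^sup>2 * d<..} (h y) \<partial>gauss (S \<times> {..<m})) + (\<integral>\<^sup>+y. deg y \<partial>gauss (S \<times> {..<m}))"
    unfolding f_def by (intro nn_integral_add degm measurable_compose[OF hm]) auto
  also have "(\<integral>\<^sup>+y. deg y \<partial>gauss (S \<times> {..<m})) = 0"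
  proof -
    \<comment> \<open>Only the first \<open>q\<close> columns occur in \<open>deg\<close>, so the
      integral passes to their marginal, where the distances are almost surely nonzero.\<close>
    have "deg y = deg (\<lambda>p\<in>S \<times> {..<q}. y p)" for y
    proof -
      have "col_dist2 S (\<lambda>j a. y (a, j)) q k = col_dist2 S (\<lambda>j a. (\<lambda>p\<in>S \<times> {..<q}. y p) (a, j)) q k" if "k < q" for k
      proof -
        have "col_residual S (\<lambda>j a. y (a, j)) q k a = col_residual S (\<lambda>j a. (\<lambda>p\<in>S \<times> {..<q}. y p) (a, j)) q k a" if "a \<in> S" for a
          using that \<open>k < q\<close> by (intro residual_cong) (auto simp: others_def)
        then show ?thesis by (intro ip_cong)
      qed
      then show ?thesis by (simp add: deg_def)
    qed
    then have "(\<integral>\<^sup>+y. deg y \<partial>gauss (S \<times> {..<m})) = (\<integral>\<^sup>+y. deg (\<lambda>p\<in>S \<times> {..<q}. y (id p)) \<partial>gauss (S \<times> {..<m}))"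
      by (intro nn_integral_cong) simp
    also have "\<dots> = (\<integral>\<^sup>+y. deg y \<partial>gauss (S \<times> {..<q}))"
      by (rule nn_integral_gauss_reindex[OF _ _ _ _ degm]) (use qm in \<open>auto simp: S_def m_def\<close>)
    also have "\<dots> = (\<integral>\<^sup>+y. 0 \<partial>gauss (S \<times> {..<q}))"
    proof (rule nn_integral_cong_AE)
      have "AE y in gauss (S \<times> {..<q}). \<forall>k<q. col_dist2 S (\<lambda>j a. y (a, j)) q k \<noteq> 0"
        by (rule AE_col_dist2_nonzero[of S q "p + 1" "real p / 2"]) (use q r p in \<open>auto simp: S_def s_def\<close>)
      then show "AE y in gauss (S \<times> {..<q}). deg y = 0" by eventually_elim (simp add: deg_def)
    qed
    finally show ?thesis by simp
  qed
  also have "(\<integral>\<^sup>+y. indicator {K\<^sup>2 * d<..} (h y) \<partial>gauss (S \<times> {..<m}))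
     \<le> ennreal (exp (- u\<^sup>2 / 2)) + ennreal ((2 * (real r + u\<^sup>2) / K\<^sup>2) powr (real p / 2) * (2 powr (1 - real p / 2) / Gamma (real p / 2)))"
    unfolding split h_def d_def
    by (rule gauss_deviation) (use I C q r p db(2) in \<open>auto simp: S_def s_def M_def\<close>)
  also have "\<dots> \<le> ennreal (exp (- u\<^sup>2 / 2)) + ennreal (5 * t powr (- real p))"
    using db(1) by (intro add_left_mono ennreal_leI)
  also have "\<dots> = ennreal (exp (- u\<^sup>2 / 2) + 5 * t powr (- real p))" by simp
  also have "\<dots> \<le> ennreal (5 * t powr (- real p) + 2 * exp (- u\<^sup>2 / 2))" by (intro ennreal_leI) simp
  finally show ?thesis by (simp add: E_def S_def s_def add_right_mono)
qed

section \<open>Tensor trains and cut ranks\<close>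

lemma idx_Nil [simp]: "idx [] = {[]}"
  by (auto simp: idx_def)

lemma idx_append: "idx (xs @ ys) = (\<lambda>(u, v). u @ v) ` (idx xs \<times> idx ys)"
proof (intro equalityI subsetI)
  fix w assume *: "w \<in> idx (xs @ ys)"
  have "take (length xs) w \<in> idx xs" using * by (auto simp: idx_def nth_append) (metis trans_less_add1)
  moreover have "drop (length xs) w \<in> idx ys"
  proof -
    have "w ! (length xs + k) < ys ! k" if "k < length ys" for k
      using * that by (auto simp: idx_def nth_append dest!: spec[of _ "length xs + k"])
    then show ?thesis using * by (auto simp: idx_def)
  qed
  ultimately show "w \<in> (\<lambda>(u, v). u @ v) ` (idx xs \<times> idx ys)"
    by (intro image_eqI[of _ _ "(take (length xs) w, drop (length xs) w)"]) auto
qed (auto simp: idx_def nth_append)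

lemma idx_append_iff [simp]:
  assumes "length u = length xs" shows "u @ v \<in> idx (xs @ ys) \<longleftrightarrow> u \<in> idx xs \<and> v \<in> idx ys"
  using assms by (auto simp: idx_append idx_def[of xs])

lemma idx_singleton: "idx [n] = (\<lambda>i. [i]) ` {..<n}"
  by (auto simp: idx_def length_Suc_conv)

lemma idx_Cons: "idx (n # ns) = (\<lambda>(i, v). i # v) ` ({..<n} \<times> idx ns)"
proof -
  have eq: "idx (n # ns) = (\<lambda>(u, v). u @ v) ` (idx [n] \<times> idx ns)" using idx_append[of "[n]" ns] by simp
  show ?thesis
  proof (intro equalityI subsetI)
    fix w assume "w \<in> idx (n # ns)"
    then obtain i v where "i < n" "v \<in> idx ns" "w = i # v" unfolding eq idx_singleton by auto
    then show "w \<in> (\<lambda>(i, v). i # v) ` ({..<n} \<times> idx ns)" by (intro image_eqI[of _ _ "(i, v)"]) auto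
  next
    fix w assume "w \<in> (\<lambda>(i, v). i # v) ` ({..<n} \<times> idx ns)"
    then obtain i v where "i < n" "v \<in> idx ns" "w = i # v" by auto
    then show "w \<in> idx (n # ns)" unfolding eq idx_singleton by (intro image_eqI[of _ _ "([i], v)"]) auto
  qed
qed

lemma idx_Cons_iff [simp]: "i # v \<in> idx (n # ns) \<longleftrightarrow> i < n \<and> v \<in> idx ns"
  by (auto simp: idx_Cons)

lemma idx_length: "u \<in> idx xs \<Longrightarrow> length u = length xs"
  by (simp add: idx_def)

lemma finite_idx [simp]: "finite (idx ns)"
  by (induction ns) (auto simp: idx_Cons)

lemma sum_idx_append: "(\<Sum>is\<in>idx (xs @ ys). f is) = (\<Sum>u\<in>idx xs. \<Sum>v\<in>idx ys. f (u @ v))"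
proof -
  have "inj_on (\<lambda>(u, v). u @ v) (idx xs \<times> idx ys)"
    by (auto simp: inj_on_def idx_def)
  then show ?thesis
    unfolding idx_append by (subst sum.reindex) (simp_all add: sum.cartesian_product case_prod_beta o_def)
qed

lemma sum_idx_singleton: "(\<Sum>is\<in>idx [n]. f is) = (\<Sum>i<n. f [i])"
  unfolding idx_singleton by (subst sum.reindex) (auto simp: inj_on_def)

lemma sum_idx_Cons: "(\<Sum>is\<in>idx (n # ns). f is) = (\<Sum>i<n. \<Sum>v\<in>idx ns. f (i # v))"
  using sum_idx_append[of f "[n]" ns] by (simp add: sum_idx_singleton)

lemma sum_idx_cut: "(\<Sum>is\<in>idx ns. f is) = (\<Sum>u\<in>idx (take j ns). \<Sum>v\<in>idx (drop j ns). f (u @ v))"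
  using sum_idx_append[of f "take j ns" "drop j ns"] by simp

lemma idx_cutE:
  assumes "is \<in> idx ns"
  obtains u v where "is = u @ v" "u \<in> idx (take j ns)" "v \<in> idx (drop j ns)"
proof -
  have "is \<in> idx (take j ns @ drop j ns)" using assms by simp
  then show ?thesis using that unfolding idx_append by auto
qed

lemma idx_cut_iff:
  assumes "u \<in> idx (take j ns)" shows "u @ v \<in> idx ns \<longleftrightarrow> v \<in> idx (drop j ns)"
  using idx_append_iff[of u "take j ns" v "drop j ns"] assms idx_length[OF assms] by simp

lemma drop_modes_segment:
  assumes "set ks = {m..<m + l}" "m + l \<le> length a"
  shows "drop_modes ks a = take m a @ drop (m + l) a"
proof -
  define n where "n = length a - (m + l)"
  have len: "length a = m + l + n" using assms by (simp add: n_def)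
  have "[0..<length a] = [0..<m] @ [m..<m + l] @ [m + l..<length a]"
    using upt_add_eq_append[of 0 m "l + n"] upt_add_eq_append[of m "m + l" n] by (simp add: len add.assoc)
  moreover have "concat (map (\<lambda>i. if i \<notin> set ks then [a ! i] else []) [0..<m]) = take m a"
  proof -
    have "map (\<lambda>i. if i \<notin> set ks then [a ! i] else []) [0..<m] = map (\<lambda>i. [a ! i]) [0..<m]"
      using assms by (intro map_cong) auto
    also have "concat \<dots> = map ((!) a) [0..<m]" by simp
    also have "\<dots> = take m a" using assms by (intro nth_equalityI) auto
    finally show ?thesis .
  qed
  moreover have "concat (map (\<lambda>i. if i \<notin> set ks then [a ! i] else []) [m..<m + l]) = []"
    using assms by auto
  moreover have "concat (map (\<lambda>i. if i \<notin> set ks then [a ! i] else []) [m + l..<length a]) = drop (m + l) a"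
  proof -
    have "map (\<lambda>i. if i \<notin> set ks then [a ! i] else []) [m + l..<length a] = map (\<lambda>i. [a ! i]) [m + l..<length a]"
      using assms by (intro map_cong) auto
    also have "concat \<dots> = map ((!) a) [m + l..<length a]" by simp
    also have "\<dots> = drop (m + l) a" using assms by (intro nth_equalityI) auto
    finally show ?thesis .
  qed
  ultimately show ?thesis unfolding drop_modes_def by (simp del: concat_eq_Nil_conv)
qed

text \<open>The pairs summed in \<open>contract\<close> are exactly
  \<open>(a1 @ c, b1 @ c @ b2)\<close> with a common block \<open>c\<close>. Every contraction of
  the algorithm has this shape: \<open>B1\<close> is empty for TT products and for the sketch, while
  for the compression with \<open>W\<close> it holds the new rank mode and \<open>B2\<close> is
  empty.\<close>

lemma contract_segment:
  assumes a1: "a1 \<in> idx A1" and b1: "b1 \<in> idx B1" and b2: "b2 \<in> idx B2"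
    and ks: "ks = [length A1..<length A1 + length w]" and ls: "ls = [length B1..<length B1 + length w]"
  shows "contract (A1 @ w) X (B1 @ w @ B2) Y ks ls (a1 @ b1 @ b2) = (\<Sum>c\<in>idx w. X (a1 @ c) * Y (b1 @ c @ b2))"
  unfolding contract_def
proof (rule sum.reindex_bij_witness[of _ "\<lambda>c. (a1 @ c, b1 @ c @ b2)" "\<lambda>(a, b). drop (length A1) a"])
  fix c assume c: "c \<in> idx w"
  have l: "length a1 = length A1" "length b1 = length B1" "length c = length w" using assms c idx_length by auto
  have "drop_modes ks (a1 @ c) = a1" "drop_modes ls (b1 @ c @ b2) = b1 @ b2"
    using l drop_modes_segment[of ks "length A1" "length w" "a1 @ c"]
      drop_modes_segment[of ls "length B1" "length w" "b1 @ c @ b2"] by (simp_all add: ks ls)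
  then show "(a1 @ c, b1 @ c @ b2) \<in> {(a, b). a \<in> idx (A1 @ w) \<and> b \<in> idx (B1 @ w @ B2) \<and>
      drop_modes ks a @ drop_modes ls b = a1 @ b1 @ b2 \<and> (\<forall>k<length ks. a ! (ks ! k) = b ! (ls ! k))}"
    using assms c l by (simp add: nth_append)
  show "(case (a1 @ c, b1 @ c @ b2) of (a, b) \<Rightarrow> drop (length A1) a) = c" using l by simp
next
  fix p assume "p \<in> {(a, b). a \<in> idx (A1 @ w) \<and> b \<in> idx (B1 @ w @ B2) \<and>
      drop_modes ks a @ drop_modes ls b = a1 @ b1 @ b2 \<and> (\<forall>k<length ks. a ! (ks ! k) = b ! (ls ! k))}"
  then obtain a b where p: "p = (a, b)" and a: "a \<in> idx (A1 @ w)" and b: "b \<in> idx (B1 @ w @ B2)"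
    and eq: "drop_modes ks a @ drop_modes ls b = a1 @ b1 @ b2"
    and shared: "\<forall>k<length ks. a ! (ks ! k) = b ! (ls ! k)" by auto
  obtain a' c where a': "a = a' @ c" "a' \<in> idx A1" "c \<in> idx w" using a unfolding idx_append by auto
  obtain b' c' b'' where b': "b = b' @ c' @ b''" "b' \<in> idx B1" "c' \<in> idx w" "b'' \<in> idx B2"
    using b unfolding idx_append by auto
  have l: "length a' = length A1" "length c = length w" "length b' = length B1" "length c' = length w"
    "length b'' = length B2" using a' b' idx_length by auto
  have "drop_modes ks a = a'" "drop_modes ls b = b' @ b''"
    using l drop_modes_segment[of ks "length A1" "length w" a]
      drop_modes_segment[of ls "length B1" "length w" b] by (simp_all add: ks ls a'(1) b'(1))
  then have "a' @ b' @ b'' = a1 @ b1 @ b2" using eq by simp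
  then have e: "a' = a1" "b' = b1" "b'' = b2" using l idx_length[OF a1] idx_length[OF b1] by auto
  have "c = c'"
  proof (rule nth_equalityI)
    fix k assume k: "k < length c"
    then have "a ! (ks ! k) = b ! (ls ! k)" using shared l by (simp add: ks)
    then show "c ! k = c' ! k" using k l unfolding a'(1) b'(1) ks ls by (simp add: nth_append)
  qed (simp add: l)
  then show "(case p of (a, b) \<Rightarrow> drop (length A1) a) \<in> idx w"
    and "(a1 @ (case p of (a, b) \<Rightarrow> drop (length A1) a), b1 @ (case p of (a, b) \<Rightarrow> drop (length A1) a) @ b2) = p"
    and "X (a1 @ (case p of (a, b) \<Rightarrow> drop (length A1) a)) * Y (b1 @ (case p of (a, b) \<Rightarrow> drop (length A1) a) @ b2) = (case p of (a, b) \<Rightarrow> X a * Y b)"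
    using a' b' l e p by auto
qed

section \<open>Evaluating tensor trains\<close>

lemma tcomp_eval:
  assumes "u \<in> idx us" "v \<in> idx vs"
  shows "snd (tcomp (us @ [m], F) (m # vs, G)) (u @ v) = (\<Sum>k<m. F (u @ [k]) * G (k # v))"
  using contract_segment[OF assms(1) _ assms(2), of "[]" "[]" "[length us]" "[m]" "[0]" F G]
  by (simp add: tcomp_def sum_idx_singleton)

lemma tcomp_dims: "fst (tcomp (us @ [m], F) (m # vs, G)) = us @ vs"
  by (simp add: tcomp_def contract_dims_def drop_modes_segment[where m = "length us" and l = 1]
      drop_modes_segment[where m = 0 and l = 1])

text \<open>Meant for \<open>i \<ge> 1\<close>, with \<open>\<rho> i\<close> the bond dimension to
  the right of mode \<open>i\<close>, counted from 0. Bonds are a function so that both a rank list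
  and the shifted ranks \<open>q\<close> of a run fit.\<close>

definition core_dims :: "nat list \<Rightarrow> (nat \<Rightarrow> nat) \<Rightarrow> nat \<Rightarrow> nat list" where
  "core_dims ns \<rho> i = (if i = length ns - 1 then [\<rho> (i - 1), ns ! i] else [\<rho> (i - 1), ns ! i, \<rho> i])"

text \<open>Entry of the product of the last \<open>m + 1\<close> cores at incoming bond index
  \<open>k\<close> and mode indices \<open>v\<close>. Such tails are the right factors of the
  unfoldings, and for a run they form the orthonormal systems onto which it projects.\<close>

primrec tt_tail :: "nat list \<Rightarrow> (nat \<Rightarrow> nat) \<Rightarrow> (nat \<Rightarrow> nat list \<Rightarrow> real) \<Rightarrow> nat \<Rightarrow> nat \<Rightarrow> nat list \<Rightarrow> real" where
  "tt_tail ns \<rho> V 0 k v = V (length ns - 1) (k # v)"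
| "tt_tail ns \<rho> V (Suc m) k v = (\<Sum>l<\<rho> (length ns - 2 - m). V (length ns - 2 - m) [k, hd v, l] * tt_tail ns \<rho> V m l (tl v))"

text \<open>The fold contracts from the left whereas \<open>tt_tail\<close> sums from the right.
  Leaving the accumulated factor \<open>F\<close> arbitrary lets the induction move one core across
  at a time, by exchanging two bond sums.\<close>

lemma foldl_tcomp_eval:
  assumes "1 \<le> i" "i + m + 1 = length ns" "u \<in> idx (take i ns)" "v \<in> idx (drop i ns)"
  shows "snd (foldl tcomp (take i ns @ [\<rho> (i - 1)], F) (map (\<lambda>i. (core_dims ns \<rho> i, V i)) [i..<length ns])) (u @ v)
    = (\<Sum>k<\<rho> (i - 1). F (u @ [k]) * tt_tail ns \<rho> V m k v)"
  using assms
proof (induction m arbitrary: i u v F)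
  case 0
  then have i: "i = length ns - 1" by simp
  have "[i..<length ns] = [i]" using 0 by (simp add: upt_rec)
  moreover have "drop i ns = [ns ! i]" using 0 by (metis Cons_nth_drop_Suc Suc_eq_plus1 add.right_neutral drop_all le_refl less_add_one)
  ultimately show ?case using 0 i
    tcomp_eval[of u "take i ns" v "[ns ! i]" "\<rho> (i - 1)" F "V i"] by (simp add: core_dims_def)
next
  case (Suc m)
  have il: "i < length ns" "i \<noteq> length ns - 1" using Suc.prems by auto
  have dr: "drop i ns = ns ! i # drop (Suc i) ns" using il by (simp add: Cons_nth_drop_Suc)
  obtain a v' where v: "v = a # v'" "a < ns ! i" "v' \<in> idx (drop (Suc i) ns)"
    using Suc.prems(4) unfolding dr by (auto simp: idx_Cons)
  define F' where "F' = snd (tcomp (take i ns @ [\<rho> (i - 1)], F) ([\<rho> (i - 1), ns ! i, \<rho> i], V i))"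
  have tk: "take (Suc i) ns = take i ns @ [ns ! i]" using il by (simp add: take_Suc_conv_app_nth)
  have "tcomp (take i ns @ [\<rho> (i - 1)], F) ([\<rho> (i - 1), ns ! i, \<rho> i], V i) = (take (Suc i) ns @ [\<rho> (Suc i - 1)], F')"
    by (rule prod_eqI) (simp_all add: F'_def tcomp_dims tk)
  moreover have "[i..<length ns] = i # [Suc i..<length ns]" using il by (simp add: upt_rec)
  ultimately have "snd (foldl tcomp (take i ns @ [\<rho> (i - 1)], F) (map (\<lambda>i. (core_dims ns \<rho> i, V i)) [i..<length ns])) (u @ v)
    = snd (foldl tcomp (take (Suc i) ns @ [\<rho> (Suc i - 1)], F') (map (\<lambda>i. (core_dims ns \<rho> i, V i)) [Suc i..<length ns])) ((u @ [a]) @ v')"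
    using il v by (simp add: core_dims_def)
  also have "\<dots> = (\<Sum>l<\<rho> i. F' ((u @ [a]) @ [l]) * tt_tail ns \<rho> V m l v')"
  proof -
    have "u @ [a] \<in> idx (take (Suc i) ns)"
      using Suc.prems(3) v idx_length[OF Suc.prems(3)] unfolding tk by simp
    from Suc.IH[OF _ _ this v(3), of F'] Suc.prems show ?thesis by simp
  qed
  also have "\<dots> = (\<Sum>l<\<rho> i. (\<Sum>k<\<rho> (i - 1). F (u @ [k]) * V i [k, a, l]) * tt_tail ns \<rho> V m l v')"
  proof (intro sum.cong refl arg_cong2[where f = times])
    fix l assume "l \<in> {..<\<rho> i}"
    then have "[a, l] \<in> idx [ns ! i, \<rho> i]" using v by simp
    from tcomp_eval[OF Suc.prems(3) this, of "\<rho> (i - 1)" F "V i"]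
    show "F' ((u @ [a]) @ [l]) = (\<Sum>k<\<rho> (i - 1). F (u @ [k]) * V i [k, a, l])" by (simp add: F'_def)
  qed
  also have "\<dots> = (\<Sum>k<\<rho> (i - 1). F (u @ [k]) * tt_tail ns \<rho> V (Suc m) k v)"
  proof -
    have "length ns - 2 - m = i" using Suc.prems by simp
    then show ?thesis using v
      by (simp add: sum_distrib_left sum_distrib_right mult.assoc sum.swap[of _ "{..<\<rho> i}"])
  qed
  finally show ?case .
qed

lemma tt_prod_eval:
  assumes "2 \<le> length ns" "u \<in> idx (take 1 ns)" "v \<in> idx (drop 1 ns)"
  shows "snd (tt_prod ((take 1 ns @ [\<rho> 0], F) # map (\<lambda>i. (core_dims ns \<rho> i, V i)) [1..<length ns])) (u @ v)
    = (\<Sum>k<\<rho> 0. F (u @ [k]) * tt_tail ns \<rho> V (length ns - 2) k v)"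
  using foldl_tcomp_eval[of 1 "length ns - 2" ns u v \<rho> F V] assms by (simp add: tt_prod_def)

section \<open>Cut ranks and TT-ranks\<close>

definition cut_rank_le :: "nat list \<Rightarrow> (nat list \<Rightarrow> real) \<Rightarrow> nat \<Rightarrow> nat \<Rightarrow> bool" where
  "cut_rank_le ns y i n \<longleftrightarrow> (\<exists>L R. \<forall>u\<in>idx (take i ns). \<forall>v\<in>idx (drop i ns). y (u @ v) = (\<Sum>k<n. L k u * R k v))"

lemma cut_rank_le_mono:
  assumes "cut_rank_le ns y i m" "m \<le> n" shows "cut_rank_le ns y i n"
proof -
  obtain L R where LR: "\<forall>u\<in>idx (take i ns). \<forall>v\<in>idx (drop i ns). y (u @ v) = (\<Sum>k<m. L k u * R k v)"
    using assms(1) by (auto simp: cut_rank_le_def)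
  have "(\<Sum>k<n. (if k < m then L k u else 0) * R k v) = (\<Sum>k<m. L k u * R k v)" for u v
    by (rule sum.mono_neutral_cong_right) (use assms(2) in auto)
  then show ?thesis unfolding cut_rank_le_def using LR
    by (intro exI[of _ "\<lambda>k u. if k < m then L k u else 0"] exI[of _ R]) simp
qed

lemma ex_cut_rank_le: "\<exists>n. cut_rank_le ns y i n"
proof -
  let ?I = "idx (take i ns)"
  obtain h where h: "bij_betw h {0..<card ?I} ?I" using ex_bij_betw_nat_finite[OF finite_idx] by blast
  have "y (u @ v) = (\<Sum>k<card ?I. (if h k = u then 1 else 0) * y (h k @ v))" if "u \<in> ?I" for u v
  proof -
    have "(\<Sum>k\<in>{0..<card ?I}. (if h k = u then 1 else 0) * y (h k @ v)) = (\<Sum>w\<in>?I. (if w = u then 1 else 0) * y (w @ v))"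
      by (rule sum.reindex_bij_betw[OF h])
    also have "\<dots> = (\<Sum>w\<in>?I. if w = u then y (w @ v) else 0)" by (rule sum.cong) auto
    also have "\<dots> = y (u @ v)" using that by simp
    finally show ?thesis by (simp add: atLeast0LessThan)
  qed
  then show ?thesis unfolding cut_rank_le_def
    by (intro exI[of _ "card ?I"] exI[of _ "\<lambda>k u. if h k = u then 1 else 0"] exI[of _ "\<lambda>k v. y (h k @ v)"]) simp
qed

definition cut_rank :: "nat list \<Rightarrow> (nat list \<Rightarrow> real) \<Rightarrow> nat \<Rightarrow> nat" where
  "cut_rank ns y i = (LEAST n. cut_rank_le ns y i n)"

lemma cut_rank_le_cut_rank: "cut_rank_le ns y i (cut_rank ns y i)"
  unfolding cut_rank_def by (rule LeastI_ex[OF ex_cut_rank_le])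

lemma cut_rank_least: "cut_rank_le ns y i n \<Longrightarrow> cut_rank ns y i \<le> n"
  unfolding cut_rank_def by (rule Least_le)

text \<open>Projecting the right factors onto the row span keeps a factorisation valid and of the same size.\<close>
lemma cut_rank_le_row_factors:
  assumes "cut_rank_le ns y i n"
  shows "\<exists>L R c. (\<forall>u\<in>idx (take i ns). \<forall>v\<in>idx (drop i ns). y (u @ v) = (\<Sum>k<n. L k u * R k v))
    \<and> (\<forall>k. \<forall>v\<in>idx (drop i ns). R k v = (\<Sum>u\<in>idx (take i ns). c k u * y (u @ v)))"
proof -
  let ?I = "idx (take i ns)" and ?C = "idx (drop i ns)"
  obtain L R where LR: "\<forall>u\<in>?I. \<forall>v\<in>?C. y (u @ v) = (\<Sum>k<n. L k u * R k v)"
    using assms by (auto simp: cut_rank_le_def)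
  obtain h where h: "bij_betw h {0..<card ?I} ?I" using ex_bij_betw_nat_finite[OF finite_idx] by blast
  define rows where "rows = (\<lambda>k v. y (h k @ v))"
  define N where "N = card ?I"
  define R' where "R' = (\<lambda>k v. R k v - residual ?C rows N (R k) v)"
  have row: "in_span ?C rows N (\<lambda>v. y (u @ v))" if "u \<in> ?I" for u
  proof -
    have "u \<in> h ` {0..<N}" using h that by (simp add: bij_betw_def N_def)
    then obtain k where "k < N" "h k = u" by auto
    then show ?thesis using in_span_member[of k N ?C rows] by (simp add: rows_def)
  qed
  have "y (u @ v) = (\<Sum>k<n. L k u * R' k v)" if u: "u \<in> ?I" and v: "v \<in> ?C" for u v
  proof -
    define w where "w = (\<lambda>v. \<Sum>k<n. L k u * residual ?C rows N (R k) v)"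
    have weq: "w v = y (u @ v) - (\<Sum>k<n. L k u * R' k v)" if "v \<in> ?C" for v
      using LR u that by (simp add: w_def R'_def right_diff_distrib sum_subtractf)
    have "in_span ?C rows N (\<lambda>v. \<Sum>k<n. L k u * R' k v)"
      unfolding R'_def by (intro in_span_sum residual_span)
    then have "in_span ?C rows N w"
      using in_span_diff[OF row[OF u]] in_span_cong[of ?C w, OF weq] by blast
    moreover have "ip ?C (rows k) w = 0" if "k < N" for k
      unfolding w_def ip_sum_right using residual_orth[OF finite_idx that]
      by (simp add: ip_commute[of _ "rows k"])
    ultimately have "sq_norm ?C w = 0" by (rule ip_in_span_eq_0)
    then have "w v = 0" using v by (simp add: ip_self_eq_0)
    then show ?thesis using weq[OF v] by simp
  qed
  moreover have "\<exists>c. \<forall>v\<in>?C. R' k v = (\<Sum>u\<in>?I. c u * y (u @ v))" for k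
  proof -
    obtain d where d: "\<forall>v\<in>?C. R' k v = (\<Sum>l<N. d l * rows l v)"
      using residual_span[of ?C rows N "R k"] unfolding in_span_def R'_def by blast
    define c where "c = (\<lambda>u. d (inv_into {0..<card ?I} h u))"
    have "(\<Sum>u\<in>?I. c u * y (u @ v)) = (\<Sum>l\<in>{0..<card ?I}. c (h l) * y (h l @ v))" for v
      by (rule sum.reindex_bij_betw[OF h, symmetric])
    also have "\<dots> v = (\<Sum>l<N. d l * rows l v)" for v
      unfolding N_def atLeast0LessThan[symmetric] using h
      by (intro sum.cong) (auto simp: c_def rows_def bij_betw_def inv_into_f_f)
    finally show ?thesis using d by (intro exI[of _ c]) simp
  qed
  then obtain c where "\<forall>k. \<forall>v\<in>?C. R' k v = (\<Sum>u\<in>?I. c k u * y (u @ v))" by metis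
  ultimately show ?thesis by blast
qed

lemma tt_cores_eq:
  assumes "2 \<le> length ns"
  shows "map (\<lambda>i. (tt_core_dims ns rs i, V i)) [0..<length ns]
    = (take 1 ns @ [rs ! 0], V 0) # map (\<lambda>i. (core_dims ns ((!) rs) i, V i)) [1..<length ns]"
proof -
  have "0 < length ns" using assms by linarith
  then have "[0..<length ns] = 0 # [1..<length ns]" by (simp add: upt_conv_Cons)
  moreover have "ns \<noteq> []" using assms by (metis list.size(3) not_numeral_le_zero)
  moreover from this have "take 1 ns = [ns ! 0]" by (cases ns) auto
  ultimately show ?thesis by (simp add: tt_core_dims_def core_dims_def)
qed

lemma tt_representable_eval:
  assumes "2 \<le> length ns"
  shows "tt_representable ns y rs \<longleftrightarrow> length rs = length ns - 1 \<and>
    (\<exists>V. \<forall>u\<in>idx (take 1 ns). \<forall>v\<in>idx (drop 1 ns).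
       y (u @ v) = (\<Sum>k<rs ! 0. V 0 (u @ [k]) * tt_tail ns ((!) rs) V (length ns - 2) k v))"
proof -
  have "(\<forall>w\<in>idx ns. y w = snd (tt_prod (map (\<lambda>i. (tt_core_dims ns rs i, V i)) [0..<length ns])) w) \<longleftrightarrow>
    (\<forall>u\<in>idx (take 1 ns). \<forall>v\<in>idx (drop 1 ns).
       y (u @ v) = (\<Sum>k<rs ! 0. V 0 (u @ [k]) * tt_tail ns ((!) rs) V (length ns - 2) k v))" (is "?l \<longleftrightarrow> ?r") for V
  proof -
    have e: "snd (tt_prod (map (\<lambda>i. (tt_core_dims ns rs i, V i)) [0..<length ns])) (u @ v)
      = (\<Sum>k<rs ! 0. V 0 (u @ [k]) * tt_tail ns ((!) rs) V (length ns - 2) k v)"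
      if "u \<in> idx (take 1 ns)" "v \<in> idx (drop 1 ns)" for u v
      unfolding tt_cores_eq[OF assms] by (rule tt_prod_eval[OF assms that])
    show ?thesis
    proof
      assume ?l
      then show ?r by (simp add: e idx_cut_iff)
    next
      assume r: ?r
      show ?l
      proof
        fix w assume "w \<in> idx ns"
        then obtain u v where "w = u @ v" "u \<in> idx (take 1 ns)" "v \<in> idx (drop 1 ns)" by (rule idx_cutE)
        then show "y w = snd (tt_prod (map (\<lambda>i. (tt_core_dims ns rs i, V i)) [0..<length ns])) w"
          using r e by simp
      qed
    qed
  qed
  then show ?thesis by (simp add: tt_representable_def)
qed

lemma idx_take_SucE:
  assumes "i < length ns" "u \<in> idx (take (Suc i) ns)"
  obtains u' a where "u = u' @ [a]" "u' \<in> idx (take i ns)" "a < ns ! i"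
proof -
  have "u \<in> idx (take i ns @ [ns ! i])" using assms by (simp add: take_Suc_conv_app_nth)
  then show ?thesis using that unfolding idx_append idx_singleton by auto
qed

lemma idx_take_SucI:
  assumes "i < length ns" "u \<in> idx (take i ns)" "a < ns ! i" shows "u @ [a] \<in> idx (take (Suc i) ns)"
  using assms idx_length[OF assms(2)] by (simp add: take_Suc_conv_app_nth)

text \<open>Cutting a train at one bond leaves as many summands as that bond is wide, with tails as
  right factors; the induction absorbs the cores one after another into the left factors.\<close>

lemma tt_representable_cut_rank_le:
  assumes ns: "2 \<le> length ns" and rep: "tt_representable ns y rs" and i: "1 \<le> i" "i < length ns"
  shows "cut_rank_le ns y i (rs ! (i - 1))"
proof -
  obtain V where V: "\<forall>u\<in>idx (take 1 ns). \<forall>v\<in>idx (drop 1 ns).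
       y (u @ v) = (\<Sum>k<rs ! 0. V 0 (u @ [k]) * tt_tail ns ((!) rs) V (length ns - 2) k v)"
    using rep tt_representable_eval[OF ns] by auto
  have "\<exists>L. \<forall>u\<in>idx (take i ns). \<forall>v\<in>idx (drop i ns).
      y (u @ v) = (\<Sum>k<rs ! (i - 1). L k u * tt_tail ns ((!) rs) V (length ns - 1 - i) k v)"
    using i
  proof (induction i rule: nat_induct_at_least)
    case base
    then show ?case using V by (intro exI[of _ "\<lambda>k u. V 0 (u @ [k])"]) (simp add: numeral_2_eq_2)
  next
    case (Suc i)
    then obtain L where L: "\<forall>u\<in>idx (take i ns). \<forall>v\<in>idx (drop i ns).
      y (u @ v) = (\<Sum>k<rs ! (i - 1). L k u * tt_tail ns ((!) rs) V (length ns - 1 - i) k v)" by auto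
    define m where "m = length ns - 1 - Suc i"
    have m: "length ns - 1 - i = Suc m" "length ns - 2 - m = i" using Suc.prems Suc.hyps by (auto simp: m_def)
    define L' where "L' = (\<lambda>l u. \<Sum>k<rs ! (i - 1). L k (butlast u) * V i [k, last u, l])"
    have dr: "drop i ns = ns ! i # drop (Suc i) ns" using Suc.prems by (simp add: Cons_nth_drop_Suc)
    show ?case
    proof (intro exI[of _ L'] ballI)
      fix u v assume u: "u \<in> idx (take (Suc i) ns)" and v: "v \<in> idx (drop (Suc i) ns)"
      obtain u' a where u': "u = u' @ [a]" "u' \<in> idx (take i ns)" "a < ns ! i"
        using idx_take_SucE[OF _ u] Suc.prems by auto
      have "y (u @ v) = y (u' @ a # v)" using u' by simp
      also have "\<dots> = (\<Sum>k<rs ! (i - 1). L k u' * tt_tail ns ((!) rs) V (Suc m) k (a # v))"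
        using L u' v unfolding m(1) dr by simp
      also have "\<dots> = (\<Sum>l<rs ! i. (\<Sum>k<rs ! (i - 1). L k u' * V i [k, a, l]) * tt_tail ns ((!) rs) V m l v)"
        by (simp add: m(2)[simplified] sum_distrib_left sum_distrib_right mult.assoc sum.swap[of _ "{..<rs ! i}"])
      finally show "y (u @ v) = (\<Sum>k<rs ! (Suc i - 1). L' k u * tt_tail ns ((!) rs) V (length ns - 1 - Suc i) k v)"
        by (simp add: L'_def u' m_def)
    qed
  qed
  then obtain L where "\<forall>u\<in>idx (take i ns). \<forall>v\<in>idx (drop i ns).
      y (u @ v) = (\<Sum>k<rs ! (i - 1). L k u * tt_tail ns ((!) rs) V (length ns - 1 - i) k v)" ..
  then show ?thesis unfolding cut_rank_le_def by blast
qed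

text \<open>Minimal factorisations at different cuts are a priori unrelated. They fit together
  because the right factors \<open>R i\<close> are combinations of rows of \<open>y\<close>:
  expanding those rows at the next cut expresses \<open>R i\<close> through
  \<open>R (Suc i)\<close>, and the coefficients form core \<open>i\<close>. So one train attains
  all cut ranks at once.\<close>

lemma tt_representable_cut_ranks:
  assumes ns: "2 \<le> length ns"
  shows "tt_representable ns y (map (cut_rank ns y) [1..<length ns])"
proof -
  define \<rho> where "\<rho> = (\<lambda>i. cut_rank ns y (Suc i))"
  define rs where "rs = map (cut_rank ns y) [1..<length ns]"
  have rs: "length rs = length ns - 1" "\<And>i. i < length ns - 1 \<Longrightarrow> rs ! i = \<rho> i"
    by (simp_all add: rs_def \<rho>_def)
  define P where "P = (\<lambda>i L R c. (\<forall>u\<in>idx (take i ns). \<forall>v\<in>idx (drop i ns). y (u @ v) = (\<Sum>k<cut_rank ns y i. L k u * R k v))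
    \<and> (\<forall>k. \<forall>v\<in>idx (drop i ns). R k v = (\<Sum>u\<in>idx (take i ns). c k u * y (u @ v))))"
  have "\<exists>L R c. P i L R c" for i
    unfolding P_def by (rule cut_rank_le_row_factors[OF cut_rank_le_cut_rank])
  then obtain L R c where P: "\<And>i. P i (L i) (R i) (c i)" by metis
  have LR: "y (u @ v) = (\<Sum>k<cut_rank ns y i. L i k u * R i k v)"
    if "u \<in> idx (take i ns)" "v \<in> idx (drop i ns)" for i u v
    using P[of i] that unfolding P_def by blast
  have Rc: "R i k v = (\<Sum>u\<in>idx (take i ns). c i k u * y (u @ v))" if "v \<in> idx (drop i ns)" for i k v
    using P[of i] that unfolding P_def by blast
  define V where "V = (\<lambda>i w. if i = 0 then L 1 (last w) (butlast w)
     else if i = length ns - 1 then R i (hd w) (tl w)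
     else (\<Sum>u\<in>idx (take i ns). c i (w ! 0) u * L (Suc i) (w ! 2) (u @ [w ! 1])))"
  have tail: "tt_tail ns ((!) rs) V m k v = R (length ns - 1 - m) k v"
    if "m + 2 \<le> length ns" "v \<in> idx (drop (length ns - 1 - m) ns)" for m k v
    using that
  proof (induction m arbitrary: k v)
    case 0
    then show ?case using ns by (simp add: V_def)
  next
    case (Suc m)
    define i where "i = length ns - 2 - m"
    have i: "length ns - 1 - Suc m = i" "length ns - 1 - m = Suc i" "0 < i" "i < length ns - 1"
      using Suc.prems by (auto simp: i_def)
    have dr: "drop i ns = ns ! i # drop (Suc i) ns" using i by (simp add: Cons_nth_drop_Suc)
    have "v \<in> idx (ns ! i # drop (Suc i) ns)" using Suc.prems(2) unfolding i(1) dr .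
    then obtain a v' where v: "v = a # v'" "a < ns ! i" "v' \<in> idx (drop (Suc i) ns)"
      by (auto simp: idx_Cons)
    have "tt_tail ns ((!) rs) V (Suc m) k v = (\<Sum>l<\<rho> i. V i [k, a, l] * R (Suc i) l v')"
      using Suc.IH[of v'] Suc.prems v i rs by (simp add: i_def[symmetric])
    also have "\<dots> = (\<Sum>l<\<rho> i. (\<Sum>u\<in>idx (take i ns). c i k u * L (Suc i) l (u @ [a])) * R (Suc i) l v')"
      using i by (simp add: V_def)
    also have "\<dots> = (\<Sum>u\<in>idx (take i ns). c i k u * (\<Sum>l<\<rho> i. L (Suc i) l (u @ [a]) * R (Suc i) l v'))"
      by (simp add: sum_distrib_left sum_distrib_right mult.assoc sum.swap[of _ "{..<\<rho> i}"])
    also have "\<dots> = (\<Sum>u\<in>idx (take i ns). c i k u * y (u @ v))"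
    proof (intro sum.cong refl arg_cong2[where f = times])
      fix u assume "u \<in> idx (take i ns)"
      then have "u @ [a] \<in> idx (take (Suc i) ns)" using idx_take_SucI v i by simp
      from LR[OF this v(3)] show "(\<Sum>l<\<rho> i. L (Suc i) l (u @ [a]) * R (Suc i) l v') = y (u @ v)"
        by (simp add: \<rho>_def v)
    qed
    also have "\<dots> = R i k v" using Rc Suc.prems(2) unfolding i(1) by simp
    finally show ?case unfolding i(1) .
  qed
  have "y (u @ v) = (\<Sum>k<rs ! 0. V 0 (u @ [k]) * tt_tail ns ((!) rs) V (length ns - 2) k v)"
    if uv: "u \<in> idx (take 1 ns)" "v \<in> idx (drop 1 ns)" for u v
  proof -
    have "length ns - 1 - (length ns - 2) = 1" using ns by simp
    then have "tt_tail ns ((!) rs) V (length ns - 2) k v = R 1 k v" for k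
      using tail[of "length ns - 2" v k] uv ns by simp
    moreover have "rs ! 0 = cut_rank ns y 1" using rs(2)[of 0] ns by (simp add: \<rho>_def)
    ultimately show ?thesis using LR[OF uv] by (simp add: V_def)
  qed
  then show ?thesis unfolding tt_representable_eval[OF ns] rs_def[symmetric] using rs(1) by blast
qed

text \<open>The cut ranks are attained and lie below the ranks of every representation; antisymmetry
  of the entrywise order makes such a least element unique, so the definite description in
  \<open>tt_rank\<close> is well defined.\<close>

lemma tt_rank_eq_cut_ranks:
  assumes ns: "2 \<le> length ns"
  shows "tt_rank ns y = map (cut_rank ns y) [1..<length ns]"
  unfolding tt_rank_def
proof (rule the_equality)
  let ?r = "map (cut_rank ns y) [1..<length ns]"
  have min: "list_all2 (\<le>) ?r rs" if "tt_representable ns y rs" for rs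
  proof (rule list_all2_all_nthI)
    show "length ?r = length rs" using that by (simp add: tt_representable_def)
    fix i assume "i < length ?r"
    then show "?r ! i \<le> rs ! i"
      using cut_rank_least[OF tt_representable_cut_rank_le[OF ns that, of "Suc i"]] by simp
  qed
  then show "tt_representable ns y ?r \<and> (\<forall>rs'. tt_representable ns y rs' \<longrightarrow> list_all2 (\<le>) ?r rs')"
    using tt_representable_cut_ranks[OF ns] by blast
  fix rs assume "tt_representable ns y rs \<and> (\<forall>rs'. tt_representable ns y rs' \<longrightarrow> list_all2 (\<le>) rs rs')"
  then have "list_all2 (\<le>) rs ?r" "list_all2 (\<le>) ?r rs" using tt_representable_cut_ranks[OF ns] min by blast+
  then show "rs = ?r" by (auto simp: list_all2_conv_all_nth intro!: nth_equalityI antisym)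
qed

lemma tt_rank_le_cut_rank_le:
  assumes ns: "2 \<le> length ns" and le: "list_all2 (\<le>) (tt_rank ns y) (replicate (length ns - 1) r)"
    and i: "1 \<le> i" "i < length ns"
  shows "cut_rank_le ns y i r"
proof -
  have "cut_rank ns y i \<le> r"
    using list_all2_nthD[OF le, of "i - 1"] i unfolding tt_rank_eq_cut_ranks[OF ns] by simp
  then show ?thesis by (rule cut_rank_le_mono[OF cut_rank_le_cut_rank])
qed

section \<open>Runs of the randomized TT-SVD\<close>

text \<open>One step of the algorithm at full size: each row of the unfolding of \<open>z\<close> at
  cut \<open>i\<close> is replaced by its orthogonal projection onto the row space of the sketched
  unfolding.\<close>

definition proj_step :: "nat list \<Rightarrow> nat \<Rightarrow> nat \<Rightarrow> (nat list \<Rightarrow> real) \<Rightarrow> (nat list \<Rightarrow> real) \<Rightarrow> nat list \<Rightarrow> real" where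
  "proj_step ns s i \<gamma> z = (\<lambda>w. z w - residual (idx (drop i ns))
     (\<lambda>k v. \<Sum>u\<in>idx (take i ns). \<gamma> (k # u) * z (u @ v)) s (\<lambda>v. z (take i w @ v)) (drop i w))"

text \<open>The state of the algorithm after \<open>m\<close> steps, expanded to a tensor of the original shape. It is
  determined by the Gaussian draws alone, whatever orthonormal bases a run chooses.\<close>
primrec tt_state :: "nat list \<Rightarrow> nat \<Rightarrow> (nat \<Rightarrow> nat list \<Rightarrow> real) \<Rightarrow> (nat list \<Rightarrow> real) \<Rightarrow> nat \<Rightarrow> nat list \<Rightarrow> real" where
  "tt_state ns s g x 0 = x"
| "tt_state ns s g x (Suc m) = proj_step ns s (length ns - m - 1) (g (length ns - m)) (tt_state ns s g x m)"

text \<open>Iteration \<open>m\<close>, counted from 0, is step \<open>j = length ns - m\<close> of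
  the algorithm: it reads the draw \<open>g j\<close> and works at the cut after
  \<open>j - 1\<close> modes.\<close>

definition step_error2 :: "nat list \<Rightarrow> nat \<Rightarrow> (nat \<Rightarrow> nat list \<Rightarrow> real) \<Rightarrow> (nat list \<Rightarrow> real) \<Rightarrow> nat \<Rightarrow> real" where
  "step_error2 ns s g x m = sketch_error2 (idx (take (length ns - m - 1) ns)) (idx (drop (length ns - m - 1) ns)) s
     (\<lambda>u v. tt_state ns s g x m (u @ v)) (\<lambda>(k, u). g (length ns - m) (k # u))"

lemma proj_step_cut:
  assumes "u \<in> idx (take i ns)" "i \<le> length ns"
  shows "proj_step ns s i \<gamma> z (u @ v) = z (u @ v) - residual (idx (drop i ns))
     (\<lambda>k v. \<Sum>u\<in>idx (take i ns). \<gamma> (k # u) * z (u @ v)) s (\<lambda>v. z (u @ v)) v"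
proof -
  have "length u = i" using assms idx_length by force
  then show ?thesis by (simp add: proj_step_def)
qed

lemma residual_pythagoras0:
  assumes "finite A"
  shows "sq_norm A v = sq_norm A (residual A h n v) + sq_norm A (\<lambda>i. v i - residual A h n v i)"
  using residual_pythagoras[OF assms in_span_0, of v h n] by simp

lemma proj_step_norm:
  assumes "i \<le> length ns"
  shows "sq_norm (idx ns) z = sq_norm (idx ns) (proj_step ns s i \<gamma> z)
    + sketch_error2 (idx (take i ns)) (idx (drop i ns)) s (\<lambda>u v. z (u @ v)) (\<lambda>(k, u). \<gamma> (k # u))"
proof -
  have "sq_norm (idx ns) f = (\<Sum>u\<in>idx (take i ns). sq_norm (idx (drop i ns)) (\<lambda>v. f (u @ v)))" for f
    unfolding ip_def by (rule sum_idx_cut)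
  then show ?thesis
    using residual_pythagoras0[OF finite_idx] assms
    by (simp add: sketch_error2_def proj_step_cut sum.distrib[symmetric] add.commute)
qed

text \<open>Every step is an orthogonal projection of each row, so by Pythagoras the squared norm
  drops by exactly the squared error of that step.\<close>

lemma tt_state_norm:
  assumes "m \<le> length ns"
  shows "sq_norm (idx ns) x = sq_norm (idx ns) (tt_state ns s g x m) + (\<Sum>i<m. step_error2 ns s g x i)"
  using assms
proof (induction m)
  case (Suc m)
  then show ?case
    using proj_step_norm[of "length ns - m - 1" ns "tt_state ns s g x m" s "g (length ns - m)"]
    by (simp add: step_error2_def)
qed simp

section \<open>Every run realises the same projections\<close>

locale tt_run =
  fixes ns :: "nat list" and x :: "nat list \<Rightarrow> real" and s :: nat and g :: "nat \<Rightarrow> nat list \<Rightarrow> real"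
    and q :: "nat \<Rightarrow> nat" and W b :: "nat \<Rightarrow> nat list \<Rightarrow> real"
  assumes d2: "2 \<le> length ns" and run: "rt_run ns x s g q W b"
begin

abbreviation d :: nat where "d \<equiv> length ns"
abbreviation rows :: "nat \<Rightarrow> nat list set" where "rows j \<equiv> idx (take (j - 1) ns)"
abbreviation cols :: "nat \<Rightarrow> nat list set" where "cols j \<equiv> idx (drop (j - 1) ns)"

definition cd :: "nat \<Rightarrow> nat list" where "cd j = tl (rt_adims ns s q j)"

text \<open>The product of the cores \<open>W j\<close>, ..., \<open>W d\<close>, read as a family
  of \<open>q (j - 1)\<close> vectors. The shift by \<open>Suc\<close> is due to
  \<open>tt_tail\<close> counting cores from 0.\<close>

definition T :: "nat \<Rightarrow> nat \<Rightarrow> nat list \<Rightarrow> real" where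
  "T j = tt_tail ns (\<lambda>i. q (Suc i)) (\<lambda>i. W (Suc i)) (d - j)"

lemma cd_last: "cd d = [ns ! (d - 1)]"
  by (simp add: cd_def rt_adims_def)

lemma cd_inner: "j \<noteq> d \<Longrightarrow> cd j = [ns ! (j - 1), q j]"
  by (simp add: cd_def rt_adims_def)

lemma drop_last: "drop (d - 1) ns = [ns ! (d - 1)]"
proof -
  have "d - 1 < d" using d2 by simp
  then have "drop (d - 1) ns = ns ! (d - 1) # drop (Suc (d - 1)) ns" by (rule Cons_nth_drop_Suc[symmetric])
  then show ?thesis using d2 by simp
qed

lemma bdims_eq:
  assumes "2 \<le> j" "j \<le> d" shows "rt_bdims ns q (j + 1) = take (j - 1) ns @ cd j"
proof (cases "j = d")
  case True
  have "take (d - 1) ns @ [ns ! (d - 1)] = ns" using append_take_drop_id[of "d - 1" ns] unfolding drop_last .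
  then show ?thesis using True by (simp add: rt_bdims_def cd_last)
next
  case False
  have "take j ns = take (j - 1) ns @ [ns ! (j - 1)]"
    using assms False take_Suc_conv_app_nth[of "j - 1" ns] by simp
  then show ?thesis using False by (simp add: rt_bdims_def cd_inner)
qed

lemma Wdims_eq: "rt_Wdims ns s q j = q (j - 1) # cd j"
  by (simp add: rt_Wdims_def cd_def)

lemma run_step:
  assumes "2 \<le> j" "j \<le> d"
  shows W_orthonormal: "k < q (j - 1) \<Longrightarrow> k' < q (j - 1) \<Longrightarrow> (\<Sum>c\<in>idx (cd j). W j (k # c) * W j (k' # c)) = (if k = k' then 1 else 0)"
    and W_in_row_span: "k < q (j - 1) \<Longrightarrow> in_row_span (cd j) s (rt_a ns s q g b j) (\<lambda>c. W j (k # c))"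
    and a_in_row_span: "k < s \<Longrightarrow> in_row_span (cd j) (q (j - 1)) (W j) (\<lambda>c. rt_a ns s q g b j (k # c))"
    and b_step: "b j = (if j = d
               then contract (rt_bdims ns q (j + 1)) (b (j + 1)) (rt_Wdims ns s q j) (W j) [j - 1] [1]
               else contract (rt_bdims ns q (j + 1)) (b (j + 1)) (rt_Wdims ns s q j) (W j)
                      [j - 1, j] [1, 2])"
  using run assms unfolding rt_run_def cd_def by (auto simp: Let_def)

lemma b_init: "b (Suc d) = x"
  using run by (simp add: rt_run_def Let_def)

lemma a_eval:
  assumes j: "2 \<le> j" "j \<le> d" and k: "k < s" and c: "c \<in> idx (cd j)"
  shows "rt_a ns s q g b j (k # c) = (\<Sum>u\<in>rows j. g j (k # u) * b (j + 1) (u @ c))"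
proof -
  have l: "length (take (j - 1) ns) = j - 1" using j by simp
  have "[k] \<in> idx [s]" using k by simp
  from contract_segment[OF this _ c, of "[]" "[]" "[1..<j]" "take (j - 1) ns" "[0..<j - 1]" "g j" "b (j + 1)"]
  show ?thesis using j l by (simp add: rt_a_def bdims_eq[OF j, simplified])
qed

lemma b_eval:
  assumes j: "2 \<le> j" "j \<le> d" and k: "k < q (j - 1)" and u: "u \<in> rows j"
  shows "b j (u @ [k]) = (\<Sum>c\<in>idx (cd j). b (j + 1) (u @ c) * W j (k # c))"
proof -
  have l: "length (take (j - 1) ns) = j - 1" using j by simp
  have k': "[k] \<in> idx [q (j - 1)]" using k by simp
  define ks where "ks = [j - 1..<j - 1 + length (cd j)]"
  define ls where "ls = [1..<1 + length (cd j)]"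
  have "contract (take (j - 1) ns @ cd j) (b (j + 1)) ([q (j - 1)] @ cd j @ []) (W j) ks ls (u @ [k] @ [])
    = (\<Sum>c\<in>idx (cd j). b (j + 1) (u @ c) * W j ([k] @ c @ []))"
    by (rule contract_segment[OF u k']) (use l in \<open>simp_all add: ks_def ls_def\<close>)
  moreover have "b j = contract (take (j - 1) ns @ cd j) (b (j + 1)) ([q (j - 1)] @ cd j @ []) (W j) ks ls"
  proof (cases "j = d")
    case True
    then have "ks = [j - 1]" "ls = [1]" by (simp_all add: ks_def ls_def cd_last)
    then show ?thesis using b_step[OF j] True bdims_eq[OF j] by (simp add: Wdims_eq)
  next
    case False
    then have "ks = [j - 1, j]" "ls = [1, 2]" using j by (simp_all add: ks_def ls_def cd_inner upt_rec)
    then show ?thesis using b_step[OF j] False bdims_eq[OF j] by (simp add: Wdims_eq)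
  qed
  ultimately show ?thesis by simp
qed

text \<open>Loop invariant before step \<open>j\<close>: \<open>\<Psi>\<close> embeds the compressed
  column index of \<open>b (j + 1)\<close> isometrically into the original modes from
  \<open>j\<close> on, so that compressed and full-size computations correspond.\<close>

definition unrolling :: "nat \<Rightarrow> (nat list \<Rightarrow> nat list \<Rightarrow> real) \<Rightarrow> bool" where
  "unrolling j \<Psi> \<longleftrightarrow> orthonormal (cols j) (idx (cd j)) \<Psi> \<and>
    (\<forall>u\<in>rows j. \<forall>c\<in>idx (cd j). b (j + 1) (u @ c) = ip (cols j) (\<lambda>v. x (u @ v)) (\<Psi> c)) \<and>
    (\<forall>u\<in>rows j. \<forall>v\<in>cols j. tt_state ns s g x (d - j) (u @ v) = (\<Sum>c\<in>idx (cd j). b (j + 1) (u @ c) * \<Psi> c v)) \<and>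
    (\<forall>k<q (j - 1). \<forall>v\<in>cols j. T j k v = (\<Sum>c\<in>idx (cd j). W j (k # c) * \<Psi> c v))"

text \<open>Loop invariant after step \<open>j\<close>. The entries of \<open>b j\<close> are
  coefficients of the original \<open>x\<close>, not just of the current state; this makes the final
  tensor a row-wise orthogonal projection of \<open>x\<close>.\<close>

definition step_done :: "nat \<Rightarrow> bool" where
  "step_done j \<longleftrightarrow> orthonormal (cols j) {..<q (j - 1)} (T j) \<and>
    (\<forall>u\<in>rows j. \<forall>k<q (j - 1). b j (u @ [k]) = ip (cols j) (\<lambda>v. x (u @ v)) (T j k)) \<and>
    (\<forall>u\<in>rows j. \<forall>v\<in>cols j. tt_state ns s g x (Suc d - j) (u @ v) = (\<Sum>k<q (j - 1). b j (u @ [k]) * T j k v))"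

lemma ip_unrolled:
  assumes "orthonormal C A \<Psi>" "finite A"
  shows "ip C (\<lambda>v. \<Sum>c\<in>A. f c * \<Psi> c v) (\<lambda>v. \<Sum>c\<in>A. h c * \<Psi> c v) = (\<Sum>c\<in>A. f c * h c)"
proof -
  have "ip C (\<lambda>v. \<Sum>c\<in>A. f c * \<Psi> c v) (\<lambda>v. \<Sum>c\<in>A. h c * \<Psi> c v) = (\<Sum>c\<in>A. \<Sum>c'\<in>A. if c' = c then f c * h c' else 0)"
    unfolding ip_double_sum using orthonormalD[OF assms(1)] by (intro sum.cong) auto
  then show ?thesis using assms(2) by simp
qed

text \<open>The isometry \<open>\<Psi>\<close> carries the compressed sketch to the sketch of the
  full-size state, and the rows of \<open>W j\<close> to an orthonormal system with the same span.
  Uniqueness of residuals then identifies the step with \<open>proj_step\<close>, whatever basis the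
  run has chosen.\<close>

lemma unrolling_step:
  assumes j: "2 \<le> j" "j \<le> d" and \<Psi>: "unrolling j \<Psi>"
  shows "step_done j"
proof -
  have on: "orthonormal (cols j) (idx (cd j)) \<Psi>"
    and bx: "\<And>u c. u \<in> rows j \<Longrightarrow> c \<in> idx (cd j) \<Longrightarrow> b (j + 1) (u @ c) = ip (cols j) (\<lambda>v. x (u @ v)) (\<Psi> c)"
    and st: "\<And>u v. u \<in> rows j \<Longrightarrow> v \<in> cols j \<Longrightarrow> tt_state ns s g x (d - j) (u @ v) = (\<Sum>c\<in>idx (cd j). b (j + 1) (u @ c) * \<Psi> c v)"
    and TW: "\<And>k v. k < q (j - 1) \<Longrightarrow> v \<in> cols j \<Longrightarrow> T j k v = (\<Sum>c\<in>idx (cd j). W j (k # c) * \<Psi> c v)"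
    using \<Psi> by (auto simp: unrolling_def)
  let ?z = "tt_state ns s g x (d - j)"
  define h where "h = (\<lambda>k v. \<Sum>u\<in>rows j. g j (k # u) * ?z (u @ v))"
  let ?a = "rt_a ns s q g b j"
  have h: "h k v = (\<Sum>c\<in>idx (cd j). ?a (k # c) * \<Psi> c v)" if "k < s" "v \<in> cols j" for k v
  proof -
    have "h k v = (\<Sum>u\<in>rows j. \<Sum>c\<in>idx (cd j). g j (k # u) * (b (j + 1) (u @ c) * \<Psi> c v))"
      unfolding h_def using st that by (intro sum.cong) (auto simp: sum_distrib_left)
    also have "\<dots> = (\<Sum>c\<in>idx (cd j). (\<Sum>u\<in>rows j. g j (k # u) * b (j + 1) (u @ c)) * \<Psi> c v)"
      by (subst sum.swap) (simp add: sum_distrib_right mult.assoc)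
    also have "\<dots> = (\<Sum>c\<in>idx (cd j). ?a (k # c) * \<Psi> c v)"
      using a_eval[OF j that(1)] by (intro sum.cong) auto
    finally show ?thesis .
  qed
  have T1: "orthonormal (cols j) {..<q (j - 1)} (T j)"
    unfolding orthonormal_def
  proof (intro ballI)
    fix k k' assume k: "k \<in> {..<q (j - 1)}" "k' \<in> {..<q (j - 1)}"
    have "ip (cols j) (T j k) (T j k') = ip (cols j) (\<lambda>v. \<Sum>c\<in>idx (cd j). W j (k # c) * \<Psi> c v) (\<lambda>v. \<Sum>c\<in>idx (cd j). W j (k' # c) * \<Psi> c v)"
      using TW k by (intro ip_cong) auto
    also have "\<dots> = (if k = k' then 1 else 0)"
      unfolding ip_unrolled[OF on finite_idx] using W_orthonormal[OF j, of k k'] k by simp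
    finally show "ip (cols j) (T j k) (T j k') = (if k = k' then 1 else 0)" .
  qed
  have T2: "b j (u @ [k]) = ip (cols j) (\<lambda>v. x (u @ v)) (T j k)" if u: "u \<in> rows j" and k: "k < q (j - 1)" for u k
  proof -
    have "ip (cols j) (\<lambda>v. x (u @ v)) (T j k) = ip (cols j) (\<lambda>v. x (u @ v)) (\<lambda>v. \<Sum>c\<in>idx (cd j). W j (k # c) * \<Psi> c v)"
      using TW k by (intro ip_cong) auto
    also have "\<dots> = (\<Sum>c\<in>idx (cd j). W j (k # c) * b (j + 1) (u @ c))"
      unfolding ip_sum_right using bx u by (intro sum.cong) auto
    also have "\<dots> = b j (u @ [k])" using b_eval[OF j k u] by (simp add: mult.commute)
    finally show ?thesis ..
  qed
  have T3: "tt_state ns s g x (Suc d - j) (u @ v) = (\<Sum>k<q (j - 1). b j (u @ [k]) * T j k v)"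
    if u: "u \<in> rows j" and v: "v \<in> cols j" for u v
  proof -
    define p where "p = (\<lambda>v. \<Sum>k<q (j - 1). b j (u @ [k]) * T j k v)"
    have Th: "in_span (cols j) h s (T j k)" if k: "k < q (j - 1)" for k
    proof -
      obtain e where e: "\<forall>c\<in>idx (cd j). W j (k # c) = (\<Sum>l<s. e l * ?a (l # c))"
        using W_in_row_span[OF j k] by (auto simp: in_row_span_def)
      have "T j k v = (\<Sum>l<s. e l * h l v)" if "v \<in> cols j" for v
      proof -
        have "T j k v = (\<Sum>c\<in>idx (cd j). \<Sum>l<s. e l * (?a (l # c) * \<Psi> c v))"
          unfolding TW[OF k that] using e by (intro sum.cong) (auto simp: sum_distrib_right mult.assoc)
        also have "\<dots> = (\<Sum>l<s. e l * h l v)"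
          using h that by (subst sum.swap) (simp add: sum_distrib_left)
        finally show ?thesis .
      qed
      then show ?thesis by (auto simp: in_span_def)
    qed
    have zT: "ip (cols j) (\<lambda>v. ?z (u @ v)) (T j k) = b j (u @ [k])" if k: "k < q (j - 1)" for k
    proof -
      have "ip (cols j) (\<lambda>v. ?z (u @ v)) (T j k)
        = ip (cols j) (\<lambda>v. \<Sum>c\<in>idx (cd j). b (j + 1) (u @ c) * \<Psi> c v) (\<lambda>v. \<Sum>c\<in>idx (cd j). W j (k # c) * \<Psi> c v)"
        using TW k st u by (intro ip_cong) auto
      then show ?thesis unfolding ip_unrolled[OF on finite_idx] using b_eval[OF j k u] by simp
    qed
    have pT: "ip (cols j) p (T j k) = b j (u @ [k])" if k: "k < q (j - 1)" for k
    proof -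
      have "ip (cols j) p (T j k) = (\<Sum>l<q (j - 1). if l = k then b j (u @ [l]) else 0)"
        unfolding p_def ip_sum_left using orthonormalD[OF T1] k by (intro sum.cong) auto
      then show ?thesis using k by simp
    qed
    \<comment> \<open>Both inclusions of row spaces enter: one puts \<open>p\<close> into the span
      of the sketched rows, the other makes the remainder orthogonal to them.\<close>
    have "residual (cols j) h s (\<lambda>v. ?z (u @ v)) v = ?z (u @ v) - p v"
    proof (rule residual_unique[OF finite_idx _ _ v])
      have "in_span (cols j) h s p" unfolding p_def by (rule in_span_sum) (use Th in auto)
      then show "in_span (cols j) h s (\<lambda>i. ?z (u @ i) - (?z (u @ i) - p i))" by simp
      fix k assume k: "k < s"
      obtain f where f: "\<forall>c\<in>idx (cd j). ?a (k # c) = (\<Sum>l<q (j - 1). f l * W j (l # c))"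
        using a_in_row_span[OF j k] by (auto simp: in_row_span_def)
      have hT: "h k v = (\<Sum>l<q (j - 1). f l * T j l v)" if "v \<in> cols j" for v
      proof -
        have "h k v = (\<Sum>c\<in>idx (cd j). \<Sum>l<q (j - 1). f l * (W j (l # c) * \<Psi> c v))"
          unfolding h[OF k that] using f by (intro sum.cong) (auto simp: sum_distrib_right mult.assoc)
        also have "\<dots> = (\<Sum>l<q (j - 1). f l * T j l v)"
          using TW that by (subst sum.swap) (simp add: sum_distrib_left)
        finally show ?thesis .
      qed
      have "ip (cols j) (\<lambda>v. ?z (u @ v) - p v) (h k) = ip (cols j) (\<lambda>v. ?z (u @ v) - p v) (\<lambda>v. \<Sum>l<q (j - 1). f l * T j l v)"
        using hT by (intro ip_cong) auto
      also have "\<dots> = 0" using zT pT by (simp add: ip_sum_right ip_diff_left)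
      finally show "ip (cols j) (\<lambda>v. ?z (u @ v) - p v) (h k) = 0" .
    qed
    then have "proj_step ns s (j - 1) (g j) ?z (u @ v) = p v"
      using proj_step_cut[OF u, of s "g j" ?z v] j by (simp add: h_def)
    moreover have "Suc d - j = Suc (d - j)" "d - (d - j) - 1 = j - 1" "d - (d - j) = j" using j by auto
    ultimately show ?thesis unfolding p_def by (simp only: tt_state.simps)
  qed
  show ?thesis unfolding step_done_def using T1 T2 T3 by blast
qed

lemma unrolling_last: "unrolling d (\<lambda>c v. if c = v then 1 else 0)"
proof -
  have cols: "cols d = idx (cd d)" by (simp only: drop_last cd_last)
  have 1: "ip (idx (cd d)) f (\<lambda>v. if c = v then 1 else 0) = f c" if "c \<in> idx (cd d)" for f c
    using ip_delta[OF finite_idx that, of f] by (simp add: ip_commute[of _ f] eq_commute[of c])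
  have 2: "(\<Sum>c\<in>idx (cd d). f c * (if c = v then 1 else 0)) = f v" if "v \<in> idx (cd d)" for f :: "nat list \<Rightarrow> real" and v
    using 1[OF that, of f] by (simp add: ip_def eq_commute[of v])
  have "Suc (d - Suc 0) = d" using d2 by linarith
  then show ?thesis
    unfolding unrolling_def cols orthonormal_def
    by (auto simp: 1 2 b_init T_def)
qed

lemma sum_idx_pair: "(\<Sum>c\<in>idx [m, n]. f c) = (\<Sum>i<m. \<Sum>l<n. f [i, l])"
  by (simp add: sum_idx_Cons sum_idx_singleton)

text \<open>A column index before step \<open>j - 1\<close> consists of an index of mode
  \<open>j - 1\<close> and a bond index. Accordingly \<open>\<Psi>\<close> is the tensor product of
  the identity on that mode with the system \<open>T j\<close> from the step just completed.\<close>

lemma unrolling_inner: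
  assumes j: "3 \<le> j" "j \<le> d" and sd: "step_done j"
  shows "unrolling (j - 1) (\<lambda>c v. if c ! 0 = hd v then T j (c ! 1) (tl v) else 0)" (is "unrolling _ ?\<Psi>")
proof -
  define n where "n = ns ! (j - 2)"
  define Q where "Q = q (j - 1)"
  have on: "orthonormal (cols j) {..<Q} (T j)"
    and bx: "\<And>u k. u \<in> rows j \<Longrightarrow> k < Q \<Longrightarrow> b j (u @ [k]) = ip (cols j) (\<lambda>v. x (u @ v)) (T j k)"
    and st: "\<And>u v. u \<in> rows j \<Longrightarrow> v \<in> cols j \<Longrightarrow> tt_state ns s g x (Suc d - j) (u @ v) = (\<Sum>k<Q. b j (u @ [k]) * T j k v)"
    using sd by (auto simp: step_done_def Q_def)
  have j1: "j - 1 + 1 = j" "j - 1 - 1 = j - 2" "d - (j - 1) = Suc d - j" using j by auto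
  have cdj: "cd (j - 1) = [n, Q]" using j by (simp add: cd_inner n_def Q_def numeral_2_eq_2)
  have dr: "drop (j - 1 - 1) ns = n # drop (j - 1) ns"
    unfolding n_def j1 using j Cons_nth_drop_Suc[of "j - 2" ns] by (simp add: Suc_diff_Suc numeral_2_eq_2)
  have tk: "u @ [i] \<in> rows j" if "u \<in> rows (j - 1)" "i < n" for u i
    using idx_take_SucI[of "j - 2" ns u i] that j by (simp add: n_def j1 numeral_2_eq_2 Suc_diff_Suc)
  have split: "ip (cols (j - 1)) f h = (\<Sum>i<n. ip (cols j) (\<lambda>v. f (i # v)) (\<lambda>v. h (i # v)))" for f h
    unfolding ip_def dr by (rule sum_idx_Cons)
  have Psi: "ip (cols (j - 1)) f (?\<Psi> [i, l]) = ip (cols j) (\<lambda>v. f (i # v)) (T j l)" if "i < n" for f i l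
  proof -
    have "ip (cols (j - 1)) f (?\<Psi> [i, l]) = (\<Sum>i'<n. if i' = i then ip (cols j) (\<lambda>v. f (i # v)) (T j l) else 0)"
      unfolding split by (intro sum.cong) (auto simp: ip_def)
    then show ?thesis using that by simp
  qed
  have pairE: "\<exists>i l. c = [i, l] \<and> i < n \<and> l < Q" if "c \<in> idx (cd (j - 1))" for c
    using that unfolding cdj idx_Cons by auto
  have 1: "orthonormal (cols (j - 1)) (idx (cd (j - 1))) ?\<Psi>"
    unfolding orthonormal_def
  proof (intro ballI)
    fix c c' assume "c \<in> idx (cd (j - 1))" "c' \<in> idx (cd (j - 1))"
    then obtain i l i' l' where c: "c = [i, l]" "i < n" "l < Q" "c' = [i', l']" "i' < n" "l' < Q" using pairE by blast
    have "ip (cols (j - 1)) (?\<Psi> c) (?\<Psi> c') = ip (cols j) (\<lambda>v. if i = i' then T j l v else 0) (T j l')"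
      unfolding c(4) Psi[OF c(5)] by (intro ip_cong) (auto simp: c(1))
    also have "\<dots> = (if c = c' then 1 else 0)"
      using orthonormalD[OF on, of l l'] c by (cases "i = i'") (auto simp: ip_zero_left)
    finally show "ip (cols (j - 1)) (?\<Psi> c) (?\<Psi> c') = (if c = c' then 1 else 0)" .
  qed
  have 2: "b (j - 1 + 1) (u @ c) = ip (cols (j - 1)) (\<lambda>v. x (u @ v)) (?\<Psi> c)"
    if u: "u \<in> rows (j - 1)" and c0: "c \<in> idx (cd (j - 1))" for u c
  proof -
    obtain i l where c: "c = [i, l]" "i < n" "l < Q" using pairE[OF c0] by blast
    have "b j ((u @ [i]) @ [l]) = ip (cols j) (\<lambda>v. x ((u @ [i]) @ v)) (T j l)" by (rule bx[OF tk[OF u c(2)] c(3)])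
    then show ?thesis unfolding c(1) Psi[OF c(2)] j1(1) by simp
  qed
  have inner: "(\<Sum>c\<in>idx (cd (j - 1)). f c * ?\<Psi> c (i # v)) = (\<Sum>l<Q. f [i, l] * T j l v)" if "i < n" for f i v
  proof -
    have "(\<Sum>c\<in>idx (cd (j - 1)). f c * ?\<Psi> c (i # v)) = (\<Sum>i'<n. if i' = i then \<Sum>l<Q. f [i, l] * T j l v else 0)"
      unfolding cdj sum_idx_pair by (intro sum.cong) auto
    then show ?thesis using that by simp
  qed
  have colE: "\<exists>i v. w = i # v \<and> i < n \<and> v \<in> cols j" if "w \<in> cols (j - 1)" for w
    using that unfolding dr idx_Cons by auto
  have 3: "tt_state ns s g x (d - (j - 1)) (u @ w) = (\<Sum>c\<in>idx (cd (j - 1)). b (j - 1 + 1) (u @ c) * ?\<Psi> c w)"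
    if u: "u \<in> rows (j - 1)" and w0: "w \<in> cols (j - 1)" for u w
  proof -
    obtain i v where w: "w = i # v" "i < n" "v \<in> cols j" using colE[OF w0] by blast
    from st[OF tk[OF u w(2)] w(3)] show ?thesis
      unfolding w(1) inner[OF w(2)] j1 by simp
  qed
  have 4: "T (j - 1) k w = (\<Sum>c\<in>idx (cd (j - 1)). W (j - 1) (k # c) * ?\<Psi> c w)"
    if w0: "w \<in> cols (j - 1)" for k w
  proof -
    obtain i v where w: "w = i # v" "i < n" "v \<in> cols j" using colE[OF w0] by blast
    have e: "d - (j - 1) = Suc (d - j)" "d - 2 - (d - j) = j - 2" "Suc (j - 2) = j - 1" using j by auto
    have "T (j - 1) k (i # v) = (\<Sum>l<Q. W (j - 1) [k, i, l] * T j l v)"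
      unfolding T_def e(1) tt_tail.simps e(2) e(3) by (simp add: Q_def)
    then show ?thesis unfolding w(1) inner[OF w(2)] .
  qed
  show ?thesis unfolding unrolling_def using 1 2 3 4 by blast
qed

lemma step_done_all:
  assumes "2 \<le> j" "j \<le> d" shows "step_done j"
  using assms(2,1)
proof (induction j rule: inc_induct)
  case base
  then show ?case using unrolling_step[OF _ _ unrolling_last] by simp
next
  case (step j)
  then show ?case using unrolling_step[of j] unrolling_inner[of "Suc j"] by auto
qed

lemma rt_output_eval:
  assumes "u \<in> rows 2" "v \<in> cols 2"
  shows "rt_output ns s q W b (u @ v) = tt_state ns s g x (d - 1) (u @ v)"
proof -
  have "[2..<d + 1] = map Suc [1..<d]" by (simp add: map_Suc_upt numeral_2_eq_2)
  moreover have "(rt_Wdims ns s q (Suc i), W (Suc i)) = (core_dims ns (\<lambda>i. q (Suc i)) i, W (Suc i))" if "i \<in> set [1..<d]" for i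
  proof -
    have "Suc (i - Suc 0) = i" "i = d - Suc 0 \<longleftrightarrow> Suc i = d" using that by auto
    then show ?thesis by (auto simp: Wdims_eq core_dims_def cd_def rt_adims_def)
  qed
  ultimately have "map (\<lambda>j. (rt_Wdims ns s q j, W j)) [2..<d + 1] = map (\<lambda>i. (core_dims ns (\<lambda>i. q (Suc i)) i, W (Suc i))) [1..<d]"
    by simp
  moreover have "rt_bdims ns q 2 = take 1 ns @ [q (Suc 0)]" using d2 by (simp add: rt_bdims_def)
  ultimately have "rt_output ns s q W b (u @ v) = (\<Sum>k<q (Suc 0). b 2 (u @ [k]) * T 2 k v)"
    using tt_prod_eval[OF d2, of u v "\<lambda>i. q (Suc i)" "b 2" "\<lambda>i. W (Suc i)"] assms
    by (simp add: rt_output_def T_def)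
  also have "\<dots> = tt_state ns s g x (d - 1) (u @ v)"
    using step_done_all[of 2] d2 assms by (simp add: step_done_def numeral_2_eq_2)
  finally show ?thesis .
qed

text \<open>Rows of the output are orthogonal projections of rows of \<open>x\<close> onto the span
  of \<open>T 2\<close>. Hence the inner product of \<open>x\<close> with the output is the squared
  norm of the output, and the squared error is a difference of squared norms, which telescopes over
  the steps.\<close>

theorem rt_output_error:
  "(tnorm ns (\<lambda>w. x w - rt_output ns s q W b w))\<^sup>2 = (\<Sum>m<d - 1. step_error2 ns s g x m)"
proof -
  define z where "z = tt_state ns s g x (d - 1)"
  have sd: "step_done 2" using step_done_all d2 by simp
  have zT: "z (u @ v) = (\<Sum>k<q 1. b 2 (u @ [k]) * T 2 k v)" if "u \<in> rows 2" "v \<in> cols 2" for u v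
    using sd that by (simp add: step_done_def z_def numeral_2_eq_2)
  have on: "orthonormal (cols 2) {..<q 1} (T 2)" using sd by (simp add: step_done_def)
  have bx: "b 2 (u @ [k]) = ip (cols 2) (\<lambda>v. x (u @ v)) (T 2 k)" if "u \<in> rows 2" "k < q 1" for u k
    using sd that by (simp add: step_done_def)
  have split: "ip (idx ns) f h = (\<Sum>u\<in>rows 2. ip (cols 2) (\<lambda>v. f (u @ v)) (\<lambda>v. h (u @ v)))" for f h
    unfolding ip_def by (rule sum_idx_cut)
  have "ip (cols 2) (\<lambda>v. x (u @ v)) (\<lambda>v. z (u @ v)) = sq_norm (cols 2) (\<lambda>v. z (u @ v))" if u: "u \<in> rows 2" for u
  proof -
    have "ip (cols 2) (\<lambda>v. x (u @ v)) (\<lambda>v. z (u @ v)) = ip (cols 2) (\<lambda>v. x (u @ v)) (\<lambda>v. \<Sum>k<q 1. b 2 (u @ [k]) * T 2 k v)"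
      using zT u by (intro ip_cong) auto
    also have "\<dots> = (\<Sum>k<q 1. b 2 (u @ [k]) * b 2 (u @ [k]))"
      unfolding ip_sum_right using bx u by (intro sum.cong) auto
    also have "\<dots> = sq_norm (cols 2) (\<lambda>v. \<Sum>k<q 1. b 2 (u @ [k]) * T 2 k v)"
      by (rule ip_unrolled[OF on, symmetric]) simp
    also have "\<dots> = sq_norm (cols 2) (\<lambda>v. z (u @ v))"
      using zT u by (intro ip_cong) auto
    finally show ?thesis .
  qed
  then have xz: "ip (idx ns) x z = sq_norm (idx ns) z" unfolding split by simp
  have out: "rt_output ns s q W b w = z w" if "w \<in> idx ns" for w
    using idx_cutE[OF that, of 1] rt_output_eval by (metis z_def diff_Suc_1 numeral_2_eq_2 One_nat_def)
  have "(tnorm ns (\<lambda>w. x w - rt_output ns s q W b w))\<^sup>2 = (\<Sum>w\<in>idx ns. (x w - rt_output ns s q W b w)\<^sup>2)"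
    by (simp add: tnorm_def sum_nonneg)
  also have "\<dots> = sq_norm (idx ns) (\<lambda>w. x w - z w)"
    unfolding ip_def by (intro sum.cong) (auto simp: out power2_eq_square)
  also have "\<dots> = sq_norm (idx ns) x - sq_norm (idx ns) z"
    using xz by (simp add: ip_diff_left ip_diff_right ip_commute[of _ z x])
  also have "\<dots> = (\<Sum>m<d - 1. step_error2 ns s g x m)"
    using tt_state_norm[of "d - 1" ns x s g] by (simp add: z_def)
  finally show ?thesis .
qed

end

section \<open>Stability of low-rank approximations under the steps\<close>

lemma residual_sum:
  assumes "finite A" "i \<in> A"
  shows "residual A h n (\<lambda>i. \<Sum>k\<in>K. c k * v k i) i = (\<Sum>k\<in>K. c k * residual A h n (v k) i)"
proof (rule residual_unique[OF assms(1) _ _ assms(2)])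
  have "in_span A h n (\<lambda>i. \<Sum>k\<in>K. c k * (v k i - residual A h n (v k) i))"
    by (intro in_span_sum residual_span)
  then show "in_span A h n (\<lambda>i. (\<Sum>k\<in>K. c k * v k i) - (\<Sum>k\<in>K. c k * residual A h n (v k) i))"
    by (simp add: right_diff_distrib sum_subtractf)
  show "ip A (\<lambda>i. \<Sum>k\<in>K. c k * residual A h n (v k) i) (h l) = 0" if "l < n" for l
    using residual_orth[OF assms(1) that] by (simp add: ip_sum_left)
qed

lemma residual_diff:
  assumes "finite A" "i \<in> A"
  shows "residual A h n (\<lambda>i. v i - w i) i = residual A h n v i - residual A h n w i"
proof (rule residual_unique[OF assms(1) _ _ assms(2)])
  have "in_span A h n (\<lambda>i. (v i - residual A h n v i) - (w i - residual A h n w i))"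
    by (intro in_span_diff residual_span)
  then show "in_span A h n (\<lambda>i. v i - w i - (residual A h n v i - residual A h n w i))"
    by (rule iffD1[OF in_span_cong, rotated]) simp
  show "ip A (\<lambda>i. residual A h n v i - residual A h n w i) (h l) = 0" if "l < n" for l
    using residual_orth[OF assms(1) that] by (simp add: ip_diff_left)
qed

text \<open>The cuts are visited from the last to the first, and a projection at one cut preserves
  the ranks at the earlier ones; so \<open>m\<close> decreases by one with each step.\<close>

definition low_cut_ranks :: "nat list \<Rightarrow> nat \<Rightarrow> nat \<Rightarrow> (nat list \<Rightarrow> real) \<Rightarrow> bool" where
  "low_cut_ranks ns r m y \<longleftrightarrow> (\<forall>i. 1 \<le> i \<longrightarrow> i < m \<longrightarrow> cut_rank_le ns y i r)"

text \<open>The witness \<open>y'\<close> is the image of \<open>y\<close> under the projection that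
  the step applies to \<open>z\<close>. This map is linear and acts on the modes after cut
  \<open>i\<close>, hence only on the right factors at earlier cuts, and as a contraction it does
  not increase the distance of \<open>z\<close> and \<open>y\<close>.\<close>

lemma proj_step_approx:
  assumes i: "i < length ns" and y: "low_cut_ranks ns r (Suc i) y"
  shows "\<exists>y'. low_cut_ranks ns r i y' \<and>
    sq_norm (idx ns) (\<lambda>w. proj_step ns s i \<gamma> z w - y' w)
      \<le> sq_norm (idx ns) (\<lambda>w. z w - y w)"
proof -
  define C where "C = idx (drop i ns)"
  define h where "h = (\<lambda>k v. \<Sum>u\<in>idx (take i ns). \<gamma> (k # u) * z (u @ v))"
  define y' where "y' = (\<lambda>w. y w - residual C h s (\<lambda>v. y (take i w @ v)) (drop i w))"
  have y'cut: "y' (u @ v) = y (u @ v) - residual C h s (\<lambda>v. y (u @ v)) v" if "u \<in> idx (take i ns)" for u v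
  proof -
    have "length u = i" using that i idx_length by force
    then show ?thesis by (simp add: y'_def)
  qed
  have "cut_rank_le ns y' k r" if k: "1 \<le> k" "k < i" for k
  proof -
    obtain L R where LR: "\<forall>u\<in>idx (take k ns). \<forall>v\<in>idx (drop k ns). y (u @ v) = (\<Sum>l<r. L l u * R l v)"
      using y k unfolding low_cut_ranks_def cut_rank_le_def by (metis less_SucI)
    define R' where "R' = (\<lambda>l w. R l w - residual C h s (\<lambda>v. R l (take (i - k) w @ v)) (drop (i - k) w))"
    have "y' (u @ w) = (\<Sum>l<r. L l u * R' l w)" if u: "u \<in> idx (take k ns)" and w: "w \<in> idx (drop k ns)" for u w
    proof -
      \<comment> \<open>The column index at cut \<open>k\<close> splits at cut \<open>i\<close>: the
        part \<open>a\<close> is left alone, the part \<open>v\<close> is projected.\<close>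
      obtain a v where av: "w = a @ v" "a \<in> idx (take (i - k) (drop k ns))" "v \<in> idx (drop (i - k) (drop k ns))"
        using idx_cutE[OF w, of "i - k"] by blast
      have v: "v \<in> C" using av(3) k by (simp add: C_def)
      have la: "length a = i - k" using idx_length[OF av(2)] k i by simp
      have tk: "take i ns = take k ns @ take (i - k) (drop k ns)" using k by (simp add: take_add[symmetric])
      have ua: "u @ a \<in> idx (take i ns)" unfolding tk using u av(2) idx_length[OF u] by simp
      have mem: "a @ v' \<in> idx (drop k ns)" if "v' \<in> C" for v'
        using idx_cut_iff[OF av(2), of v'] that k by (simp add: C_def)
      have "residual C h s (\<lambda>v. y ((u @ a) @ v)) v = residual C h s (\<lambda>v. \<Sum>l<r. L l u * R l (a @ v)) v"
        by (rule residual_cong) (use LR u v mem in auto)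
      also have "\<dots> = (\<Sum>l<r. L l u * residual C h s (\<lambda>v. R l (a @ v)) v)"
        by (rule residual_sum) (use v in \<open>auto simp: C_def\<close>)
      finally have "y' ((u @ a) @ v) = (\<Sum>l<r. L l u * (R l (a @ v) - residual C h s (\<lambda>v. R l (a @ v)) v))"
        unfolding y'cut[OF ua] using LR u mem[OF v] by (simp add: right_diff_distrib sum_subtractf)
      then show ?thesis by (simp add: R'_def av(1) la)
    qed
    then show ?thesis unfolding cut_rank_le_def by blast
  qed
  moreover have "sq_norm (idx ns) (\<lambda>w. proj_step ns s i \<gamma> z w - y' w)
      \<le> sq_norm (idx ns) (\<lambda>w. z w - y w)"
  proof -
    have split: "sq_norm (idx ns) f = (\<Sum>u\<in>idx (take i ns). sq_norm C (\<lambda>v. f (u @ v)))" for f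
      unfolding ip_def C_def by (rule sum_idx_cut)
    show ?thesis unfolding split
    proof (rule sum_mono)
      fix u assume u: "u \<in> idx (take i ns)"
      let ?w = "\<lambda>v. z (u @ v) - y (u @ v)"
      have "sq_norm C (\<lambda>v. proj_step ns s i \<gamma> z (u @ v) - y' (u @ v))
        = sq_norm C (\<lambda>v. ?w v - residual C h s ?w v)"
        using residual_diff[of C _ h s "\<lambda>v. z (u @ v)" "\<lambda>v. y (u @ v)"] i
        by (intro ip_cong) (simp_all add: proj_step_cut[OF u] y'cut[OF u] C_def h_def)
      also have "\<dots> \<le> sq_norm C ?w"
        using residual_pythagoras0[of C ?w h s] ip_self_nonneg[of C "residual C h s ?w"] by (simp add: C_def)
      finally show "sq_norm C (\<lambda>v. proj_step ns s i \<gamma> z (u @ v) - y' (u @ v))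
        \<le> sq_norm C ?w" .
    qed
  qed
  ultimately show ?thesis unfolding low_cut_ranks_def by blast
qed

lemma tt_state_approx:
  assumes "m < length ns" "low_cut_ranks ns r (length ns) y"
  shows "\<exists>y'. low_cut_ranks ns r (length ns - m) y' \<and>
    sq_norm (idx ns) (\<lambda>w. tt_state ns s g x m w - y' w)
      \<le> sq_norm (idx ns) (\<lambda>w. x w - y w)"
  using assms(1)
proof (induction m)
  case 0
  then show ?case using assms(2) by auto
next
  case (Suc m)
  then obtain y' where y': "low_cut_ranks ns r (length ns - m) y'"
    "sq_norm (idx ns) (\<lambda>w. tt_state ns s g x m w - y' w) \<le> sq_norm (idx ns) (\<lambda>w. x w - y w)"
    by auto
  have i: "length ns - m - 1 < length ns" "Suc (length ns - m - 1) = length ns - m" "length ns - Suc m = length ns - m - 1"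
    using Suc.prems by auto
  obtain y'' where "low_cut_ranks ns r (length ns - m - 1) y''"
    "sq_norm (idx ns) (\<lambda>w. tt_state ns s g x (Suc m) w - y'' w)
      \<le> sq_norm (idx ns) (\<lambda>w. tt_state ns s g x m w - y' w)"
    using proj_step_approx[OF i(1), of r y' s "g (length ns - m)" "tt_state ns s g x m"] y'(1) unfolding i(2) by auto
  then show ?case using y'(2) unfolding i(3) by (meson order_trans)
qed

section \<open>Dependence on the draws and measurability\<close>

lemma tt_state_cong:
  assumes "m \<le> length ns" "\<And>j. length ns - m < j \<Longrightarrow> g j = g' j"
  shows "tt_state ns s g x m = tt_state ns s g' x m"
  using assms
proof (induction m)
  case (Suc m)
  have "tt_state ns s g x m = tt_state ns s g' x m" using Suc by simp
  moreover have "g (length ns - m) = g' (length ns - m)" using Suc.prems by simp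
  ultimately show ?case by simp
qed simp

lemma step_error2_cong:
  assumes "m < length ns" "\<And>j. length ns - Suc m < j \<Longrightarrow> g j = g' j"
  shows "step_error2 ns s g x m = step_error2 ns s g' x m"
proof -
  have "tt_state ns s g x m = tt_state ns s g' x m" using assms by (intro tt_state_cong) auto
  moreover have "g (length ns - m) = g' (length ns - m)" using assms by simp
  ultimately show ?thesis by (simp add: step_error2_def)
qed

lemma measurable_tt_state:
  "(\<lambda>\<omega>. tt_state ns s (\<lambda>j w. \<omega> (j, w)) x m w) \<in> borel_measurable (gauss A)"
proof (induction m arbitrary: w)
  case (Suc m)
  then show ?case unfolding tt_state.simps proj_step_def
    by (intro borel_measurable_diff measurable_residual borel_measurable_sum borel_measurable_times measurable_gauss_component)
qed simp

lemma measurable_step_error2: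
  "(\<lambda>\<omega>. step_error2 ns s (\<lambda>j w. \<omega> (j, w)) x m) \<in> borel_measurable (gauss A)"
  unfolding step_error2_def
  by (intro measurable_sketch_error2 measurable_tt_state) (simp add: case_prod_beta measurable_gauss_component)

lemma sketch_error2_cong:
  assumes "\<And>k i. k < s \<Longrightarrow> i \<in> I \<Longrightarrow> g (k, i) = g' (k, i)"
  shows "sketch_error2 I C s X g = sketch_error2 I C s X g'"
proof -
  have "residual C (\<lambda>k c. \<Sum>i\<in>I. g (k, i) * X i c) s v c = residual C (\<lambda>k c. \<Sum>i\<in>I. g' (k, i) * X i c) s v c"
    if "c \<in> C" for v c
    using that assms by (intro residual_cong) auto
  then show ?thesis unfolding sketch_error2_def by (intro sum.cong refl ip_cong)
qed

section \<open>Combining the steps\<close>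

text \<open>Draws are consumed from \<open>j = length ns\<close> downwards, so these are the ones
  read by the first \<open>m\<close> steps, and \<open>step_index\<close> collects those of the step
  numbered \<open>m\<close> from 0.\<close>

definition drawn_index :: "nat list \<Rightarrow> nat \<Rightarrow> nat \<Rightarrow> (nat \<times> nat list) set" where
  "drawn_index ns s m = {p \<in> rt_gauss_index ns s. length ns - m < fst p}"

definition step_index :: "nat list \<Rightarrow> nat \<Rightarrow> nat \<Rightarrow> (nat \<times> nat list) set" where
  "step_index ns s m = (\<lambda>(k, u). (length ns - m, k # u)) ` ({..<s} \<times> idx (take (length ns - m - 1) ns))"

lemma drawn_index_Suc:
  assumes "Suc m < length ns"
  shows "drawn_index ns s (Suc m) = drawn_index ns s m \<union> step_index ns s m"
proof -
  have "p \<in> step_index ns s m \<longleftrightarrow> p \<in> rt_gauss_index ns s \<and> fst p = length ns - m" for p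
    using assms by (cases p) (auto simp: step_index_def rt_gauss_index_def idx_Cons image_iff)
  then show ?thesis using assms by (auto simp: drawn_index_def)
qed

lemma finite_rt_gauss_index: "finite (rt_gauss_index ns s)"
proof -
  have "rt_gauss_index ns s \<subseteq> (\<Union>j\<in>{2..length ns}. {j} \<times> idx (s # take (j - 1) ns))"
    by (auto simp: rt_gauss_index_def)
  then show ?thesis by (rule finite_subset) (intro finite_UN_I finite_cartesian_product; simp)
qed

lemma drawn_index_facts:
  "finite (drawn_index ns s m)" "finite (step_index ns s m)" "drawn_index ns s m \<inter> step_index ns s m = {}"
  using finite_rt_gauss_index by (auto simp: drawn_index_def step_index_def)

lemma drawn_index_all: "2 \<le> length ns \<Longrightarrow> drawn_index ns s (length ns - 1) = rt_gauss_index ns s"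
  by (auto simp: drawn_index_def rt_gauss_index_def)

text \<open>The equation covers every \<open>w\<close>, also outside the index set, where points of
  a product space are \<open>undefined\<close>. This is what the congruence lemmas require, as they
  compare whole functions \<open>g j\<close>.\<close>

lemma merge_drawn:
  assumes "\<omega> \<in> space (gauss (drawn_index ns s m))" "length ns - m < j"
  shows "merge (drawn_index ns s m) (step_index ns s m) (\<omega>, \<gamma>) (j, w) = \<omega> (j, w)"
proof (cases "(j, w) \<in> drawn_index ns s m")
  case False
  moreover have "(j, w) \<notin> step_index ns s m" using assms(2) by (auto simp: step_index_def)
  ultimately show ?thesis using assms(1) by (auto simp: merge_def space_PiM PiE_def extensional_def)
qed (simp add: merge_def)

text \<open>The bound holds for every admissible \<open>y\<close> separately; monotone convergence passes to the
  infimum, so that one event serves all \<open>y\<close> simultaneously.\<close>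
lemma step_error2_tail:
  fixes r p :: nat and u t :: real and x :: "nat list \<Rightarrow> real"
  assumes m: "Suc m < length ns" and r: "1 \<le> r" and p: "4 \<le> p" and u: "1 \<le> u" and t: "1 \<le> t"
    and \<omega>: "\<omega> \<in> space (gauss (drawn_index ns (r + p) m))"
  defines "\<eta> \<equiv> 1 + t * sqrt (12 * real r / real p) + u * t * exp 1 * sqrt (real (r + p)) / real (p + 1)"
    and "\<nu> \<equiv> INF y\<in>{y. low_cut_ranks ns r (length ns) y}. sq_norm (idx ns) (\<lambda>w. x w - y w)"
  shows "(\<integral>\<^sup>+\<gamma>. indicator {\<eta>\<^sup>2 * \<nu><..} (step_error2 ns (r + p)
      (\<lambda>j w. merge (drawn_index ns (r + p) m) (step_index ns (r + p) m) (\<omega>, \<gamma>) (j, w)) x m) \<partial>gauss (step_index ns (r + p) m))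
    \<le> ennreal (5 * t powr (- real p) + 2 * exp (- u\<^sup>2 / 2))"
proof -
  define s where "s = r + p"
  define Y where "Y = {y. low_cut_ranks ns r (length ns) y}"
  define N where "N = (\<lambda>y. sq_norm (idx ns) (\<lambda>w. x w - y w))"
  define i where "i = length ns - m - 1"
  have i: "1 \<le> i" "i < length ns - m" "i \<le> length ns" using m by (auto simp: i_def)
  let ?I = "idx (take i ns)" and ?C = "idx (drop i ns)"
  let ?mg = "\<lambda>\<gamma> j w. merge (drawn_index ns s m) (step_index ns s m) (\<omega>, \<gamma>) (j, w)"
  define X where "X = (\<lambda>u v. tt_state ns s (\<lambda>j w. \<omega> (j, w)) x m (u @ v))"
  define \<iota> where "\<iota> = (\<lambda>(k :: nat, u). (length ns - m, k # u :: nat list))"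
  define K where "K = {..<s} \<times> ?I"
  define e where "e = sketch_error2 ?I ?C s X"
  have Yne: "(\<lambda>_. 0) \<in> Y"
    unfolding Y_def low_cut_ranks_def cut_rank_le_def by (auto intro!: exI[of _ "\<lambda>_ _. 0"])
  have \<eta>: "\<eta> > 0" using deviation_bound(2)[OF r p u t] by (simp add: \<eta>_def)
  have err: "step_error2 ns s (?mg \<gamma>) x m = e (\<lambda>q\<in>K. \<gamma> (\<iota> q))" for \<gamma>
  proof -
    have st: "tt_state ns s (?mg \<gamma>) x m = tt_state ns s (\<lambda>j w. \<omega> (j, w)) x m"
      by (rule tt_state_cong) (use m merge_drawn[OF \<omega>[folded s_def]] in auto)
    have "step_error2 ns s (?mg \<gamma>) x m = sketch_error2 ?I ?C s X (\<lambda>(k, u). ?mg \<gamma> (length ns - m) (k # u))"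
      unfolding step_error2_def st X_def i_def ..
    also have "\<dots> = sketch_error2 ?I ?C s X (\<lambda>q\<in>K. \<gamma> (\<iota> q))"
    proof (rule sketch_error2_cong)
      fix k u assume ku: "k < s" "u \<in> ?I"
      then have "(length ns - m, k # u) \<in> step_index ns s m" by (auto simp: step_index_def i_def)
      moreover have "(length ns - m, k # u) \<notin> drawn_index ns s m" by (simp add: drawn_index_def)
      ultimately show "(case (k, u) of (k, u) \<Rightarrow> ?mg \<gamma> (length ns - m) (k # u)) = (\<lambda>q\<in>K. \<gamma> (\<iota> q)) (k, u)"
        using ku by (simp add: merge_def K_def \<iota>_def)
    qed
    finally show ?thesis by (simp add: e_def)
  qed
  have em: "e \<in> borel_measurable (gauss K)"
    unfolding e_def by (intro measurable_sketch_error2 measurable_gauss_component) simp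
  have reindex: "(\<integral>\<^sup>+\<gamma>. f (step_error2 ns s (?mg \<gamma>) x m) \<partial>gauss (step_index ns s m)) = (\<integral>\<^sup>+y. f (e y) \<partial>gauss K)"
    if f: "f \<in> borel_measurable borel" for f :: "real \<Rightarrow> ennreal"
  proof -
    have "(\<integral>\<^sup>+\<gamma>. f (step_error2 ns s (?mg \<gamma>) x m) \<partial>gauss (step_index ns s m))
      = (\<integral>\<^sup>+\<gamma>. (\<lambda>y. f (e y)) (\<lambda>q\<in>K. \<gamma> (\<iota> q)) \<partial>gauss (step_index ns s m))" unfolding err ..
    also have "\<dots> = (\<integral>\<^sup>+y. f (e y) \<partial>gauss K)"
    proof (rule nn_integral_gauss_reindex)
      show "(\<lambda>y. f (e y)) \<in> borel_measurable (gauss K)" by (rule measurable_compose[OF em f])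
    qed (use drawn_index_facts(2) in \<open>auto simp: K_def \<iota>_def inj_on_def step_index_def i_def\<close>)
    finally show ?thesis .
  qed
  have tail: "(\<integral>\<^sup>+y. indicator {\<eta>\<^sup>2 * N y0<..} (e y) \<partial>gauss K) \<le> ennreal (5 * t powr (- real p) + 2 * exp (- u\<^sup>2 / 2))"
    if y0: "y0 \<in> Y" for y0
  proof -
    obtain y' where y': "low_cut_ranks ns r (length ns - m) y'"
      and le: "sq_norm (idx ns) (\<lambda>w. tt_state ns s (\<lambda>j w. \<omega> (j, w)) x m w - y' w) \<le> N y0"
      using tt_state_approx[of m ns r y0 s "\<lambda>j w. \<omega> (j, w)" x] y0 m by (auto simp: Y_def N_def)
    \<comment> \<open>Here \<open>i\<close> is the largest cut at which \<open>y'\<close> is still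
      known to have low rank, precisely the one sketched in this step.\<close>
    obtain L R where LR: "\<forall>u\<in>?I. \<forall>v\<in>?C. y' (u @ v) = (\<Sum>k<r. L k u * R k v)"
      using y' i unfolding low_cut_ranks_def cut_rank_le_def by blast
    have E: "(\<Sum>u\<in>?I. \<Sum>v\<in>?C. (X u v - y' (u @ v))\<^sup>2) \<le> N y0"
      using le unfolding ip_def X_def by (subst (asm) sum_idx_cut[of _ ns i]) (simp add: power2_eq_square)
    have "(\<integral>\<^sup>+y. indicator {\<eta>\<^sup>2 * N y0<..} (e y) \<partial>gauss K)
      \<le> (\<integral>\<^sup>+y. indicator {\<eta>\<^sup>2 * (\<Sum>u\<in>?I. \<Sum>v\<in>?C. (X u v - y' (u @ v))\<^sup>2)<..} (e y) \<partial>gauss K)"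
    proof (intro nn_integral_mono)
      fix y
      have "\<eta>\<^sup>2 * (\<Sum>u\<in>?I. \<Sum>v\<in>?C. (X u v - y' (u @ v))\<^sup>2) \<le> \<eta>\<^sup>2 * N y0"
        by (rule mult_left_mono[OF E]) simp
      then show "indicator {\<eta>\<^sup>2 * N y0<..} (e y) \<le> (indicator {\<eta>\<^sup>2 * (\<Sum>u\<in>?I. \<Sum>v\<in>?C. (X u v - y' (u @ v))\<^sup>2)<..} (e y) :: ennreal)"
        by (auto simp: indicator_def)
    qed
    also have "\<dots> \<le> ennreal (5 * t powr (- real p) + 2 * exp (- u\<^sup>2 / 2))"
      unfolding e_def K_def s_def \<eta>_def
      by (rule randomized_range_finder[where L = L and R = R]) (use r p u t LR in auto)
    finally show ?thesis .
  qed
  define c where "c = \<eta>\<^sup>2 * \<nu>"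
  have \<nu>: "\<nu> = Inf (N ` Y)" by (simp add: \<nu>_def N_def Y_def)
  define F where "F = (\<lambda>n y. indicator {\<eta>\<^sup>2 * (\<nu> + 1 / real (Suc n))<..} (e y) :: ennreal)"
  have Fle: "(\<integral>\<^sup>+y. F n y \<partial>gauss K) \<le> ennreal (5 * t powr (- real p) + 2 * exp (- u\<^sup>2 / 2))" for n
  proof -
    have "Inf (N ` Y) < \<nu> + 1 / real (Suc n)" by (simp add: \<nu>)
    then obtain y0 where y0: "y0 \<in> Y" "N y0 < \<nu> + 1 / real (Suc n)"
      using cInf_lessD[of "N ` Y"] Yne by blast
    have "(\<integral>\<^sup>+y. F n y \<partial>gauss K) \<le> (\<integral>\<^sup>+y. indicator {\<eta>\<^sup>2 * N y0<..} (e y) \<partial>gauss K)"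
    proof (intro nn_integral_mono)
      fix y
      have "\<eta>\<^sup>2 * N y0 \<le> \<eta>\<^sup>2 * (\<nu> + 1 / real (Suc n))" using y0 by (intro mult_left_mono) auto
      then show "F n y \<le> indicator {\<eta>\<^sup>2 * N y0<..} (e y)" by (auto simp: F_def indicator_def)
    qed
    also have "\<dots> \<le> ennreal (5 * t powr (- real p) + 2 * exp (- u\<^sup>2 / 2))" by (rule tail[OF y0(1)])
    finally show ?thesis .
  qed
  have Fmeas: "F n \<in> borel_measurable (gauss K)" for n
    unfolding F_def by (rule measurable_compose[OF em]) auto
  have inc: "incseq F"
  proof (rule incseq_SucI, rule le_funI)
    fix n y
    have "\<eta>\<^sup>2 * (\<nu> + 1 / real (Suc (Suc n))) \<le> \<eta>\<^sup>2 * (\<nu> + 1 / real (Suc n))"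
      by (intro mult_left_mono add_left_mono frac_le) auto
    then show "F n y \<le> F (Suc n) y" by (auto simp: F_def indicator_def)
  qed
  have "(\<integral>\<^sup>+y. indicator {c<..} (e y) \<partial>gauss K) \<le> (\<integral>\<^sup>+y. (SUP n. F n y) \<partial>gauss K)"
  proof (intro nn_integral_mono)
    fix y
    show "indicator {c<..} (e y) \<le> (SUP n. F n y)"
    proof (cases "c < e y")
      case True
      then have "(e y - c) / \<eta>\<^sup>2 > 0" using \<eta> by simp
      then obtain n where n: "inverse (real (Suc n)) < (e y - c) / \<eta>\<^sup>2" using reals_Archimedean by blast
      then have "\<eta>\<^sup>2 * (\<nu> + 1 / real (Suc n)) < e y" using \<eta> by (simp add: c_def field_simps)
      then have "indicator {c<..} (e y) \<le> F n y" using True by (simp add: F_def)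
      also have "F n y \<le> (SUP n. F n y)" by (rule SUP_upper) simp
      finally show ?thesis .
    qed simp
  qed
  also have "\<dots> = (SUP n. \<integral>\<^sup>+y. F n y \<partial>gauss K)"
    by (rule nn_integral_monotone_convergence_SUP[OF inc Fmeas])
  also have "\<dots> \<le> ennreal (5 * t powr (- real p) + 2 * exp (- u\<^sup>2 / 2))" by (rule SUP_least) (rule Fle)
  finally have "(\<integral>\<^sup>+y. indicator {c<..} (e y) \<partial>gauss K) \<le> ennreal (5 * t powr (- real p) + 2 * exp (- u\<^sup>2 / 2))" .
  then show ?thesis
    using reindex[of "indicator {c<..}"] by (simp add: c_def s_def)
qed

text \<open>The steps are dependent, but the failure probability of each is bounded uniformly in the
  earlier draws, so integrating over the newest draws first multiplies the success probabilities.
  Earlier step errors are constants in that inner integral.\<close>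

lemma step_errors_chain:
  fixes r p :: nat and u t :: real and x :: "nat list \<Rightarrow> real"
  assumes r: "1 \<le> r" and p: "4 \<le> p" and u: "1 \<le> u" and t: "1 \<le> t" and m: "m < length ns"
  defines "\<eta> \<equiv> 1 + t * sqrt (12 * real r / real p) + u * t * exp 1 * sqrt (real (r + p)) / real (p + 1)"
    and "\<nu> \<equiv> INF y\<in>{y. low_cut_ranks ns r (length ns) y}. sq_norm (idx ns) (\<lambda>w. x w - y w)"
  shows "ennreal (max 0 (1 - 5 * t powr (- real p) - 2 * exp (- u\<^sup>2 / 2))) ^ m
    \<le> (\<integral>\<^sup>+\<omega>. (\<Prod>i<m. indicator {..\<eta>\<^sup>2 * \<nu>} (step_error2 ns (r + p) (\<lambda>j w. \<omega> (j, w)) x i)) \<partial>gauss (drawn_index ns (r + p) m))"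
  using m
proof (induction m)
  case 0
  interpret prob_space "gauss (drawn_index ns (r + p) 0)" by (rule prob_space_gauss)
  show ?case by (simp add: emeasure_space_1)
next
  case (Suc m)
  define \<pi> where "\<pi> = ennreal (max 0 (1 - 5 * t powr (- real p) - 2 * exp (- u\<^sup>2 / 2)))"
  define \<delta> where "\<delta> = 5 * t powr (- real p) + 2 * exp (- u\<^sup>2 / 2)"
  define s where "s = r + p"
  define A where "A = drawn_index ns s m"
  define B where "B = step_index ns s m"
  define c where "c = \<eta>\<^sup>2 * \<nu>"
  define P where "P = (\<lambda>\<omega> i. indicator {..c} (step_error2 ns s (\<lambda>j w. \<omega> (j, w)) x i) :: ennreal)"
  interpret B: prob_space "gauss B" by (rule prob_space_gauss)
  have AB: "drawn_index ns s (Suc m) = A \<union> B" "finite A" "finite B" "A \<inter> B = {}"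
    using drawn_index_Suc[of m ns s] drawn_index_facts[of ns s m] Suc.prems by (auto simp: A_def B_def)
  have Pm: "(\<lambda>\<omega>. P \<omega> i) \<in> borel_measurable (gauss D)" for i D
    unfolding P_def by (rule measurable_compose[OF measurable_step_error2]) auto
  have Pprod: "(\<lambda>\<omega>. \<Prod>i<n. P \<omega> i) \<in> borel_measurable (gauss D)" for n D
    by (intro borel_measurable_prod_ennreal Pm)
  have IH: "\<pi> ^ m \<le> (\<integral>\<^sup>+\<omega>. (\<Prod>i<m. P \<omega> i) \<partial>gauss A)"
    using Suc.IH Suc.prems by (simp add: \<pi>_def P_def A_def s_def c_def)
  have "\<pi> ^ Suc m = \<pi> ^ m * \<pi>" by (simp add: mult.commute)
  also have "\<dots> \<le> (\<integral>\<^sup>+\<omega>. (\<Prod>i<m. P \<omega> i) \<partial>gauss A) * \<pi>" by (rule mult_right_mono[OF IH]) simp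
  also have "\<dots> = (\<integral>\<^sup>+\<omega>. (\<Prod>i<m. P \<omega> i) * \<pi> \<partial>gauss A)"
    by (rule nn_integral_multc[symmetric]) (rule Pprod)
  also have "\<dots> \<le> (\<integral>\<^sup>+\<omega>. \<integral>\<^sup>+\<gamma>. (\<Prod>i<Suc m. P (merge A B (\<omega>, \<gamma>)) i) \<partial>gauss B \<partial>gauss A)"
  proof (rule nn_integral_mono)
    fix \<omega> assume \<omega>: "\<omega> \<in> space (gauss A)"
    have old: "P (merge A B (\<omega>, \<gamma>)) i = P \<omega> i" if "i < m" for i \<gamma>
    proof -
      have "step_error2 ns s (\<lambda>j w. merge A B (\<omega>, \<gamma>) (j, w)) x i = step_error2 ns s (\<lambda>j w. \<omega> (j, w)) x i"
        by (rule step_error2_cong) (use that Suc.prems merge_drawn[OF \<omega>[unfolded A_def]] in \<open>auto simp: A_def B_def\<close>)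
      then show ?thesis by (simp add: P_def)
    qed
    define e where "e = (\<lambda>\<gamma>. step_error2 ns s (\<lambda>j w. merge A B (\<omega>, \<gamma>) (j, w)) x m)"
    have mg: "(\<lambda>\<gamma>. merge A B (\<omega>, \<gamma>)) \<in> measurable (gauss B) (gauss (A \<union> B))"
      using measurable_compose[OF measurable_Pair1'[OF \<omega>] measurable_merge[of A B "\<lambda>_. stdn"]] .
    have em: "e \<in> borel_measurable (gauss B)"
      unfolding e_def by (rule measurable_compose[OF mg measurable_step_error2])
    have "(\<integral>\<^sup>+\<gamma>. indicator {c<..} (e \<gamma>) \<partial>gauss B) \<le> ennreal \<delta>"
      using step_error2_tail[OF Suc.prems r p u t \<omega>[unfolded A_def s_def], of x]
      by (simp add: e_def A_def B_def s_def c_def \<eta>_def \<nu>_def \<delta>_def)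
    moreover have "(\<integral>\<^sup>+\<gamma>. indicator {..c} (e \<gamma>) \<partial>gauss B) + (\<integral>\<^sup>+\<gamma>. indicator {c<..} (e \<gamma>) \<partial>gauss B) = 1"
    proof -
      have "(\<integral>\<^sup>+\<gamma>. indicator {..c} (e \<gamma>) \<partial>gauss B) + (\<integral>\<^sup>+\<gamma>. indicator {c<..} (e \<gamma>) \<partial>gauss B)
        = (\<integral>\<^sup>+\<gamma>. indicator {..c} (e \<gamma>) + indicator {c<..} (e \<gamma>) \<partial>gauss B)"
        by (rule nn_integral_add[symmetric]) (rule measurable_compose[OF em]; simp)+
      also have "\<dots> = (\<integral>\<^sup>+\<gamma>. 1 \<partial>gauss B)" by (rule nn_integral_cong) (auto simp: indicator_def)
      finally show ?thesis by (simp add: B.emeasure_space_1)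
    qed
    ultimately have "1 \<le> (\<integral>\<^sup>+\<gamma>. indicator {..c} (e \<gamma>) \<partial>gauss B) + ennreal \<delta>" by (metis add_left_mono)
    then have "1 - ennreal \<delta> \<le> (\<integral>\<^sup>+\<gamma>. indicator {..c} (e \<gamma>) \<partial>gauss B)"
      by (simp add: ennreal_minus_le_iff add.commute)
    \<comment> \<open>Subtraction in \<open>ennreal\<close> is truncated, which matches the maximum
      with 0 in \<open>\<pi>\<close>.\<close>
    moreover have "\<pi> = 1 - ennreal \<delta>"
    proof -
      have "\<delta> \<ge> 0" by (simp add: \<delta>_def)
      then have "1 - ennreal \<delta> = ennreal (1 - \<delta>)" using ennreal_minus[of \<delta> 1] by simp
      moreover have "1 - 5 * t powr (- real p) - 2 * exp (- u\<^sup>2 / 2) = 1 - \<delta>" by (simp add: \<delta>_def)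
      ultimately show ?thesis unfolding \<pi>_def by (cases "1 - \<delta> \<ge> 0") (simp_all add: max_def ennreal_neg)
    qed
    ultimately have "(\<Prod>i<m. P \<omega> i) * \<pi> \<le> (\<Prod>i<m. P \<omega> i) * (\<integral>\<^sup>+\<gamma>. indicator {..c} (e \<gamma>) \<partial>gauss B)"
      by (intro mult_left_mono) auto
    also have "\<dots> = (\<integral>\<^sup>+\<gamma>. (\<Prod>i<m. P \<omega> i) * indicator {..c} (e \<gamma>) \<partial>gauss B)"
      by (rule nn_integral_cmult[symmetric]) (rule measurable_compose[OF em]; simp)
    also have "\<dots> = (\<integral>\<^sup>+\<gamma>. (\<Prod>i<Suc m. P (merge A B (\<omega>, \<gamma>)) i) \<partial>gauss B)"
    proof (rule nn_integral_cong)
      fix \<gamma>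
      have "(\<Prod>i<m. P (merge A B (\<omega>, \<gamma>)) i) = (\<Prod>i<m. P \<omega> i)" using old by (intro prod.cong) auto
      then show "(\<Prod>i<m. P \<omega> i) * indicator {..c} (e \<gamma>) = (\<Prod>i<Suc m. P (merge A B (\<omega>, \<gamma>)) i)"
        by (simp add: P_def e_def)
    qed
    finally show "(\<Prod>i<m. P \<omega> i) * \<pi> \<le> (\<integral>\<^sup>+\<gamma>. (\<Prod>i<Suc m. P (merge A B (\<omega>, \<gamma>)) i) \<partial>gauss B)" .
  qed
  also have "\<dots> = (\<integral>\<^sup>+\<omega>. (\<Prod>i<Suc m. P \<omega> i) \<partial>gauss (A \<union> B))"
    by (rule stdn_prod.product_nn_integral_fold[OF AB(4,2,3) Pprod, symmetric])
  finally show ?case by (simp only: \<pi>_def P_def AB(1)[symmetric] s_def c_def)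
qed

theorem theorem2:
  fixes ns :: "nat list" and x :: "nat list \<Rightarrow> real" and r p s :: nat and u t :: real
  assumes "length ns \<ge> 2" and "r \<ge> 1" and "p \<ge> 4" and "s = r + p"
    and "u \<ge> 1" and "t \<ge> 1"
  shows "\<exists>E \<in> sets (rt_measure ns s).
    measure (rt_measure ns s) E \<ge>
      (max 0 (1 - 5 * t powr (- real p) - 2 * exp (- u\<^sup>2 / 2))) ^ (length ns - 1) \<and>
    (\<forall>\<omega>\<in>E. \<forall>q W b. rt_run ns x s (\<lambda>j is. \<omega> (j, is)) q W b \<longrightarrow>
       (\<forall>y. list_all2 (\<le>) (tt_rank ns y) (replicate (length ns - 1) r) \<longrightarrow>
          tnorm ns (\<lambda>is. x is - rt_output ns s q W b is) \<le>
            sqrt (real (length ns - 1)) *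
            (1 + t * sqrt (12 * real r / real p)
               + u * t * exp 1 * sqrt (real (r + p)) / real (p + 1)) *
            tnorm ns (\<lambda>is. x is - y is)))"
proof -
  define \<eta> where "\<eta> = 1 + t * sqrt (12 * real r / real p) + u * t * exp 1 * sqrt (real (r + p)) / real (p + 1)"
  define N where "N = (\<lambda>y. sq_norm (idx ns) (\<lambda>w. x w - y w))"
  define \<nu> where "\<nu> = (INF y\<in>{y. low_cut_ranks ns r (length ns) y}. N y)"
  define \<pi> where "\<pi> = max 0 (1 - 5 * t powr (- real p) - 2 * exp (- u\<^sup>2 / 2))"
  define n where "n = length ns - 1"
  define M where "M = rt_measure ns s"
  have M: "M = gauss (drawn_index ns s n)"
    using drawn_index_all[OF assms(1)] by (simp add: M_def rt_measure_def n_def)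
  interpret prob_space M unfolding M by (rule prob_space_gauss)
  let ?e = "\<lambda>\<omega> i. step_error2 ns s (\<lambda>j w. \<omega> (j, w)) x i"
  \<comment> \<open>The event refers only to the basis-free step errors and to the infimum over
    \<open>y\<close>, so it is measurable and serves all runs and all \<open>y\<close>
    simultaneously.\<close>
  define E where "E = {\<omega> \<in> space M. \<forall>i\<in>{..<n}. ?e \<omega> i \<le> \<eta>\<^sup>2 * \<nu>}"
  have em: "(\<lambda>\<omega>. ?e \<omega> i) \<in> borel_measurable M" for i
    unfolding M by (rule measurable_step_error2)
  have E: "E \<in> sets M"
    unfolding E_def by (intro sets.sets_Collect_finite_All borel_measurable_le em) auto
  have nl: "n < length ns" using assms(1) by (simp add: n_def)
  have "0 \<le> \<pi>" by (simp add: \<pi>_def)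
  then have "ennreal (\<pi> ^ n) = ennreal \<pi> ^ n" by (simp add: ennreal_power)
  also have "\<dots> \<le> (\<integral>\<^sup>+\<omega>. (\<Prod>i<n. indicator {..\<eta>\<^sup>2 * \<nu>} (?e \<omega> i)) \<partial>M)"
    unfolding \<pi>_def M \<eta>_def \<nu>_def N_def assms(4) by (rule step_errors_chain[OF assms(2,3,5,6) nl])
  also have "\<dots> = (\<integral>\<^sup>+\<omega>. indicator E \<omega> \<partial>M)"
  proof (rule nn_integral_cong)
    fix \<omega> assume "\<omega> \<in> space M"
    then show "(\<Prod>i<n. indicator {..\<eta>\<^sup>2 * \<nu>} (?e \<omega> i)) = (indicator E \<omega> :: ennreal)"
      by (auto simp: E_def indicator_def prod_zero_iff)
  qed
  also have "\<dots> = ennreal (measure M E)" using E by (simp add: emeasure_eq_measure)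
  finally have prob: "\<pi> ^ n \<le> measure M E" by simp
  have bound: "tnorm ns (\<lambda>w. x w - rt_output ns s q W b w) \<le> sqrt (real n) * \<eta> * tnorm ns (\<lambda>w. x w - y w)"
    if \<omega>: "\<omega> \<in> E" and run: "rt_run ns x s (\<lambda>j w. \<omega> (j, w)) q W b"
      and y: "list_all2 (\<le>) (tt_rank ns y) (replicate (length ns - 1) r)" for \<omega> q W b y
  proof -
    interpret tt_run ns x s "\<lambda>j w. \<omega> (j, w)" q W b by standard (rule assms(1), rule run)
    have "low_cut_ranks ns r (length ns) y"
      using tt_rank_le_cut_rank_le[OF assms(1) y] by (simp add: low_cut_ranks_def)
    then have \<nu>: "\<nu> \<le> N y"
      unfolding \<nu>_def by (intro cINF_lower bdd_belowI[of _ 0]) (auto simp: N_def)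
    have \<eta>: "\<eta> \<ge> 0" using deviation_bound(2)[OF assms(2,3,5,6)] by (simp add: \<eta>_def)
    have N: "N y = (tnorm ns (\<lambda>w. x w - y w))\<^sup>2"
      by (simp add: N_def tnorm_def ip_def sum_nonneg power2_eq_square)
    have "(tnorm ns (\<lambda>w. x w - rt_output ns s q W b w))\<^sup>2 = (\<Sum>m<n. ?e \<omega> m)"
      unfolding n_def by (rule rt_output_error)
    also have "\<dots> \<le> (\<Sum>m<n. \<eta>\<^sup>2 * N y)"
    proof (rule sum_mono)
      fix m assume "m \<in> {..<n}"
      then have "?e \<omega> m \<le> \<eta>\<^sup>2 * \<nu>" using \<omega> by (auto simp: E_def)
      also have "\<dots> \<le> \<eta>\<^sup>2 * N y" by (intro mult_left_mono \<nu>) simp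
      finally show "?e \<omega> m \<le> \<eta>\<^sup>2 * N y" .
    qed
    also have "\<dots> = (sqrt (real n) * \<eta> * tnorm ns (\<lambda>w. x w - y w))\<^sup>2"
      by (simp add: N power_mult_distrib)
    finally show ?thesis
      by (rule power2_le_imp_le) (use \<eta> in \<open>simp add: tnorm_def sum_nonneg\<close>)
  qed
  show ?thesis
    using E prob bound unfolding M_def n_def \<pi>_def \<eta>_def by blast
qed

end
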